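(* Let $q$ be an odd prime and $k\ge1$ a natural number. Let $S=\{s_j\}_{j=1}^{m}\subset\mathbb{Z}\setminus\{0\}$ be a finite set of integers not containing a perfect $q$-th power, and assume that $S\in\mathcal{T}_{k,q}$. Then every set $T=\{t_j\}_{j=1}^{\ell}$ that is geometric $q$-equivalent to $S$ belongs to $\mathcal{T}_{k,q}$.
   Context: An integer is a perfect $q$-th power if it equals $r^q$ for some $r\in\mathbb{Q}$. For a positive integer $r=\prod_i p_i^{a_i}$ (prime factorization), $\mathrm{rad}_q(r):=\prod_i p_i^{a_i \bmod q}$, where $a_i \bmod q\in\{0,\dots,q-1\}$. For a natural number $N$, $\Omega(N)$ is the number of prime factors of $N$ counted with multiplicity. A finite set $S\subset\mathbb{Z}$ contains a $q$-th power modulo $N$ if there are $s\in S$ and $x\in\mathbb{Z}$ with $x^q\equiv s \pmod N$. $S$ contains a $q$-th power modulo almost every natural number $N$ with $\Omega(N)\le k$ if there exists a natural number $\Delta$ (depending on $S$) such that for every natural number $N$ with $\Omega(N)\le k$ and $\gcd(N,\Delta)=1$, $S$ contains a $q$-th power modulo $N$. $\mathcal{T}_{k,q}$ is the collection of all finite subsets $S\subset\mathbb{Z}$ that contain a $q$-th power modulo almost every natural number $N$ with $\Omega(N)\le k$. $\mathrm{PG}(\mathbb{F}_q^n)$ is the projective space of one-dimensional subspaces of $\mathbb{F}_q^n$; $\langle v\rangle$ is the point spanned by $v\neq0$. Geometric $q$-equivalence: let $S=\{s_j\}_{j=1}^{m}$ and $T=\{t_j\}_{j=1}^{\ell}$ be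 two finite sets of non-zero integers not containing a perfect $q$-th power. Let $p_1,\dots,p_n$ be all the distinct primes dividing $\prod_{j=1}^m\mathrm{rad}_q(|s_j|)\cdot\prod_{j=1}^\ell\mathrm{rad}_q(|t_j|)$, and write $\mathrm{rad}_q(|s_j|)=\prod_{i=1}^n p_i^{\nu_{ij}}$, $\mathrm{rad}_q(|t_j|)=\prod_{i=1}^n p_i^{\mu_{ij}}$ with $\nu_{ij},\mu_{ij}\ge0$. Put $\mathcal{S}=\{\langle(\nu_{1j},\dots,\nu_{nj})\rangle:1\le j\le m\}$ and $\mathcal{T}=\{\langle(\mu_{1j},\dots,\mu_{nj})\rangle:1\le j\le\ell\}$, subsets of $\mathrm{PG}(\mathbb{F}_q^n)$. Then $S$ and $T$ are geometric $q$-equivalent if and only if there exists $\Psi\in\mathrm{PGL}(n,q)$ such that $\Psi(\mathcal{S})=\mathcal{T}$. *)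

theory Defs
  imports "HOL-Number_Theory.Number_Theory"
begin

definition perfect_power :: "nat \<Rightarrow> int \<Rightarrow> bool" where
  "perfect_power q s \<longleftrightarrow> (\<exists>r::rat. of_int s = r ^ q)"

definition rad :: "nat \<Rightarrow> nat \<Rightarrow> nat" where
  "rad q r = (\<Prod>p\<in>prime_factors r. p ^ (multiplicity p r mod q))"

definition big_omega :: "nat \<Rightarrow> nat" where
  "big_omega N = size (prime_factorization N)"

definition contains_power_mod :: "nat \<Rightarrow> int set \<Rightarrow> nat \<Rightarrow> bool" where
  "contains_power_mod q S N \<longleftrightarrow> (\<exists>s\<in>S. \<exists>x::int. [x ^ q = s] (mod int N))"

text \<open>Natural numbers are positive here: \<open>\<Delta> = 0\<close> would only leave \<open>N = 1\<close>, and
  \<open>big_omega 0 = 0\<close> is an artefact of the library.\<close>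

definition contains_power_mod_almost_all :: "nat \<Rightarrow> nat \<Rightarrow> int set \<Rightarrow> bool" where
  "contains_power_mod_almost_all k q S \<longleftrightarrow>
     (\<exists>\<Delta>::nat. \<Delta> > 0 \<and>
        (\<forall>N::nat. N > 0 \<longrightarrow> big_omega N \<le> k \<longrightarrow> coprime N \<Delta> \<longrightarrow> contains_power_mod q S N))"

definition power_sets :: "nat \<Rightarrow> nat \<Rightarrow> int set set" where
  "power_sets k q = {S. finite S \<and> contains_power_mod_almost_all k q S}"

text \<open>The field with \<open>q\<close> elements, for \<open>q\<close> prime; its carrier is \<open>{0..int q - 1}\<close>.
  Vectors and matrices are extensional functions on \<open>{..<n}\<close>, i.e. the mathematical
  indices \<open>1, \<dots>, n\<close> are shifted to \<open>0, \<dots>, n - 1\<close>.\<close>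

abbreviation Fq :: "nat \<Rightarrow> int ring" where
  "Fq q \<equiv> residue_ring (int q)"

definition vecs :: "nat \<Rightarrow> nat \<Rightarrow> (nat \<Rightarrow> int) set" where
  "vecs n q = ({..<n} \<rightarrow>\<^sub>E carrier (Fq q))"

definition zero_vec :: "nat \<Rightarrow> nat \<Rightarrow> nat \<Rightarrow> int" where
  "zero_vec n q = (\<lambda>i\<in>{..<n}. \<zero>\<^bsub>Fq q\<^esub>)"

definition scale_vec :: "nat \<Rightarrow> nat \<Rightarrow> int \<Rightarrow> (nat \<Rightarrow> int) \<Rightarrow> nat \<Rightarrow> int" where
  "scale_vec n q c v = (\<lambda>i\<in>{..<n}. c \<otimes>\<^bsub>Fq q\<^esub> v i)"

definition point :: "nat \<Rightarrow> nat \<Rightarrow> (nat \<Rightarrow> int) \<Rightarrow> (nat \<Rightarrow> int) set" where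
  "point n q v = {scale_vec n q c v | c. c \<in> carrier (Fq q)}"

definition PG :: "nat \<Rightarrow> nat \<Rightarrow> (nat \<Rightarrow> int) set set" where
  "PG n q = {point n q v | v. v \<in> vecs n q \<and> v \<noteq> zero_vec n q}"

definition matrix_monoid :: "nat \<Rightarrow> nat \<Rightarrow> (nat \<Rightarrow> nat \<Rightarrow> int) monoid" where
  "matrix_monoid n q =
     \<lparr>carrier = {..<n} \<rightarrow>\<^sub>E ({..<n} \<rightarrow>\<^sub>E carrier (Fq q)),
      monoid.mult = (\<lambda>A B. \<lambda>i\<in>{..<n}. \<lambda>j\<in>{..<n}. \<Oplus>\<^bsub>Fq q\<^esub>l\<in>{..<n}. A i l \<otimes>\<^bsub>Fq q\<^esub> B l j),
      one = (\<lambda>i\<in>{..<n}. \<lambda>j\<in>{..<n}. if i = j then \<one>\<^bsub>Fq q\<^esub> else \<zero>\<^bsub>Fq q\<^esub>)\<rparr>"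

definition GL :: "nat \<Rightarrow> nat \<Rightarrow> (nat \<Rightarrow> nat \<Rightarrow> int) set" where
  "GL n q = Units (matrix_monoid n q)"

definition mat_vec :: "nat \<Rightarrow> nat \<Rightarrow> (nat \<Rightarrow> nat \<Rightarrow> int) \<Rightarrow> (nat \<Rightarrow> int) \<Rightarrow> nat \<Rightarrow> int" where
  "mat_vec n q A v = (\<lambda>i\<in>{..<n}. \<Oplus>\<^bsub>Fq q\<^esub>j\<in>{..<n}. A i j \<otimes>\<^bsub>Fq q\<^esub> v j)"

text \<open>\<open>PGL n q\<close> as the group of permutations of \<open>PG n q\<close> induced by \<open>GL n q\<close>. Scalar matrices
  are exactly the matrices in \<open>GL n q\<close> that act trivially, so this is the quotient of \<open>GL n q\<close>
  by its scalars.\<close>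

definition PGL :: "nat \<Rightarrow> nat \<Rightarrow> ((nat \<Rightarrow> int) set \<Rightarrow> (nat \<Rightarrow> int) set) set" where
  "PGL n q = {(\<lambda>X\<in>PG n q. mat_vec n q A ` X) | A. A \<in> GL n q}"

text \<open>The primes \<open>p\<^sub>1, \<dots>, p\<^sub>n\<close>, listed in increasing order; another order would only change the
  coordinates by a permutation matrix.\<close>

definition rad_primes :: "nat \<Rightarrow> int set \<Rightarrow> int set \<Rightarrow> nat list" where
  "rad_primes q S T = sorted_list_of_set
     (prime_factors ((\<Prod>s\<in>S. rad q (nat \<bar>s\<bar>)) * (\<Prod>t\<in>T. rad q (nat \<bar>t\<bar>))))"

definition exponent_vec :: "nat \<Rightarrow> nat list \<Rightarrow> int \<Rightarrow> nat \<Rightarrow> int" where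
  "exponent_vec q ps s =
     (\<lambda>i\<in>{..<length ps}. int (multiplicity (ps ! i) (rad q (nat \<bar>s\<bar>))) mod int q)"

definition point_set :: "nat \<Rightarrow> nat list \<Rightarrow> int set \<Rightarrow> (nat \<Rightarrow> int) set set" where
  "point_set q ps S = (\<lambda>s. point (length ps) q (exponent_vec q ps s)) ` S"

definition power_free_set :: "nat \<Rightarrow> int set \<Rightarrow> bool" where
  "power_free_set q S \<longleftrightarrow> finite S \<and> 0 \<notin> S \<and> (\<forall>s\<in>S. \<not> perfect_power q s)"

definition geometric_equivalent :: "nat \<Rightarrow> int set \<Rightarrow> int set \<Rightarrow> bool" where
  "geometric_equivalent q S T \<longleftrightarrow>
     power_free_set q S \<and> power_free_set q T \<and>
     (let ps = rad_primes q S T in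
        \<exists>\<Psi>\<in>PGL (length ps) q. \<Psi> ` point_set q ps S = point_set q ps T)"

end

theory Submission
  imports Defs "HOL-Computational_Algebra.Polynomial_Factorial"
    "HOL-Computational_Algebra.Fundamental_Theorem_Algebra" "HOL-Computational_Algebra.Nth_Powers"
begin

text \<open>
  For \<open>N\<close> prime to \<open>q\<close> and to an integer \<open>t\<close>, whether \<open>t\<close> is a \<open>q\<close>-th power modulo \<open>N\<close> is
  decided modulo the primes \<open>p\<close> that divide \<open>N\<close> (Hensel lifting and the Chinese remainder
  theorem), and only those with \<open>p \<equiv> 1 (mod q)\<close> impose a condition. For such a \<open>p\<close>, the
  exponent vectors \<open>v\<close> for which \<open>\<Prod>\<^sub>i p\<^sub>i ^ v\<^sub>i\<close> is a \<open>q\<close>-th power residue modulo \<open>p\<close>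
  are the kernel \<open>H\<^sub>p\<close> of a linear form over the field with \<open>q\<close> elements. Let the matrix
  \<open>A\<close> map the points of \<open>S\<close> onto those of \<open>T\<close>, and let \<open>N\<close> have at most \<open>k\<close> prime factors.
  Replace every \<open>p\<close> that divides \<open>N\<close>, unless it imposes nothing, by a large prime \<open>r\<close> with
  \<open>H\<^sub>r = A\<inverse> H\<^sub>p\<close>. The product of these \<open>r\<close> has at most \<open>k\<close> prime factors, so some \<open>s \<in> S\<close>
  is a \<open>q\<close>-th power modulo it, and an element of \<open>T\<close> on the image of the point of \<open>s\<close> is
  then a \<open>q\<close>-th power modulo \<open>N\<close>.

  So all rests on \<open>ex_prime_with_residue_kernel\<close>: the kernel of every nonzero form is \<open>H\<^sub>r\<close>
  for arbitrarily large primes \<open>r\<close>. This is a case of the Frobenius density theorem for the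
  field generated by the \<open>q\<close>-th roots of unity and of the \<open>p\<^sub>i\<close>, but it follows from
  information on single radicals. By \<open>root_count_average\<close>, a monic irreducible integer
  polynomial has on average one root modulo \<open>p\<close>, when primes are weighted by \<open>ln p / p\<close>.
  For \<open>x\<^sup>q - m\<close> with \<open>m\<close> not a \<open>q\<close>-th power, this says that the weights \<open>q [v \<in> H\<^sub>p] - 1\<close>,
  summed over \<open>p \<equiv> 1 (mod q)\<close>, cancel for every single vector \<open>v \<noteq> 0\<close>. If \<open>K\<close> is the kernel
  of a nonzero form, \<open>q \<Sum>\<^sub>v\<^sub>\<in>\<^sub>K - \<Sum>\<^sub>v\<close> of these weights is at most \<open>0\<close> for every
  \<open>p\<close> with \<open>H\<^sub>p \<noteq> K\<close>, by counting (\<open>kernel_count\<close>). On the other hand the zero vector alone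
  contributes \<open>(q - 1)\<^sup>2\<close> for each \<open>p \<equiv> 1 (mod q)\<close>, and the weighted sum over those primes
  diverges (\<open>log_sum_primes_1_mod\<close>, again by \<open>root_count_average\<close>, now for a factor of a
  cyclotomic polynomial). So \<open>H\<^sub>p = K\<close> cannot fail for all large \<open>p\<close>.

  The average number of roots is found by counting in the ring of integer polynomials
  modulo \<open>g\<close>, of rank \<open>d\<close>. An ideal of index \<open>D\<close>, small compared with \<open>X\<^sup>d\<close>, contains about
  \<open>X\<^sup>d / D\<close> of the \<open>X\<^sup>d\<close> points of a box of side \<open>X\<close>: by the pigeonhole principle it has a
  nonzero element \<open>\<alpha>\<close> with coefficients of size at most \<open>D\<close> to the power \<open>1/d\<close>, and
  division by \<open>\<alpha>\<close> gives representatives of all residue classes that are equally small. The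
  norm of \<open>z\<close>, defined as the index of the ideal generated by \<open>z\<close>, is of size \<open>X\<^sup>d\<close> on
  suitable boxes, so that its logarithm is \<open>d ln X + O(1)\<close>. It is at least the product of
  all primes \<open>p\<close>, one factor for each common root of \<open>g\<close> and \<open>z\<close> modulo \<open>p\<close>
  (\<open>common_roots_bound\<close>), and equal to it for all but a small proportion of the \<open>z\<close> in a
  suitable residue class (\<open>ideal_norm_le_prod_common_roots\<close>). Summing over \<open>z\<close> in a box and
  exchanging sums gives both bounds for \<open>\<Sum> \<rho>(p) ln p / p\<close>, where \<open>\<rho>(p)\<close> is the number
  of roots modulo \<open>p\<close>.
\<close>

section \<open>Bounds for sums over primes\<close>

definition primes_le :: "nat \<Rightarrow> nat set" where
  "primes_le n = {p. prime p \<and> p \<le> n}"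

lemma finite_primes_le [simp]: "finite (primes_le n)"
  by (rule finite_subset[of _ "{..n}"]) (auto simp: primes_le_def)

lemma ln_primes_le_nonneg: "p \<in> primes_le n \<Longrightarrow> 0 \<le> ln (real p)"
  using prime_ge_1_nat[of p] by (simp add: primes_le_def)

lemma prod_primes_dvd:
  assumes "finite A" "\<And>p. p \<in> A \<Longrightarrow> prime (p::nat) \<and> p dvd m"
  shows "\<Prod>A dvd m"
  using assms
proof (induction A rule: finite_induct)
  case (insert p A)
  have "coprime p (\<Prod>A)"
    using insert by (intro prod_coprime_right) (metis insertCI primes_coprime)
  then show ?case using insert by (simp add: divides_mult)
qed simp

text \<open>An even \<open>n > 2\<close> adds no prime. For \<open>n = 2 * m + 1\<close>, the primes between \<open>m + 1\<close> and \<open>n\<close> divide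
  a binomial coefficient that occurs twice in a row of sum \<open>2 ^ n\<close>.\<close>

lemma prod_primes_le_bound: "\<Prod>(primes_le n) \<le> 4 ^ n"
proof (induction n rule: less_induct)
  case (less n)
  consider "n \<le> 2" | "n > 2" "even n" | "n > 2" "odd n" by linarith
  then show ?case
  proof cases
    case 1
    have "p = 2 \<and> n = 2" if "p \<in> primes_le n" for p
      using that 1 prime_ge_2_nat[of p] by (simp add: primes_le_def)
    then have "primes_le n \<subseteq> {2}" by blast
    then consider "primes_le n = {}" | "primes_le n = {2}" "n = 2"
      using \<open>\<And>p. p \<in> primes_le n \<Longrightarrow> p = 2 \<and> n = 2\<close> by blast
    then show ?thesis by cases simp_all
  next
    case 2
    have "primes_le n = primes_le (n - 1)"
      unfolding primes_le_def using 2 by (auto simp: le_less dest: prime_odd_nat)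
    then have "\<Prod>(primes_le n) \<le> 4 ^ (n - 1)" using less.IH[of "n - 1"] 2 by simp
    also have "\<dots> \<le> 4 ^ n" by (rule power_increasing) auto
    finally show ?thesis .
  next
    case 3
    then obtain m where m: "n = 2 * m + 1" "m \<ge> 1" by (elim oddE) auto
    define A where "A = {p. prime p \<and> m + 1 < p \<and> p \<le> n}"
    have fA: "finite A" by (rule finite_subset[of _ "{..n}"]) (auto simp: A_def)
    have "p dvd (2 * m + 1) choose m" if "p \<in> A" for p
    proof -
      have p: "prime p" "m + 1 < p" "p \<le> 2 * m + 1" using that m by (auto simp: A_def)
      have "fact m * fact (m + 1) * ((2 * m + 1) choose m) = (fact (2 * m + 1) :: nat)"
        using binomial_fact_lemma[of m "2 * m + 1"] by simp
      moreover have "p dvd fact (2 * m + 1)" using p by (simp add: prime_dvd_fact_iff del: fact_Suc)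
      ultimately have "p dvd fact m * fact (m + 1) * ((2 * m + 1) choose m)" by simp
      then show ?thesis using p by (auto simp: prime_dvd_mult_iff prime_dvd_fact_iff simp del: fact_Suc)
    qed
    then have "\<Prod>A dvd (2 * m + 1) choose m" using fA by (intro prod_primes_dvd) (auto simp: A_def)
    then have "\<Prod>A \<le> (2 * m + 1) choose m" by (rule dvd_imp_le) simp
    also have "\<dots> \<le> 4 ^ m"
    proof -
      have "2 * ((2 * m + 1) choose m) = ((2 * m + 1) choose m) + ((2 * m + 1) choose (m + 1))"
        using binomial_symmetric[of m "2 * m + 1"] by simp
      also have "\<dots> = (\<Sum>k\<in>{m, m + 1}. (2 * m + 1) choose k)" by simp
      also have "\<dots> \<le> (\<Sum>k\<le>2 * m + 1. (2 * m + 1) choose k)" by (rule sum_mono2) auto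
      also have "\<dots> = 2 ^ (2 * m + 1)" by (rule choose_row_sum)
      also have "\<dots> = 2 * 4 ^ m" by (simp add: power_mult)
      finally show ?thesis by simp
    qed
    finally have A: "\<Prod>A \<le> 4 ^ m" .
    have "primes_le n = primes_le (m + 1) \<union> A"
      using m by (auto simp: primes_le_def A_def)
    moreover have "primes_le (m + 1) \<inter> A = {}" by (auto simp: primes_le_def A_def)
    ultimately have "\<Prod>(primes_le n) = \<Prod>(primes_le (m + 1)) * \<Prod>A"
      using fA by (simp add: prod.union_disjoint)
    also have "\<dots> \<le> 4 ^ (m + 1) * 4 ^ m" using less.IH[of "m + 1"] A m by (intro mult_mono) auto
    also have "\<dots> = 4 ^ n" by (simp add: m power_add[symmetric] mult_2)
    finally show ?thesis .
  qed
qed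

lemma sum_ln_primes_le: "(\<Sum>p\<in>primes_le n. ln (real p)) \<le> 2 * real n"
proof -
  have pos: "real p > 0" if "p \<in> primes_le n" for p using that prime_gt_0_nat by (auto simp: primes_le_def)
  have "(\<Sum>p\<in>primes_le n. ln (real p)) = ln (\<Prod>p\<in>primes_le n. real p)"
    using pos by (intro ln_prod[symmetric]) auto
  also have "(\<Prod>p\<in>primes_le n. real p) = real (\<Prod>(primes_le n))" by simp
  also have "ln \<dots> \<le> ln (real (4 ^ n))"
  proof -
    have "\<Prod>(primes_le n) > 0" using pos by (intro prod_pos) auto
    then show ?thesis using prod_primes_le_bound[of n] by (subst ln_le_cancel_iff) linarith+
  qed
  also have "\<dots> = real n * ln 4" by (simp add: ln_realpow)
  also have "ln (4::real) \<le> 2"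
  proof -
    have "ln (4::real) = 2 * ln 2" using ln_realpow[of 2 2] by simp
    then show ?thesis using ln_2_less_1 by linarith
  qed
  then have "real n * ln 4 \<le> 2 * real n" using mult_left_mono[of "ln 4" 2 "real n"] by simp
  finally show ?thesis .
qed

text \<open>The sum is compared with the telescoping sum of \<open>1 / (m * (m + 1))\<close>.\<close>

lemma sum_inverse_squares_le:
  assumes "n \<ge> 1" "finite A" "\<And>p. p \<in> A \<Longrightarrow> p > n"
  shows "(\<Sum>p\<in>A. 1 / (real p)\<^sup>2) \<le> 1 / real n"
proof -
  have t: "(\<Sum>p\<in>{n<..m}. 1 / (real p)\<^sup>2) \<le> 1 / real n - 1 / real m" if "m \<ge> n" for m
    using that
  proof (induction m rule: dec_induct)
    case (step m)
    have "{n<..Suc m} = insert (Suc m) {n<..m}" using step by auto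
    then have "(\<Sum>p\<in>{n<..Suc m}. 1 / (real p)\<^sup>2) = 1 / (real (Suc m))\<^sup>2 + (\<Sum>p\<in>{n<..m}. 1 / (real p)\<^sup>2)"
      by simp
    also have "\<dots> \<le> 1 / (real (Suc m))\<^sup>2 + (1 / real n - 1 / real m)" using step by simp
    also have "1 / (real (Suc m))\<^sup>2 \<le> 1 / real m - 1 / real (Suc m)"
    proof -
      have "1 / real m - 1 / real (Suc m) = 1 / (real m * real (Suc m))"
        using step assms(1) by (simp add: field_simps)
      moreover have "real m * real (Suc m) \<le> (real (Suc m))\<^sup>2" by (simp add: power2_eq_square)
      ultimately show ?thesis using step assms(1) by (auto intro!: divide_left_mono)
    qed
    finally show ?case by simp
  qed simp
  define m where "m = Max (insert n A)"
  have "m \<ge> n" using assms(2) by (simp add: m_def)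
  have "A \<subseteq> {n<..m}" using assms(2,3) by (auto simp: m_def)
  then have "(\<Sum>p\<in>A. 1 / (real p)\<^sup>2) \<le> (\<Sum>p\<in>{n<..m}. 1 / (real p)\<^sup>2)"
    by (intro sum_mono2) auto
  also have "\<dots> \<le> 1 / real n - 1 / real m" by (rule t) fact
  also have "\<dots> \<le> 1 / real n" by simp
  finally show ?thesis .
qed

section \<open>The ring of integer polynomials modulo a monic irreducible polynomial\<close>

lemma poly_diff_dvd: "x - y dvd poly f x - poly f (y::int)"
proof (induction f)
  case (pCons a f)
  have "poly (pCons a f) x - poly (pCons a f) y = (x - y) * poly f x + y * (poly f x - poly f y)"
    by (simp add: algebra_simps)
  then show ?case using pCons.IH by (metis dvd_add dvd_mult dvd_triv_left)
qed simp

lemma poly_cong_mod: "poly f (r mod m) mod m = poly f (r::int) mod m"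
proof -
  have "m dvd r mod m - r" by (metis mod_eq_dvd_iff mod_mod_trivial)
  then have "m dvd poly f (r mod m) - poly f r" using poly_diff_dvd by (rule dvd_trans)
  then show ?thesis by (simp only: mod_eq_dvd_iff)
qed

text \<open>Taylor expansion to second order; the quotient \<open>h\<close> is an integer, which makes Hensel lifting
  possible.\<close>

lemma poly_taylor2: "\<exists>h. poly f (r + t) = poly f r + t * poly (pderiv f) r + t\<^sup>2 * (h::int)"
proof (induction f)
  case (pCons a f)
  then obtain h where h: "poly f (r + t) = poly f r + t * poly (pderiv f) r + t\<^sup>2 * h" by blast
  have "poly (pCons a f) (r + t) = poly (pCons a f) r + t * poly (pderiv (pCons a f)) r
          + t\<^sup>2 * (r * h + poly (pderiv f) r + t * h)"
    by (simp add: h pderiv_pCons algebra_simps power2_eq_square)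
  then show ?case by blast
qed simp

text \<open>The ring \<open>R\<close> of integer polynomials modulo \<open>g\<close> is an order in a number field of degree \<open>d\<close>. It is not
  built as a quotient: elements are polynomials up to divisibility of the difference by \<open>g\<close>, and every
  element has a unique representative of degree below \<open>d\<close>, so that the additive group is a lattice of
  rank \<open>d\<close> with the coefficients as coordinates.\<close>

locale monic_irreducible =
  fixes g :: "int poly"
  assumes monic: "lead_coeff g = 1" and irr: "irreducible g"
begin

abbreviation d :: nat where "d \<equiv> degree g"

lemma g_nz: "g \<noteq> 0" using monic by auto

lemma prime_g: "prime_elem g"
  using irr by (rule irreducible_imp_prime_elem_gcd)

lemma d_pos: "d > 0"
proof (rule ccontr)
  assume "\<not> d > 0"
  then have "d = 0" by simp
  then have "g = [:coeff g 0:]" by (metis degree_0_id)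
  then have "g = 1" using monic \<open>d = 0\<close> by (metis one_pCons)
  then show False using irr by simp
qed

lemma g_dvd_multD: "g dvd a * b \<Longrightarrow> g dvd a \<or> g dvd b"
  using prime_g prime_elem_dvd_mult_iff by blast

lemma g_dvd_degree: assumes "g dvd a" "degree a < d" shows "a = 0"
  using assms dvd_imp_degree_le[of g a] by (metis leD)

lemma not_g_dvd_const: "n \<noteq> 0 \<Longrightarrow> \<not> g dvd [:n:]"
  using g_dvd_degree[of "[:n:]"] d_pos by auto

definition small :: "int \<Rightarrow> int poly \<Rightarrow> bool" where
  "small A f \<longleftrightarrow> (\<forall>i. \<bar>coeff f i\<bar> \<le> A) \<and> (\<forall>i\<ge>d. coeff f i = 0)"

lemma deg_lt: "(\<forall>i\<ge>d. coeff f i = 0) \<longleftrightarrow> degree f < d"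
proof
  assume "\<forall>i\<ge>d. coeff f i = 0"
  then have "degree f \<le> d - 1" using d_pos by (intro degree_le) auto
  then show "degree f < d" using d_pos by simp
next
  assume "degree f < d" then show "\<forall>i\<ge>d. coeff f i = 0" by (auto intro!: coeff_eq_0)
qed

lemma reduce_exists: "\<exists>h. (\<forall>i\<ge>d. coeff h i = 0) \<and> g dvd f - h"
proof (induction f)
  case 0
  show ?case by (rule exI[of _ 0]) simp
next
  case (pCons a f)
  then obtain h where h: "\<forall>i\<ge>d. coeff h i = 0" "g dvd f - h" by blast
  define h' where "h' = pCons a h - smult (coeff (pCons a h) d) g"
  have "coeff h' i = 0" if "i \<ge> d" for i
  proof (cases "i = d")
    case True then show ?thesis using monic by (simp add: h'_def)
  next
    case False
    then have "i > d" using that by simp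
    then have "coeff g i = 0" "coeff (pCons a h) i = 0"
      using h(1) d_pos by (auto simp: coeff_eq_0 coeff_pCons split: nat.splits)
    then show ?thesis by (simp add: h'_def)
  qed
  moreover have "pCons a f - h' = [:0,1:] * (f - h) + smult (coeff (pCons a h) d) g"
    by (simp add: h'_def)
  then have "g dvd pCons a f - h'" using h(2) by (metis dvd_add dvd_mult dvd_smult dvd_refl)
  ultimately show ?case by blast
qed

text \<open>Only the powers \<open>x ^ k\<close> with \<open>k < 2 * d\<close> occur in a product of two reduced polynomials, and their
  reductions have bounded coefficients.\<close>

lemma small_mult_exists:
  "\<exists>C\<ge>1. \<forall>a b A B. small A a \<longrightarrow> small B b \<longrightarrow> (\<exists>c. small (C * A * B) c \<and> g dvd a * b - c)"
proof -
  obtain e where e: "\<And>k::nat. (\<forall>i\<ge>d. coeff (e k) i = 0) \<and> g dvd monom 1 k - e k"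
  proof -
    have "\<forall>k::nat. \<exists>h. (\<forall>i\<ge>d. coeff h i = 0) \<and> g dvd monom 1 k - h"
      using reduce_exists by blast
    then show ?thesis using that by metis
  qed
  define E where "E = Max ((\<lambda>(k,i). \<bar>coeff (e k) i\<bar>) ` ({..<2*d} \<times> {..<d}))"
  have E: "\<bar>coeff (e k) i\<bar> \<le> E" if "k < 2*d" "i < d" for k i
    unfolding E_def using that by (intro Max_ge) (auto simp: image_iff)
  have E0: "E \<ge> 0" using E[of 0 0] d_pos by fastforce
  have E': "\<bar>coeff (e k) i\<bar> \<le> E" if "k < 2*d" for k i
    using E[OF that] e[of k] E0 by (cases "i < d") auto
  define C where "C = 1 + int (2*d) * (int (2*d) * E)"
  have "\<exists>c. small (C * A * B) c \<and> g dvd a * b - c" if ab: "small A a" "small B b" for a b A B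
  proof -
    have A0: "A \<ge> 0" "B \<ge> 0" using ab unfolding small_def by (meson abs_ge_zero order_trans)+
    define c where "c = (\<Sum>k<2*d. smult (coeff (a*b) k) (e k))"
    have deg: "degree a < d" "degree b < d" using ab deg_lt unfolding small_def by auto
    have dab: "degree (a*b) < 2*d" using degree_mult_le[of a b] deg by linarith
    have "a * b = (\<Sum>k\<le>degree (a*b). monom (coeff (a*b) k) k)" by (simp add: poly_as_sum_of_monoms)
    also have "\<dots> = (\<Sum>k<2*d. monom (coeff (a*b) k) k)"
      using dab by (intro sum.mono_neutral_left) (auto simp: coeff_eq_0)
    finally have "a * b - c = (\<Sum>k<2*d. smult (coeff (a*b) k) (monom 1 k - e k))"
      unfolding c_def sum_subtractf[symmetric] by (simp add: smult_diff_right smult_monom sum_subtractf)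
    then have gd: "g dvd a * b - c"
      using e by (auto intro!: dvd_sum dvd_smult)
    have cab: "\<bar>coeff (a*b) k\<bar> \<le> int (2*d) * (A * B)" if "k < 2*d" for k
    proof -
      have "\<bar>coeff (a*b) k\<bar> \<le> (\<Sum>i\<le>k. \<bar>coeff a i * coeff b (k-i)\<bar>)"
        unfolding coeff_mult by (rule sum_abs)
      also have "\<dots> \<le> (\<Sum>i\<le>k. A * B)"
        using ab A0 unfolding small_def by (intro sum_mono) (auto simp: abs_mult intro!: mult_mono)
      also have "\<dots> = int (k+1) * (A * B)" by simp
      also have "\<dots> \<le> int (2*d) * (A * B)" using that A0 by (intro mult_right_mono) auto
      finally show ?thesis .
    qed
    have "\<bar>coeff c i\<bar> \<le> C * A * B" for i
    proof -
      have "\<bar>coeff c i\<bar> \<le> (\<Sum>k<2*d. \<bar>coeff (a*b) k * coeff (e k) i\<bar>)"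
        unfolding c_def coeff_sum coeff_smult by (rule sum_abs)
      also have "\<dots> \<le> (\<Sum>k<2*d. (int (2*d) * (A * B)) * E)"
        using cab E' A0 E0 by (intro sum_mono) (auto simp: abs_mult intro!: mult_mono)
      also have "\<dots> = (C - 1) * A * B" by (simp add: C_def)
      also have "\<dots> \<le> C * A * B" using A0 by (simp add: algebra_simps)
      finally show ?thesis .
    qed
    moreover have "coeff c i = 0" if "i \<ge> d" for i
      unfolding c_def coeff_sum coeff_smult using e that by (intro sum.neutral) auto
    ultimately show ?thesis using gd unfolding small_def by blast
  qed
  moreover have "C \<ge> 1" using E0 by (simp add: C_def)
  ultimately show ?thesis by blast
qed

definition C :: int where
  "C = (SOME C. C \<ge> 1 \<and> (\<forall>a b A B. small A a \<longrightarrow> small B b \<longrightarrow>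
     (\<exists>c. small (C * A * B) c \<and> g dvd a * b - c)))"

lemma C_ge_1: "C \<ge> 1"
  and small_mult: "small A a \<Longrightarrow> small B b \<Longrightarrow> \<exists>c. small (C * A * B) c \<and> g dvd a * b - c"
  using someI_ex[OF small_mult_exists[unfolded Bex_def]] unfolding C_def by blast+

text \<open>Elements of \<open>R\<close> other than \<open>0\<close> are invertible over the rationals. A polynomial \<open>f\<close> of least degree in
  the ideal \<open>(a, g)\<close> divides, up to integer factors, every element of that ideal, by pseudo-division. If \<open>f\<close>
  were not constant, it would share a factor with \<open>g\<close>, so that \<open>g\<close>, being prime, would divide \<open>a\<close>.\<close>

lemma inverse_up_to_integer:
  assumes "\<not> g dvd a"
  shows "\<exists>b n. n \<noteq> 0 \<and> g dvd a * b - [:n:]"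
proof -
  define J where "J = {f. \<exists>s t. f = a * s + g * t}"
  have J_add: "f - h * k \<in> J" if "f \<in> J" "h \<in> J" for f h k
  proof -
    from that obtain s t s' t' where "f = a * s + g * t" "h = a * s' + g * t'" unfolding J_def by blast
    then have "f - h * k = a * (s - s' * k) + g * (t - t' * k)" by (simp add: algebra_simps)
    then show ?thesis unfolding J_def by blast
  qed
  have J_smult: "smult c f \<in> J" if "f \<in> J" for c f
    using that unfolding J_def by clarsimp (metis mult_smult_right smult_add_right)
  have gJ: "g \<in> J" unfolding J_def by (rule CollectI, rule exI[of _ 0], rule exI[of _ 1]) simp
  have aJ: "a \<in> J" unfolding J_def by (rule CollectI, rule exI[of _ 1], rule exI[of _ 0]) simp
  obtain f where f: "f \<in> J" "f \<noteq> 0" and fmin: "\<And>h. h \<in> J \<Longrightarrow> h \<noteq> 0 \<Longrightarrow> degree f \<le> degree h"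
    using ex_has_least_nat[of "\<lambda>f. f \<in> J \<and> f \<noteq> 0" g degree] gJ g_nz by blast
  have fd: "\<exists>c. c \<noteq> 0 \<and> f dvd smult c h" if h: "h \<in> J" for h
  proof -
    obtain k r where kr: "pseudo_divmod h f = (k, r)" by fastforce
    define c where "c = lead_coeff f ^ (Suc (degree h) - degree f)"
    have eq: "smult c h = f * k + r" and r: "r = 0 \<or> degree r < degree f"
      using pseudo_divmod[OF f(2) kr] unfolding c_def by auto
    have "r = smult c h - f * k" using eq by simp
    then have "r \<in> J" using J_add[OF J_smult[OF h] f(1)] by simp
    then have "r = 0" using fmin r by force
    moreover have "c \<noteq> 0" using f(2) by (simp add: c_def)
    ultimately show ?thesis using eq by (metis add_0_right dvd_triv_left)
  qed
  obtain c1 where c1: "c1 \<noteq> 0" "f dvd smult c1 g" using fd[OF gJ] by blast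
  obtain c2 where c2: "c2 \<noteq> 0" "f dvd smult c2 a" using fd[OF aJ] by blast
  have ngf: "\<not> g dvd f"
  proof
    assume "g dvd f"
    then have "g dvd [:c2:] * a" using c2(2) by (simp add: dvd_trans)
    then show False using g_dvd_multD not_g_dvd_const c2(1) assms by blast
  qed
  obtain h where h: "smult c1 g = f * h" using c1(2) by blast
  then have "g dvd f * h" by (metis dvd_refl dvd_smult)
  then have "g dvd h" using ngf g_dvd_multD by blast
  then obtain h' where h': "h = g * h'" by blast
  have "g * [:c1:] = g * (f * h')" using h h' by (simp add: ac_simps)
  then have "[:c1:] = f * h'" using g_nz by (metis mult_cancel_left)
  then have "degree (f * h') = 0" "f * h' \<noteq> 0" using c1(1) by (metis degree_pCons_0, metis pCons_eq_0_iff)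
  then have "degree f = 0" by (simp add: degree_mult_eq)
  then obtain n where n: "f = [:n:]" by (metis degree_0_id)
  obtain s t where "f = a * s + g * t" using f(1) unfolding J_def by blast
  then have "a * s - [:n:] = g * (- t)" using n by simp
  then have "g dvd a * s - [:n:]" by (metis dvd_triv_left)
  moreover have "n \<noteq> 0" using n f(2) by auto
  ultimately show ?thesis by blast
qed

text \<open>With \<open>a * b = n\<close> in \<open>R\<close>, the exact quotient of \<open>w\<close> by \<open>a\<close> is \<open>w * b / n\<close>. Rounding its coefficients
  down leaves the remainder \<open>a * \<rho>' / n\<close>, where \<open>\<rho>'\<close> has coefficients between \<open>0\<close> and \<open>n\<close>; the size of
  the inverse \<open>b\<close> does not enter.\<close>

lemma division_with_small_remainder:
  assumes "\<not> g dvd a" and a: "small A a"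
  shows "\<exists>y \<rho>. small (C * A) \<rho> \<and> g dvd w - a * y - \<rho>"
proof -
  obtain b n0 where bn0: "n0 \<noteq> 0" "g dvd a * b - [:n0:]" using inverse_up_to_integer[OF assms(1)] by blast
  define n where "n = \<bar>n0\<bar>"
  have n: "n > 0" using bn0 by (simp add: n_def)
  have "\<exists>b. g dvd a * b - [:n:]"
  proof (cases "n0 > 0")
    case True then show ?thesis using bn0 n_def by auto
  next
    case False
    then have "a * (-b) - [:n:] = - (a * b - [:n0:])" by (simp add: n_def)
    then show ?thesis using bn0(2) by (metis dvd_minus_iff)
  qed
  then obtain b where b: "g dvd a * b - [:n:]" by blast
  obtain h where h: "\<forall>i\<ge>d. coeff h i = 0" "g dvd w * b - h" using reduce_exists by blast
  define y where "y = map_poly (\<lambda>c. c div n) h"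
  define \<rho>' where "\<rho>' = map_poly (\<lambda>c. c mod n) h"
  have hy: "h = smult n y + \<rho>'"
    by (rule poly_eqI) (simp add: y_def \<rho>'_def coeff_map_poly)
  have sm: "small n \<rho>'" using h(1) n by (auto simp: small_def \<rho>'_def coeff_map_poly less_imp_le)
  obtain c where c: "small (C * A * n) c" "g dvd a * \<rho>' - c" using small_mult[OF a sm] by blast
  obtain \<rho> where \<rho>: "\<forall>i\<ge>d. coeff \<rho> i = 0" "g dvd (w - a * y) - \<rho>" using reduce_exists by blast
  have "smult n \<rho> - c = a * (w * b - h) - w * (a * b - [:n:]) - smult n ((w - a * y) - \<rho>) + (a * \<rho>' - c)"
    by (simp add: hy algebra_simps smult_diff_right smult_add_right)
  then have "g dvd smult n \<rho> - c"
    using b h(2) \<rho>(2) c(2) by (metis dvd_add dvd_diff dvd_mult dvd_smult)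
  moreover have "degree (smult n \<rho> - c) < d"
    using \<rho>(1) c(1) unfolding small_def deg_lt[symmetric] by simp
  ultimately have eq: "smult n \<rho> = c" using g_dvd_degree by fastforce
  have "\<bar>coeff \<rho> i\<bar> \<le> C * A" for i
  proof -
    have "n * \<bar>coeff \<rho> i\<bar> = \<bar>coeff c i\<bar>" using n by (simp add: eq[symmetric] abs_mult)
    also have "\<dots> \<le> n * (C * A)" using c(1) by (simp add: small_def ac_simps)
    finally show ?thesis using n by simp
  qed
  then have "small (C * A) \<rho>" using \<rho>(1) by (simp add: small_def)
  then show ?thesis using \<rho>(2) by blast
qed

section \<open>Ideals of finite index and their points in boxes\<close>

text \<open>Ideals of \<open>R\<close>, as sets of integer polynomials that contain \<open>g\<close>.\<close>

definition is_ideal :: "int poly set \<Rightarrow> bool" where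
  "is_ideal I \<longleftrightarrow> g \<in> I \<and> (\<forall>a\<in>I. \<forall>b\<in>I. a - b \<in> I) \<and> (\<forall>a\<in>I. \<forall>c. c * a \<in> I)"

definition residue_class :: "int poly set \<Rightarrow> int poly \<Rightarrow> int poly set" where
  "residue_class I w = {v. v - w \<in> I}"

definition ideal_index :: "int poly set \<Rightarrow> nat" where
  "ideal_index I = card (range (residue_class I))"

definition finite_index :: "int poly set \<Rightarrow> bool" where
  "finite_index I \<longleftrightarrow> finite (range (residue_class I))"

definition box :: "int \<Rightarrow> int \<Rightarrow> int poly set" where
  "box a b = {f. (\<forall>i<d. a \<le> coeff f i \<and> coeff f i < b) \<and> (\<forall>i\<ge>d. coeff f i = 0)}"

abbreviation coset_points :: "int \<Rightarrow> int poly \<Rightarrow> int poly set \<Rightarrow> int poly set" where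
  "coset_points X y0 I \<equiv> {y \<in> box 0 X. y - y0 \<in> I}"

lemma box_bij: "bij_betw (\<lambda>f. restrict (coeff f) {..<d}) (box a b) ({..<d} \<rightarrow>\<^sub>E {a..<b})"
proof (rule bij_betwI')
  fix x y assume "x \<in> box a b" "y \<in> box a b"
  then show "(restrict (coeff x) {..<d} = restrict (coeff y) {..<d}) = (x = y)"
  proof (intro iffI poly_eqI)
    fix i assume xy: "x \<in> box a b" "y \<in> box a b" "restrict (coeff x) {..<d} = restrict (coeff y) {..<d}"
    show "coeff x i = coeff y i"
    proof (cases "i < d")
      case True then show ?thesis using fun_cong[OF xy(3), of i] by simp
    next
      case False then show ?thesis using xy(1,2) by (simp add: box_def)
    qed
  qed simp
next
  fix x assume "x \<in> box a b"
  then show "restrict (coeff x) {..<d} \<in> {..<d} \<rightarrow>\<^sub>E {a..<b}" unfolding box_def by auto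
next
  fix h assume h: "h \<in> {..<d} \<rightarrow>\<^sub>E {a..<b}"
  define f where "f = (\<Sum>i<d. monom (h i) i)"
  have c: "coeff f i = (if i < d then h i else 0)" for i
  proof -
    have "coeff f i = (\<Sum>j<d. if j = i then h j else 0)"
      unfolding f_def coeff_sum coeff_monom ..
    also have "\<dots> = (if i \<in> {..<d} then h i else 0)" by (rule sum.delta) simp
    finally show ?thesis by simp
  qed
  have "a \<le> h i \<and> h i < b" if "i < d" for i using PiE_mem[OF h, of i] that by simp
  then have "f \<in> box a b" unfolding box_def by (simp add: c)
  moreover have "h = restrict (coeff f) {..<d}"
  proof (rule ext)
    fix i show "h i = restrict (coeff f) {..<d} i"
      using PiE_arb[OF h, of i] by (cases "i < d") (simp_all add: c)
  qed
  ultimately show "\<exists>f\<in>box a b. h = restrict (coeff f) {..<d}" by blast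
qed

lemma finite_box [simp]: "finite (box a b)"
  using bij_betw_finite[OF box_bij] by (simp add: finite_PiE)

lemma card_box: "card (box a b) = nat (b - a) ^ d"
  using bij_betw_same_card[OF box_bij] by (simp add: card_PiE)

lemma box_coeff:
  assumes "x \<in> box a b"
  shows "i < d \<Longrightarrow> a \<le> coeff x i" "i < d \<Longrightarrow> coeff x i < b" "i \<ge> d \<Longrightarrow> coeff x i = 0"
  using assms by (simp_all add: box_def)

lemma box_diff_small:
  assumes "x \<in> box 0 X" "y \<in> box 0 X" "X \<ge> 1" shows "small (X - 1) (x - y)"
proof -
  have "\<bar>coeff (x - y) i\<bar> \<le> X - 1" for i
    using box_coeff[OF assms(1), of i] box_coeff[OF assms(2), of i] assms(3)
    by (cases "i < d") auto
  then show ?thesis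
    using box_coeff(3)[OF assms(1)] box_coeff(3)[OF assms(2)] by (simp add: small_def)
qed

lemma box_add: assumes "x \<in> box a b" "small E y" shows "x + y \<in> box (a - E) (b + E)"
proof -
  have "a - E \<le> coeff (x + y) i \<and> coeff (x + y) i < b + E" if "i < d" for i
  proof -
    have "\<bar>coeff y i\<bar> \<le> E" using assms(2) by (simp add: small_def)
    then show ?thesis using box_coeff(1,2)[OF assms(1) that] by (simp add: abs_le_iff)
  qed
  moreover have "coeff (x + y) i = 0" if "i \<ge> d" for i
    using box_coeff(3)[OF assms(1) that] assms(2) that by (simp add: small_def)
  ultimately show ?thesis by (simp add: box_def)
qed

lemma small_uminus: "small A f \<Longrightarrow> small A (- f)" by (simp add: small_def)
lemma small_mono: "small A f \<Longrightarrow> A \<le> B \<Longrightarrow> small B f"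
  unfolding small_def by (meson order_trans)

context
  fixes I
  assumes I: "is_ideal I"
begin

lemma ideal_diff: "a \<in> I \<Longrightarrow> b \<in> I \<Longrightarrow> a - b \<in> I" using I by (simp add: is_ideal_def)
lemma ideal_mult: "a \<in> I \<Longrightarrow> c * a \<in> I" using I by (simp add: is_ideal_def)
lemma ideal_mult': "a \<in> I \<Longrightarrow> a * c \<in> I" using ideal_mult by (simp add: mult.commute)
lemma ideal_zero: "0 \<in> I" using ideal_mult[of g 0] I by (simp add: is_ideal_def)
lemma ideal_uminus: "a \<in> I \<Longrightarrow> - a \<in> I" using ideal_mult[of a "-1"] by simp
lemma ideal_add: "a \<in> I \<Longrightarrow> b \<in> I \<Longrightarrow> a + b \<in> I"
  using ideal_diff[of a "- b"] ideal_uminus[of b] by simp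
lemma ideal_g: "g dvd a \<Longrightarrow> a \<in> I" using I ideal_mult' unfolding is_ideal_def by (auto elim!: dvdE)
lemma ideal_sum: "(\<And>x. x \<in> A \<Longrightarrow> f x \<in> I) \<Longrightarrow> sum f A \<in> I"
  by (induction A rule: infinite_finite_induct) (auto simp: ideal_zero ideal_add)

lemma residue_class_eq_iff: "residue_class I v = residue_class I w \<longleftrightarrow> v - w \<in> I"
proof
  assume "residue_class I v = residue_class I w"
  moreover have "v \<in> residue_class I v" using ideal_zero by (simp add: residue_class_def)
  ultimately show "v - w \<in> I" by (auto simp: residue_class_def)
next
  assume *: "v - w \<in> I"
  have "x - v \<in> I \<longleftrightarrow> x - w \<in> I" for x
    using ideal_add[of "x - v" "v - w"] ideal_diff[of "x - w" "v - w"] * by auto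
  then show "residue_class I v = residue_class I w" by (auto simp: residue_class_def)
qed

lemma ideal_smult: "a \<in> I \<Longrightarrow> smult c a \<in> I" using ideal_mult[of a "[:c:]"] by simp

lemma integer_index:
  assumes n: "[:int n:] \<in> I" "n > 0"
  shows "finite_index I" "ideal_index I \<le> n ^ d"
proof -
  have sub: "range (residue_class I) \<subseteq> residue_class I ` box 0 (int n)"
  proof clarify
    fix w
    obtain h where h: "\<forall>i\<ge>d. coeff h i = 0" "g dvd w - h" using reduce_exists by blast
    define \<rho> where "\<rho> = map_poly (\<lambda>c. c mod int n) h"
    define y where "y = map_poly (\<lambda>c. c div int n) h"
    have hy: "h = y * [:int n:] + \<rho>"
      by (rule poly_eqI) (simp add: y_def \<rho>_def coeff_map_poly)
    have "\<rho> \<in> box 0 (int n)" using h(1) n(2) by (auto simp: box_def \<rho>_def coeff_map_poly)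
    moreover have "w - \<rho> = (w - h) + y * [:int n:]" using hy by (simp add: algebra_simps)
    then have "w - \<rho> \<in> I" using ideal_add[OF ideal_g[OF h(2)] ideal_mult[OF n(1)]] by metis
    ultimately show "residue_class I w \<in> residue_class I ` box 0 (int n)" using residue_class_eq_iff by blast
  qed
  show "finite_index I" unfolding finite_index_def by (rule finite_subset[OF sub]) simp
  have "ideal_index I \<le> card (residue_class I ` box 0 (int n))" unfolding ideal_index_def by (rule card_mono[OF _ sub]) simp
  also have "\<dots> \<le> card (box 0 (int n))" by (rule card_image_le) simp
  finally show "ideal_index I \<le> n ^ d" by (simp add: card_box)
qed

lemma ideal_index_pos: "finite_index I \<Longrightarrow> ideal_index I > 0"
  unfolding ideal_index_def finite_index_def by (simp add: card_gt_0_iff)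

text \<open>The ideal contains a nonzero element with coefficients at most \<open>A\<close>, because a box with more than
  \<open>ideal_index I\<close> points has two points in one class. Dividing by it gives the representative.\<close>

lemma coset_representatives:
  assumes fin: "finite_index I" and A: "ideal_index I < (A + 1) ^ d"
  shows "\<exists>u. small (C * int A) u \<and> w - u \<in> I"
proof -
  have "card (residue_class I ` box 0 (int A + 1)) \<le> ideal_index I"
    unfolding ideal_index_def using fin unfolding finite_index_def by (intro card_mono) auto
  also have "\<dots> < card (box 0 (int A + 1))" using A by (simp add: card_box nat_add_distrib)
  finally have "\<not> inj_on (residue_class I) (box 0 (int A + 1))" using card_image by force
  then obtain x y where xy: "x \<in> box 0 (int A + 1)" "y \<in> box 0 (int A + 1)" "x \<noteq> y" "x - y \<in> I"
    using residue_class_eq_iff unfolding inj_on_def by blast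
  have sm: "small (int A) (x - y)" using box_diff_small[OF xy(1,2)] by simp
  have "\<not> g dvd x - y"
    using g_dvd_degree[of "x - y"] xy(3) sm unfolding small_def deg_lt by auto
  from division_with_small_remainder[OF this sm, of w] obtain k u where
    u: "small (C * int A) u" "g dvd w - (x - y) * k - u" by blast
  have "w - u = (w - (x - y) * k - u) + (x - y) * k" by simp
  then have "w - u \<in> I" using ideal_add[OF ideal_g[OF u(2)] ideal_mult'[OF xy(4)]] by metis
  then show ?thesis using u(1) by blast
qed

lemma ex_transversal:
  assumes fin: "finite_index I" and A: "ideal_index I < (A + 1) ^ d"
  obtains u where "\<And>w. small (C * int A) (u (residue_class I w))" "\<And>w. w - u (residue_class I w) \<in> I"
proof -
  have "\<exists>u. small (C * int A) u \<and> (\<forall>w. c = residue_class I w \<longrightarrow> w - u \<in> I)" if "c \<in> range (residue_class I)" for c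
  proof -
    from that obtain w where w: "c = residue_class I w" by (rule rangeE)
    obtain u where u: "small (C * int A) u" "w - u \<in> I" using coset_representatives[OF assms] by blast
    have "w' - u \<in> I" if "c = residue_class I w'" for w'
    proof -
      have "w' - w \<in> I" using that w residue_class_eq_iff by metis
      then show ?thesis using ideal_add[OF _ u(2), of "w' - w"] by simp
    qed
    then show ?thesis using u(1) by blast
  qed
  then have "\<forall>c\<in>range (residue_class I). \<exists>u. small (C * int A) u \<and> (\<forall>w. c = residue_class I w \<longrightarrow> w - u \<in> I)" by blast
  then obtain u where "\<forall>c\<in>range (residue_class I). small (C * int A) (u c) \<and> (\<forall>w. c = residue_class I w \<longrightarrow> w - u c \<in> I)"
    by metis
  then show thesis using that[of u] by blast
qed

text \<open>Translating the points of the coset by a transversal with small coefficients yields distinct points of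
  a slightly larger box.\<close>

lemma coset_count_upper:
  assumes fin: "finite_index I" and A: "ideal_index I < (A + 1) ^ d"
  shows "card (coset_points X y0 I) * ideal_index I \<le> nat (X + 2 * (C * int A)) ^ d"
proof -
  obtain u where u: "\<And>w. small (C * int A) (u (residue_class I w))" "\<And>w. w - u (residue_class I w) \<in> I"
    using ex_transversal[OF assms] by blast
  have u': "small (C * int A) (u c)" "residue_class I (u c) = c" if "c \<in> range (residue_class I)" for c
    using that u(1) u(2) residue_class_eq_iff by (metis rangeE)+
  let ?S = "coset_points X y0 I \<times> range (residue_class I)"
  have "inj_on (\<lambda>(y,c). y + u c) ?S"
  proof (rule inj_onI; clarify)
    fix y v y' v' assume *: "y - y0 \<in> I" "y' - y0 \<in> I" "y + u (residue_class I v) = y' + u (residue_class I v')"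
    have "u (residue_class I v) - u (residue_class I v') = (y' - y0) - (y - y0)" using *(3) by (simp add: algebra_simps)
    then have "u (residue_class I v) - u (residue_class I v') \<in> I" using ideal_diff[OF *(2,1)] by simp
    then have "residue_class I v = residue_class I v'" using residue_class_eq_iff u'(2) by (metis rangeI)
    then show "y = y' \<and> residue_class I v = residue_class I v'" using *(3) by simp
  qed
  moreover have "(\<lambda>(y,c). y + u c) ` ?S \<subseteq> box (0 - C * int A) (X + C * int A)"
    using box_add u(1) by (force simp del: diff_0)
  ultimately have "card ?S \<le> card (box (0 - C * int A) (X + C * int A))"
    using card_inj_on_le finite_box by blast
  then show ?thesis by (simp add: card_box card_cartesian_product ideal_index_def algebra_simps)
qed

text \<open>Every point of a slightly smaller box is a point of the coset plus an element of the transversal.\<close>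

lemma coset_count_lower:
  assumes fin: "finite_index I" and A: "ideal_index I < (A + 1) ^ d"
  shows "nat (X - 2 * (C * int A)) ^ d \<le> card (coset_points X y0 I) * ideal_index I"
proof -
  obtain u where u: "\<And>w. small (C * int A) (u (residue_class I w))" "\<And>w. w - u (residue_class I w) \<in> I"
    using ex_transversal[OF assms] by blast
  let ?S = "coset_points X y0 I \<times> range (residue_class I)"
  let ?f = "\<lambda>w. (w - u (residue_class I (w - y0)), residue_class I (w - y0))"
  have "inj_on ?f (box (0 + C * int A) (X - C * int A))"
    by (rule inj_onI) auto
  moreover have "?f ` box (0 + C * int A) (X - C * int A) \<subseteq> ?S"
  proof (rule image_subsetI)
    fix w assume w: "w \<in> box (0 + C * int A) (X - C * int A)"
    show "(w - u (residue_class I (w - y0)), residue_class I (w - y0)) \<in> ?S"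
      using box_add[OF w small_uminus[OF u(1)[of "w - y0"]]] u(2)[of "w - y0"] by (auto simp: algebra_simps)
  qed
  moreover have "finite ?S" using fin unfolding finite_index_def by auto
  ultimately have "card (box (0 + C * int A) (X - C * int A)) \<le> card ?S"
    using card_inj_on_le by blast
  then show ?thesis by (simp add: card_box card_cartesian_product ideal_index_def algebra_simps)
qed

end

section \<open>Maximal ideals and principal ideals\<close>

text \<open>Maximality is put as the existence of inverses modulo \<open>M\<close>, which is how it is used.\<close>

definition maximal_ideal :: "int poly set \<Rightarrow> bool" where
  "maximal_ideal M \<longleftrightarrow> is_ideal M \<and> finite_index M \<and> 1 \<notin> M \<and>
     (\<forall>a. a \<notin> M \<longrightarrow> (\<exists>c. c * a - 1 \<in> M))"

definition adjoin :: "int poly set \<Rightarrow> int poly \<Rightarrow> int poly set" where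
  "adjoin I z = {f. \<exists>a\<in>I. \<exists>b. f = a + b * z}"

lemma is_ideal_adjoin: assumes I: "is_ideal I" shows "is_ideal (adjoin I z)"
  unfolding is_ideal_def
proof (intro conjI ballI allI)
  show "g \<in> adjoin I z" unfolding adjoin_def
    using I by (auto simp: is_ideal_def intro!: bexI[of _ g] exI[of _ 0])
next
  fix a b assume "a \<in> adjoin I z" "b \<in> adjoin I z"
  then obtain x y x' y' where "x \<in> I" "x' \<in> I" "a = x + y * z" "b = x' + y' * z" unfolding adjoin_def by blast
  then have "x - x' \<in> I" "a - b = (x - x') + (y - y') * z" using ideal_diff[OF I] by (auto simp: algebra_simps)
  then show "a - b \<in> adjoin I z" unfolding adjoin_def by blast
next
  fix a c assume "a \<in> adjoin I z"
  then obtain x y where "x \<in> I" "a = x + y * z" unfolding adjoin_def by blast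
  then have "c * x \<in> I" "c * a = c * x + (c * y) * z" using ideal_mult[OF I, of x c] by (simp_all add: algebra_simps)
  then show "c * a \<in> adjoin I z" unfolding adjoin_def by blast
qed

lemma adjoin_mem: assumes I: "is_ideal I" shows "z \<in> adjoin I z" "I \<subseteq> adjoin I z"
proof -
  have "z = 0 + 1 * z" "\<And>x. x = x + 0 * z" by simp_all
  then show "z \<in> adjoin I z" "I \<subseteq> adjoin I z" unfolding adjoin_def using ideal_zero[OF I] by blast+
qed

text \<open>The canonical map from the residue classes of the smaller ideal to those of the larger one.\<close>

lemma residue_class_factor:
  assumes I: "is_ideal I" and J: "is_ideal J" and "I \<subseteq> J"
  obtains h where "\<And>w. residue_class J w = h (residue_class I w)"
proof -
  have "\<exists>c'. \<forall>w. c = residue_class I w \<longrightarrow> residue_class J w = c'" for c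
  proof (cases "\<exists>w. c = residue_class I w")
    case True
    then obtain w where "c = residue_class I w" by blast
    then show ?thesis using residue_class_eq_iff[OF I] residue_class_eq_iff[OF J] assms(3) by (metis subsetD)
  qed auto
  then have "\<forall>c. \<exists>c'. \<forall>w. c = residue_class I w \<longrightarrow> residue_class J w = c'" by blast
  then obtain h where "\<forall>c w. c = residue_class I w \<longrightarrow> residue_class J w = h c" using choice[of "\<lambda>c c'. \<forall>w. c = residue_class I w \<longrightarrow> residue_class J w = c'"] by blast
  then have "\<And>w. residue_class J w = h (residue_class I w)" by simp
  then show thesis by (rule that)
qed

lemma finite_index_mono:
  assumes I: "is_ideal I" and J: "is_ideal J" and IJ: "I \<subseteq> J" and fin: "finite_index I"
  shows "finite_index J" "ideal_index J \<le> ideal_index I" "I \<noteq> J \<Longrightarrow> ideal_index J < ideal_index I"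
proof -
  obtain h where h: "\<And>w. residue_class J w = h (residue_class I w)" by (rule residue_class_factor[OF I J IJ]) blast
  have r: "range (residue_class J) = h ` range (residue_class I)" using h by auto
  show "finite_index J" using fin r unfolding finite_index_def by simp
  show le: "ideal_index J \<le> ideal_index I" unfolding ideal_index_def r using fin unfolding finite_index_def by (rule card_image_le)
  show "ideal_index J < ideal_index I" if "I \<noteq> J"
  proof (rule ccontr)
    assume "\<not> ideal_index J < ideal_index I"
    then have "card (h ` range (residue_class I)) = card (range (residue_class I))" using le unfolding ideal_index_def r by simp
    then have inj: "inj_on h (range (residue_class I))" using fin unfolding finite_index_def by (simp add: eq_card_imp_inj_on)
    have "\<exists>x. x \<in> J \<and> x \<notin> I" using \<open>I \<noteq> J\<close> IJ by blast
    then obtain x where x: "x \<in> J" "x \<notin> I" by blast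
    then have "residue_class J x = residue_class J 0" using residue_class_eq_iff[OF J] by simp
    then have "residue_class I x = residue_class I 0" using inj h unfolding inj_on_def by auto
    then show False using residue_class_eq_iff[OF I] x by simp
  qed
qed

text \<open>Among the proper ideals above \<open>J\<close>, one of least index is maximal, since enlarging an ideal strictly
  decreases the index.\<close>

lemma ex_maximal_ideal:
  assumes J: "is_ideal J" "finite_index J" "1 \<notin> J"
  obtains M where "maximal_ideal M" "J \<subseteq> M"
proof -
  let ?P = "\<lambda>M. is_ideal M \<and> J \<subseteq> M \<and> 1 \<notin> M"
  obtain M where M: "?P M" and min: "\<And>M'. ?P M' \<Longrightarrow> ideal_index M \<le> ideal_index M'"
    using ex_has_least_nat[of ?P J ideal_index] J by blast
  have fin: "finite_index M" using finite_index_mono(1)[OF J(1) _ _ J(2)] M by blast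
  have "\<exists>c. c * a - 1 \<in> M" if a: "a \<notin> M" for a
  proof -
    have id: "is_ideal (adjoin M a)" "M \<subseteq> adjoin M a" "a \<in> adjoin M a" using is_ideal_adjoin adjoin_mem M by auto
    have "ideal_index (adjoin M a) < ideal_index M" using finite_index_mono(3)[OF _ id(1,2) fin] M id(3) a by blast
    then have "1 \<in> adjoin M a" using min[of "adjoin M a"] id M by fastforce
    then obtain x b where "x \<in> M" "1 = x + b * a" unfolding adjoin_def by blast
    then have "b * a - 1 = - x" by simp
    then show ?thesis using ideal_uminus[of M x] \<open>x \<in> M\<close> M by metis
  qed
  then have "maximal_ideal M" using M fin by (simp add: maximal_ideal_def)
  then show thesis using that M by blast
qed

lemma maximal_prime:
  assumes M: "maximal_ideal M" and "a * b \<in> M" shows "a \<in> M \<or> b \<in> M"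
proof (rule ccontr)
  have id: "is_ideal M" using M by (simp add: maximal_ideal_def)
  assume "\<not> ?thesis"
  then obtain c e where ce: "c * a - 1 \<in> M" "e * b - 1 \<in> M" using M unfolding maximal_ideal_def by blast
  have "1 = c * e * (a * b) - (c * a - 1) * (e * b) - (e * b - 1)" by (simp add: algebra_simps)
  then have "1 \<in> M" using ideal_diff[OF id ideal_diff[OF id ideal_mult[OF id assms(2)] ideal_mult'[OF id ce(1)]] ce(2)]
    by metis
  then show False using M by (simp add: maximal_ideal_def)
qed

lemma maximal_unique:
  assumes M: "maximal_ideal M" and N: "maximal_ideal N" and "M \<subseteq> N" shows "M = N"
proof (rule ccontr)
  have id: "is_ideal N" using N by (simp add: maximal_ideal_def)
  assume "M \<noteq> N"
  then obtain a where a: "a \<in> N" "a \<notin> M" using assms(3) by blast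
  then obtain c where "c * a - 1 \<in> N" using M assms(3) unfolding maximal_ideal_def by blast
  then have "c * a - (c * a - 1) \<in> N" using ideal_diff[OF id ideal_mult[OF id a(1)]] by blast
  then show False using N by (simp add: maximal_ideal_def)
qed

lemma maximal_residue_char:
  assumes M: "maximal_ideal M" obtains p where "prime (p::nat)" "[:int p:] \<in> M"
proof -
  have id: "is_ideal M" and fin: "finite_index M" using M by (simp_all add: maximal_ideal_def)
  have "\<not> inj (\<lambda>n::nat. residue_class M [:int n:])"
  proof
    assume "inj (\<lambda>n::nat. residue_class M [:int n:])"
    then have "infinite (range (\<lambda>n::nat. residue_class M [:int n:]))" using finite_imageD infinite_UNIV_nat by blast
    moreover have "range (\<lambda>n::nat. residue_class M [:int n:]) \<subseteq> range (residue_class M)" by auto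
    ultimately show False using fin finite_subset unfolding finite_index_def by blast
  qed
  then obtain a b :: nat where ab: "a \<noteq> b" "residue_class M [:int a:] = residue_class M [:int b:]" unfolding inj_on_def by blast
  then have "\<exists>n::nat. n > 0 \<and> [:int n:] \<in> M"
  proof (cases "a > b")
    case True
    then show ?thesis using ab residue_class_eq_iff[OF id] by (intro exI[of _ "a - b"]) (auto simp: of_nat_diff)
  next
    case False
    have "[:int b:] - [:int a:] \<in> M" using ab residue_class_eq_iff[OF id] by metis
    then show ?thesis using ab False by (intro exI[of _ "b - a"]) (auto simp: of_nat_diff)
  qed
  then obtain n where "n > 0" "[:int n:] \<in> M" by blast
  then have "\<exists>p. prime p \<and> [:int p:] \<in> M"
  proof (induction n rule: prime_divisors_induct)
    case (factor p n)
    have "[:int p:] * [:int n:] = [:int (p * n):]" by simp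
    then have "[:int p:] * [:int n:] \<in> M" using factor.prems by metis
    then have "[:int p:] \<in> M \<or> [:int n:] \<in> M" by (rule maximal_prime[OF M])
    moreover have "n > 0" using factor.prems by simp
    moreover have "prime p" by fact
    ultimately show ?case using factor.IH by metis
  qed (use M in \<open>auto simp: maximal_ideal_def one_pCons\<close>)
  then show thesis using that by blast
qed

lemma maximal_char_dvd:
  assumes M: "maximal_ideal M" and p: "prime p" "[:int p:] \<in> M" and n: "[:n:] \<in> M" shows "int p dvd n"
proof (rule ccontr)
  have id: "is_ideal M" using M by (simp_all add: maximal_ideal_def)
  assume "\<not> int p dvd n"
  then have "coprime (int p) n" using p(1) by (simp add: prime_imp_coprime)
  then obtain x y where "x * int p + y * n = 1" by (metis bezout_int coprime_imp_gcd_eq_1)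
  then have "[:x:] * [:int p:] + [:y:] * [:n:] = 1" by (simp add: one_pCons mult.commute)
  then show False using ideal_add[OF id ideal_mult[OF id p(2)] ideal_mult[OF id n]] M
    by (metis maximal_ideal_def)
qed

text \<open>The surjective half of the Chinese remainder theorem: \<open>R\<close> maps onto the product of its residue fields
  at distinct maximal ideals, and each of these contains a prime field.\<close>

lemma prod_char_le_ideal_index:
  assumes fin: "finite \<M>" and max: "\<And>M. M \<in> \<M> \<Longrightarrow> maximal_ideal M"
    and p: "\<And>M. M \<in> \<M> \<Longrightarrow> prime (p M) \<and> [:int (p M):] \<in> M"
    and J: "is_ideal J" "finite_index J" "\<And>M. M \<in> \<M> \<Longrightarrow> J \<subseteq> M"
  shows "(\<Prod>M\<in>\<M>. p M) \<le> ideal_index J"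
proof -
  have id: "is_ideal M" if "M \<in> \<M>" for M using max[OF that] by (simp add: maximal_ideal_def)
  have "\<exists>e. e - 1 \<in> M \<and> (\<forall>N\<in>\<M> - {M}. e \<in> N)" if M: "M \<in> \<M>" for M
  proof -
    have "\<exists>a. a \<in> N \<and> a - 1 \<in> M" if N: "N \<in> \<M> - {M}" for N
    proof -
      obtain b where b: "b \<in> N" "b \<notin> M" using maximal_unique[OF max max] N M by blast
      then obtain c where "c * b - 1 \<in> M" using max[OF M] by (auto simp: maximal_ideal_def)
      then show ?thesis using ideal_mult[OF id b(1)] N by blast
    qed
    then obtain a where a: "\<And>N. N \<in> \<M> - {M} \<Longrightarrow> a N \<in> N \<and> a N - 1 \<in> M" by metis
    define e where "e = (\<Prod>N\<in>\<M> - {M}. a N)"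
    have "e \<in> N" if "N \<in> \<M> - {M}" for N
      unfolding e_def using that fin a[OF that] ideal_mult'[OF id]
      by (subst prod.remove[of _ N]) auto
    moreover have "(\<Prod>N\<in>F. a N) - 1 \<in> M" if "finite F" "F \<subseteq> \<M> - {M}" for F
      using that
    proof (induction F rule: finite_induct)
      case empty then show ?case using ideal_zero[OF id[OF M]] by simp
    next
      case (insert N F)
      have "(\<Prod>N\<in>insert N F. a N) - 1 = a N * ((\<Prod>N\<in>F. a N) - 1) + (a N - 1)"
        using insert by (simp add: algebra_simps)
      moreover have "\<dots> \<in> M"
        using insert a[of N] by (intro ideal_add[OF id[OF M]] ideal_mult[OF id[OF M]]) auto
      ultimately show ?case by metis
    qed
    ultimately show ?thesis using fin by (intro exI[of _ e]) (auto simp: e_def)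
  qed
  then obtain e where e: "\<And>M. M \<in> \<M> \<Longrightarrow> e M - 1 \<in> M" "\<And>M N. M \<in> \<M> \<Longrightarrow> N \<in> \<M> - {M} \<Longrightarrow> e M \<in> N"
    by metis
  define w where "w c = (\<Sum>M\<in>\<M>. [:int (c M):] * e M)" for c
  let ?S = "PiE \<M> (\<lambda>M. {..<p M})"
  have "inj_on (\<lambda>c. residue_class J (w c)) ?S"
  proof (rule inj_onI)
    fix c c' assume c: "c \<in> ?S" "c' \<in> ?S" "residue_class J (w c) = residue_class J (w c')"
    have "c M = c' M" if M: "M \<in> \<M>" for M
    proof -
      have idM: "is_ideal M" using id M .
      have wM: "w b - [:int (b M):] \<in> M" for b
      proof -
        have "w b - [:int (b M):] = [:int (b M):] * (e M - 1) + (\<Sum>N\<in>\<M> - {M}. [:int (b N):] * e N)"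
          unfolding w_def using fin M by (subst sum.remove[of _ M]) (simp_all add: smult_diff_right)
        moreover have "\<dots> \<in> M"
        proof (intro ideal_add[OF idM] ideal_sum[OF idM])
          show "[:int (b M):] * (e M - 1) \<in> M" using ideal_mult[OF idM e(1)[OF M]] .
          fix N assume "N \<in> \<M> - {M}"
          then show "[:int (b N):] * e N \<in> M" using ideal_mult[OF idM e(2)[of N M]] M by blast
        qed
        ultimately show ?thesis by metis
      qed
      have "w c - w c' \<in> M" using c(3) residue_class_eq_iff[OF J(1)] J(3)[OF M] by blast
      then have "(w c - w c') - (w c - [:int (c M):]) + (w c' - [:int (c' M):]) \<in> M"
        using ideal_add[OF idM ideal_diff[OF idM _ wM] wM] by blast
      then have "[:int (c M) - int (c' M):] \<in> M" by simp
      then have "int (p M) dvd int (c M) - int (c' M)"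
        using maximal_char_dvd[OF max[OF M]] p[OF M] by blast
      moreover have "c M < p M" "c' M < p M" using c(1,2) M by auto
      ultimately show ?thesis
        by (metis mod_eq_dvd_iff mod_less of_nat_eq_iff zmod_int)
    qed
    then show "c = c'" using c(1,2) by (metis PiE_ext)
  qed
  moreover have "(\<lambda>c. residue_class J (w c)) ` ?S \<subseteq> range (residue_class J)" by blast
  ultimately have "card ?S \<le> ideal_index J" unfolding ideal_index_def
    using J(2) card_inj_on_le unfolding finite_index_def by blast
  then show ?thesis using fin by (simp add: card_PiE)
qed

text \<open>When \<open>m\<close> divides \<open>poly g r\<close>, this is the kernel of the evaluation at \<open>r\<close> from \<open>R\<close> to the integers
  modulo \<open>m\<close>.\<close>

definition eval_ideal :: "int \<Rightarrow> int \<Rightarrow> int poly set" where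
  "eval_ideal m r = {f. m dvd poly f r}"

lemma is_ideal_eval_ideal: "m dvd poly g r \<Longrightarrow> is_ideal (eval_ideal m r)"
  unfolding is_ideal_def eval_ideal_def by auto

lemma ideal_index_eval_ideal:
  assumes "int m dvd poly g r" "m > 0"
  shows "finite_index (eval_ideal (int m) r)" "ideal_index (eval_ideal (int m) r) = m"
proof -
  have id: "is_ideal (eval_ideal (int m) r)" using is_ideal_eval_ideal assms by blast
  have c: "residue_class (eval_ideal (int m) r) w = residue_class (eval_ideal (int m) r) [:poly w r mod int m:]" for w
    unfolding residue_class_eq_iff[OF id] by (simp add: eval_ideal_def)
  have r: "range (residue_class (eval_ideal (int m) r)) = (\<lambda>k. residue_class (eval_ideal (int m) r) [:k:]) ` {0..<int m}"
  proof (intro equalityI subsetI)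
    fix x assume "x \<in> range (residue_class (eval_ideal (int m) r))"
    then obtain w where "x = residue_class (eval_ideal (int m) r) w" by blast
    then have "x = residue_class (eval_ideal (int m) r) [:poly w r mod int m:]" using c by metis
    then show "x \<in> (\<lambda>k. residue_class (eval_ideal (int m) r) [:k:]) ` {0..<int m}" using assms(2) by auto
  qed auto
  have inj: "inj_on (\<lambda>k. residue_class (eval_ideal (int m) r) [:k:]) {0..<int m}"
  proof (rule inj_onI)
    fix k l assume kl: "k \<in> {0..<int m}" "l \<in> {0..<int m}" "residue_class (eval_ideal (int m) r) [:k:] = residue_class (eval_ideal (int m) r) [:l:]"
    then have "int m dvd k - l" unfolding residue_class_eq_iff[OF id] by (simp add: eval_ideal_def)
    then have "k mod int m = l mod int m" by (simp add: mod_eq_dvd_iff)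
    then show "k = l" using kl by simp
  qed
  show "finite_index (eval_ideal (int m) r)" unfolding finite_index_def r by simp
  show "ideal_index (eval_ideal (int m) r) = m" unfolding ideal_index_def r card_image[OF inj] by simp
qed

lemma maximal_eval_ideal:
  assumes p: "prime p" "int p dvd poly g r" shows "maximal_ideal (eval_ideal (int p) r)"
  unfolding maximal_ideal_def
proof (intro conjI allI impI)
  show "is_ideal (eval_ideal (int p) r)" using is_ideal_eval_ideal p by blast
  show "finite_index (eval_ideal (int p) r)" using ideal_index_eval_ideal p prime_gt_0_nat by blast
  show "1 \<notin> eval_ideal (int p) r" using p prime_gt_1_nat[OF p(1)] by (auto simp: eval_ideal_def)
  fix a assume "a \<notin> eval_ideal (int p) r"
  then have "coprime (int p) (poly a r)" using p(1) by (simp add: eval_ideal_def prime_imp_coprime)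
  then obtain x y where "x * int p + y * poly a r = 1" by (metis bezout_int coprime_imp_gcd_eq_1)
  then have "poly ([:y:] * a - 1) r = int p * (- x)" by (simp add: algebra_simps)
  then show "\<exists>c. c * a - 1 \<in> eval_ideal (int p) r" unfolding eval_ideal_def by (intro exI[of _ "[:y:]"]) (metis dvd_triv_left mem_Collect_eq)
qed

definition principal :: "int poly \<Rightarrow> int poly set" where
  "principal z = {f. \<exists>a b. f = a * g + b * z}"

lemma principal_adjoin: "principal z = adjoin (principal 0) z" unfolding principal_def adjoin_def by auto

lemma is_ideal_principal: "is_ideal (principal z)"
proof -
  have "is_ideal (principal 0)" unfolding is_ideal_def principal_def
    by (auto intro: exI[of _ 1] simp: left_diff_distrib[symmetric] mult.assoc[symmetric])
  then show ?thesis using is_ideal_adjoin principal_adjoin by metis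
qed

lemma principal_mem: "z \<in> principal z" unfolding principal_def by (auto intro: exI[of _ 0] exI[of _ 1])

lemma principal_sub: "is_ideal I \<Longrightarrow> z \<in> I \<Longrightarrow> principal z \<subseteq> I"
  unfolding principal_def using ideal_g[of I] ideal_mult[of I z] ideal_add[of I] by fastforce

lemma principal_dvd: "f \<in> principal z \<longleftrightarrow> (\<exists>b. g dvd f - z * b)"
proof
  assume "f \<in> principal z"
  then obtain a b where "f = a * g + b * z" unfolding principal_def by blast
  then have "f - z * b = g * a" by (simp add: algebra_simps)
  then show "\<exists>b. g dvd f - z * b" by (metis dvd_triv_left)
next
  assume "\<exists>b. g dvd f - z * b"
  then obtain a b where "f - z * b = g * a" by (auto elim: dvdE)
  then have "f = a * g + b * z" by (simp add: algebra_simps)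
  then show "f \<in> principal z" unfolding principal_def by blast
qed

text \<open>The absolute value of the field norm of \<open>z\<close>, put as an index so that it can be estimated by counting
  residue classes.\<close>

definition ideal_norm :: "int poly \<Rightarrow> nat" where "ideal_norm z = ideal_index (principal z)"

lemma principal_finite: assumes "\<not> g dvd z" shows "finite_index (principal z)"
proof -
  obtain b n where bn: "n \<noteq> 0" "g dvd z * b - [:n:]" using inverse_up_to_integer[OF assms] by blast
  have "g dvd [:n:] - z * b" using bn(2) by (metis dvd_minus_iff minus_diff_eq)
  then have n: "[:n:] \<in> principal z" unfolding principal_dvd by blast
  have "[:int (nat \<bar>n\<bar>):] \<in> principal z"
  proof (cases "n > 0")
    case False
    then have "[:int (nat \<bar>n\<bar>):] = - [:n:]" by simp
    then show ?thesis using ideal_uminus[OF is_ideal_principal n] by metis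
  qed (use n in simp)
  then show ?thesis using integer_index(1)[OF is_ideal_principal] bn(1) by (metis nat_0_iff zero_less_nat_eq zero_less_abs_iff)
qed

section \<open>The index of a principal ideal\<close>

text \<open>Division by \<open>z\<close> represents every class by a point of a box of side \<open>2 * C * Z + 1\<close>.\<close>

lemma ideal_norm_upper:
  assumes "\<not> g dvd z" "small Z z" "Z \<ge> 0"
  shows "ideal_norm z \<le> nat (2 * C * Z + 1) ^ d"
proof -
  have "range (residue_class (principal z)) \<subseteq> residue_class (principal z) ` box (- (C * Z)) (C * Z + 1)"
  proof clarify
    fix w
    obtain y \<rho> where \<rho>: "small (C * Z) \<rho>" "g dvd w - z * y - \<rho>"
      using division_with_small_remainder[OF assms(1,2), of w] by blast
    have "w - \<rho> - z * y = w - z * y - \<rho>" by simp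
    then have "w - \<rho> \<in> principal z" using \<rho>(2) unfolding principal_dvd by metis
    then have "residue_class (principal z) w = residue_class (principal z) \<rho>" using residue_class_eq_iff[OF is_ideal_principal] by blast
    moreover have "0 \<in> box 0 1" by (simp add: box_def)
    then have "\<rho> \<in> box (- (C * Z)) (C * Z + 1)" using box_add[OF _ \<rho>(1), of 0 0 1] by (simp add: add.commute)
    ultimately show "residue_class (principal z) w \<in> residue_class (principal z) ` box (- (C * Z)) (C * Z + 1)" by blast
  qed
  then have "ideal_norm z \<le> card (residue_class (principal z) ` box (- (C * Z)) (C * Z + 1))"
    unfolding ideal_norm_def ideal_index_def by (intro card_mono) auto
  also have "\<dots> \<le> card (box (- (C * Z)) (C * Z + 1))" by (rule card_image_le) simp
  finally show ?thesis by (simp add: card_box algebra_simps)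
qed

text \<open>The large constant term dominates: multiplication by it scales the largest coefficient of \<open>w\<close> more
  than multiplication by \<open>B * y\<close> can disturb it. The term \<open>C + 1\<close> is chosen to leave a margin of more than \<open>B * X\<close>.\<close>

lemma multiple_large_coeff:
  assumes y: "small X y" and X: "X \<ge> 1" and B: "B \<ge> 1" and w: "w \<noteq> 0" "degree w < d"
    and f: "g dvd ([:1 + B * (C + 1) * X:] + smult B y) * w - f" "degree f < d"
  shows "\<exists>i. \<bar>coeff f i\<bar> \<ge> X"
proof -
  let ?R = "(\<lambda>i. \<bar>coeff w i\<bar>) ` {..<d}"
  define W where "W = Max ?R"
  obtain i where i: "i < d" "W = \<bar>coeff w i\<bar>"
  proof -
    have "W \<in> ?R" unfolding W_def using d_pos by (intro Max_in) auto
    then show ?thesis using that by blast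
  qed
  have le: "\<bar>coeff w j\<bar> \<le> W" if "j < d" for j unfolding W_def using that by (intro Max_ge) auto
  have W1: "W \<ge> 1"
  proof -
    have "coeff w (degree w) \<noteq> 0" using w by simp
    then show ?thesis using le[OF w(2)] by linarith
  qed
  have "small W w" unfolding small_def
  proof (intro conjI allI impI)
    fix j show "\<bar>coeff w j\<bar> \<le> W" using le[of j] W1 w(2) by (cases "j < d") (auto simp: coeff_eq_0)
    show "coeff w j = 0" if "d \<le> j" using that w(2) by (simp add: coeff_eq_0)
  qed
  then obtain c where c: "small (C * X * W) c" "g dvd y * w - c" using small_mult[OF y] by blast
  let ?K = "1 + B * (C + 1) * X"
  have "smult ?K w + smult B c - f = (([:?K:] + smult B y) * w - f) - smult B (y * w - c)"
    by (simp add: algebra_simps smult_diff_right smult_add_left)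
  moreover have "g dvd (([:?K:] + smult B y) * w - f) - smult B (y * w - c)"
    by (rule dvd_diff[OF f(1) dvd_smult[OF c(2)]])
  ultimately have "g dvd smult ?K w + smult B c - f" by metis
  moreover have "degree (smult ?K w + smult B c - f) < d"
  proof -
    have "degree c < d" using c(1) unfolding small_def deg_lt by blast
    then show ?thesis using w(2) f(2) unfolding deg_lt[symmetric] by simp
  qed
  ultimately have "smult ?K w + smult B c - f = 0" by (rule g_dvd_degree)
  then have "coeff (smult ?K w + smult B c - f) i = 0" by simp
  then have eq: "coeff f i = ?K * coeff w i + B * coeff c i" by simp
  have K: "?K \<ge> 0" using B X C_ge_1 by simp
  have "X \<le> (1 + B * X) * W"
  proof -
    have "1 * X \<le> B * X" using X B by (intro mult_right_mono) auto
    then have "X \<le> 1 + B * X" by linarith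
    then have "X * 1 \<le> (1 + B * X) * W" using X W1 by (intro mult_mono) simp_all
    then show ?thesis by simp
  qed
  also have "\<dots> = ?K * W - B * (C * X * W)" by (simp add: algebra_simps)
  also have "\<dots> \<le> \<bar>?K * coeff w i\<bar> - \<bar>B * coeff c i\<bar>"
  proof -
    have "\<bar>coeff c i\<bar> \<le> C * X * W" using c(1) by (simp add: small_def)
    then have "\<bar>B * coeff c i\<bar> \<le> B * (C * X * W)" using B by (simp add: abs_mult)
    moreover have "\<bar>?K * coeff w i\<bar> = ?K * W" using K i(2) by (simp add: abs_mult)
    ultimately show ?thesis by linarith
  qed
  also have "\<dots> \<le> \<bar>coeff f i\<bar>" unfolding eq by linarith
  finally show ?thesis by blast
qed

text \<open>No nonzero multiple of \<open>z\<close> is small enough to be a difference of two points of \<open>box 0 X\<close>, so these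
  \<open>X ^ d\<close> points are incongruent modulo \<open>z\<close>.\<close>

lemma ideal_norm_lower:
  assumes y: "y \<in> box 0 X" and X: "X \<ge> 1" and B: "B \<ge> 1"
    and z: "z = [:1 + B * (C + 1) * X:] + smult B y"
  shows "\<not> g dvd z" "nat X ^ d \<le> ideal_norm z"
proof -
  have "0 \<in> box 0 X" using X by (simp add: box_def)
  then have sy: "small X y" using box_diff_small[OF y _ X] small_mono by fastforce
  show ng: "\<not> g dvd z"
  proof
    assume "g dvd z"
    then have "g dvd z * 1 - 0" by simp
    then show False using multiple_large_coeff[OF sy X B, of 1 0] d_pos X unfolding z by auto
  qed
  have "inj_on (residue_class (principal z)) (box 0 X)"
  proof (rule inj_onI)
    fix u v assume uv: "u \<in> box 0 X" "v \<in> box 0 X" "residue_class (principal z) u = residue_class (principal z) v"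
    then have "u - v \<in> principal z" using residue_class_eq_iff[OF is_ideal_principal] by blast
    then obtain b where b: "g dvd u - v - z * b" using principal_dvd by blast
    obtain w where w: "\<forall>i\<ge>d. coeff w i = 0" "g dvd b - w" using reduce_exists by blast
    have "z * w - (u - v) = - ((u - v - z * b) + z * (b - w))" by (simp add: algebra_simps)
    moreover have "g dvd - ((u - v - z * b) + z * (b - w))"
      using dvd_add[OF b dvd_mult[OF w(2), of z]] dvd_minus_iff by blast
    ultimately have gd: "g dvd z * w - (u - v)" by metis
    have sm: "small (X - 1) (u - v)" using box_diff_small[OF uv(1,2) X] .
    then have dg: "degree (u - v) < d" unfolding small_def deg_lt by blast
    show "u = v"
    proof (cases "w = 0")
      case True
      then have "g dvd u - v" using gd dvd_minus_iff[of g "v - u"] by simp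
      then show ?thesis using g_dvd_degree dg by fastforce
    next
      case False
      then obtain i where "\<bar>coeff (u - v) i\<bar> \<ge> X"
        using multiple_large_coeff[OF sy X B False _ gd[unfolded z] dg] w(1) deg_lt by blast
      moreover have "\<bar>coeff (u - v) i\<bar> \<le> X - 1" using sm by (simp only: small_def)
      ultimately show ?thesis by linarith
    qed
  qed
  then have "card (box 0 X) \<le> card (range (residue_class (principal z)))"
    using card_inj_on_le[of _ "box 0 X"] principal_finite[OF ng] unfolding finite_index_def by blast
  then show "nat X ^ d \<le> ideal_norm z" by (simp add: card_box ideal_norm_def ideal_index_def)
qed

text \<open>These pairs correspond to the maximal ideals above \<open>z\<close> whose residue field has prime order.\<close>

definition common_roots :: "int poly \<Rightarrow> (nat \<times> int) set" where
  "common_roots z = {(p,r). prime p \<and> r \<in> {0..<int p} \<and> int p dvd poly g r \<and> int p dvd poly z r}"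

abbreviation root_prod :: "int poly \<Rightarrow> nat" where
  "root_prod z \<equiv> (\<Prod>(p,r)\<in>common_roots z. p)"

lemma eval_ideal_eqD:
  assumes "prime p" "prime q" "r \<in> {0..<int p}" "s \<in> {0..<int q}"
    "int p dvd poly g r" "int q dvd poly g s" "eval_ideal (int p) r = eval_ideal (int q) s"
  shows "p = q \<and> r = s"
proof -
  have "[:int p:] \<in> eval_ideal (int q) s" using assms(7)[symmetric] by (simp add: eval_ideal_def)
  then have pq: "p = q" using assms(1,2) by (auto simp: eval_ideal_def dest: primes_dvd_imp_eq)
  have "[:-r,1:] \<in> eval_ideal (int q) s" using assms(7)[symmetric] by (simp add: eval_ideal_def)
  then have "int p dvd s - r" using pq by (simp add: eval_ideal_def)
  then have "s mod int p = r mod int p" by (simp add: mod_eq_dvd_iff)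
  then show ?thesis using assms(3,4) pq by simp
qed

lemma prod_common_roots_le:
  assumes "finite F" "F \<subseteq> {(p,r). prime p \<and> r \<in> {0..<int p} \<and> int p dvd poly g r}"
    and J: "is_ideal J" "finite_index J" "\<And>p r. (p,r) \<in> F \<Longrightarrow> J \<subseteq> eval_ideal (int p) r"
  shows "(\<Prod>(p,r)\<in>F. p) \<le> ideal_index J"
proof -
  let ?e = "\<lambda>(p,r). eval_ideal (int p) r"
  have inj: "inj_on ?e F"
  proof (rule inj_onI)
    fix x y assume "x \<in> F" "y \<in> F" "?e x = ?e y"
    then show "x = y" using assms(2) eval_ideal_eqD[of "fst x" "fst y" "snd x" "snd y"]
      by (cases x; cases y) auto
  qed
  define p where "p M = fst (the_inv_into F ?e M)" for M
  have p: "p (?e x) = fst x" if "x \<in> F" for x unfolding p_def using the_inv_into_f_f[OF inj that] by simp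
  have "(\<Prod>M\<in>?e ` F. p M) \<le> ideal_index J"
  proof (rule prod_char_le_ideal_index[OF _ _ _ J(1,2)])
    show "finite (?e ` F)" using assms(1) by simp
    fix M assume "M \<in> ?e ` F"
    then obtain x where x: "x \<in> F" "M = ?e x" by blast
    then obtain a r where ar: "x = (a,r)" by (cases x)
    then have *: "prime a" "int a dvd poly g r" using assms(2) x by auto
    show "maximal_ideal M" using maximal_eval_ideal[OF *] x ar by simp
    show "prime (p M) \<and> [:int (p M):] \<in> M" using p[OF x(1)] * ar x by (simp add: eval_ideal_def)
    show "J \<subseteq> M" using J(3) x ar by blast
  qed
  also have "(\<Prod>M\<in>?e ` F. p M) = (\<Prod>(p,r)\<in>F. p)"
    using inj p by (subst prod.reindex) (auto intro!: prod.cong)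
  finally show ?thesis .
qed

text \<open>The Chinese remainder theorem for the evaluation ideals that contain \<open>z\<close>.\<close>

lemma common_roots_bound:
  assumes "\<not> g dvd z"
  shows "finite (common_roots z)" "root_prod z \<le> ideal_norm z" "(p,r) \<in> common_roots z \<Longrightarrow> p \<le> ideal_norm z"
proof -
  have sub: "principal z \<subseteq> eval_ideal (int p) r" if "(p,r) \<in> common_roots z" for p r
    using that by (intro principal_sub is_ideal_eval_ideal) (auto simp: common_roots_def eval_ideal_def)
  have *: "finite F \<Longrightarrow> F \<subseteq> common_roots z \<Longrightarrow> (\<Prod>(p,r)\<in>F. p) \<le> ideal_norm z" for F
    unfolding ideal_norm_def using sub
    by (intro prod_common_roots_le is_ideal_principal principal_finite assms) (auto simp: common_roots_def)
  show 1: "p \<le> ideal_norm z" if "(p,r) \<in> common_roots z" for p r using *[of "{(p,r)}"] that by simp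
  have "common_roots z \<subseteq> {..ideal_norm z} \<times> {0..int (ideal_norm z)}"
  proof (rule subrelI)
    fix p r assume pr: "(p, r) \<in> common_roots z"
    then have "0 \<le> r" "r < int p" by (simp_all add: common_roots_def)
    then show "(p, r) \<in> {..ideal_norm z} \<times> {0..int (ideal_norm z)}" using 1[OF pr] by simp
  qed
  then show "finite (common_roots z)" by (rule finite_subset) simp
  then show "root_prod z \<le> ideal_norm z" using * by blast
qed

text \<open>The product of the characteristics of such ideals is at most the index \<open>p ^ d\<close> of the ideal
  generated by \<open>p\<close>.\<close>

lemma maximal_above_prime:
  assumes p: "prime p"
  shows "finite {M. maximal_ideal M \<and> [:int p:] \<in> M}" "card {M. maximal_ideal M \<and> [:int p:] \<in> M} \<le> d"
proof -
  let ?S = "{M. maximal_ideal M \<and> [:int p:] \<in> M}"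
  have *: "finite F \<Longrightarrow> F \<subseteq> ?S \<Longrightarrow> card F \<le> d" for F
  proof -
    assume F: "finite F" "F \<subseteq> ?S"
    have p0: "p > 0" using p prime_gt_0_nat by blast
    have principal: "finite_index (principal [:int p:])" "ideal_index (principal [:int p:]) \<le> p ^ d"
      using integer_index[OF is_ideal_principal principal_mem p0] .
    have "(\<Prod>M\<in>F. p) \<le> ideal_index (principal [:int p:])"
      using F p by (intro prod_char_le_ideal_index[OF F(1) _ _ is_ideal_principal principal(1)] principal_sub)
        (auto simp: maximal_ideal_def)
    then have "p ^ card F \<le> p ^ d" using principal(2) by simp
    then show "card F \<le> d" using prime_gt_1_nat[OF p] by simp
  qed
  show "finite ?S"
  proof (rule ccontr)
    assume "infinite ?S"
    then obtain F where "finite F" "card F = Suc d" "F \<subseteq> ?S" by (meson infinite_arbitrarily_large)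
    then show False using * by fastforce
  qed
  then show "card ?S \<le> d" using * by blast
qed

definition roots :: "nat \<Rightarrow> int set" where
  "roots p = {r \<in> {0..<int p}. int p dvd poly g r}"

lemma finite_roots [simp]: "finite (roots p)"
  by (rule finite_subset[of _ "{0..<int p}"]) (auto simp: roots_def)

lemma card_roots_le: assumes p: "prime p" shows "card (roots p) \<le> d"
proof -
  have "inj_on (eval_ideal (int p)) (roots p)"
    by (rule inj_onI) (use eval_ideal_eqD[OF p p] in \<open>simp add: roots_def\<close>)
  moreover have "eval_ideal (int p) ` roots p \<subseteq> {M. maximal_ideal M \<and> [:int p:] \<in> M}"
    using maximal_eval_ideal[OF p] by (auto simp: roots_def eval_ideal_def)
  ultimately have "card (roots p) \<le> card {M. maximal_ideal M \<and> [:int p:] \<in> M}"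
    using maximal_above_prime[OF p] by (meson card_inj_on_le)
  then show ?thesis using maximal_above_prime(2)[OF p] by simp
qed

text \<open>If the class of \<open>x\<close> modulo \<open>M\<close> is an integer \<open>r\<close>, then \<open>M\<close> is an evaluation ideal.\<close>

lemma linear_mem_iff:
  assumes M: "maximal_ideal M" and p: "prime p" "[:int p:] \<in> M" and r: "[:-r,1:] \<in> M"
  shows "f \<in> M \<longleftrightarrow> int p dvd poly f (r mod int p)"
proof -
  have id: "is_ideal M" using M by (simp add: maximal_ideal_def)
  have "f = [:-r,1:] * synthetic_div f r + [:poly f r:]"
    using synthetic_div_correct'[of r f] by simp
  then have "f - [:poly f r:] = [:-r,1:] * synthetic_div f r" by simp
  then have m: "f - [:poly f r:] \<in> M" using ideal_mult'[OF id r] by metis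
  have "f \<in> M \<longleftrightarrow> [:poly f r:] \<in> M"
    using ideal_diff[OF id _ m] ideal_add[OF id _ m] by force
  also have "\<dots> \<longleftrightarrow> int p dvd poly f r"
  proof
    assume "int p dvd poly f r"
    then obtain k where "poly f r = int p * k" by blast
    then have "[:poly f r:] = [:int p:] * [:k:]" by simp
    then show "[:poly f r:] \<in> M" using ideal_mult'[OF id p(2)] by metis
  qed (use maximal_char_dvd[OF M p] in blast)
  also have "\<dots> \<longleftrightarrow> int p dvd poly f (r mod int p)"
    using poly_cong_mod[where m = "int p" and r = r and f = f] by (simp add: dvd_eq_mod_eq_0)
  finally show ?thesis .
qed

section \<open>Polynomials whose index is explained by roots modulo primes\<close>

definition simple_at :: "nat \<Rightarrow> bool" where
  "simple_at p \<longleftrightarrow> (\<forall>r. int p dvd poly g r \<longrightarrow> \<not> int p dvd poly (pderiv g) r)"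

text \<open>A root modulo \<open>p\<^sup>2\<close> above \<open>r\<close>, provided by Hensel's lemma when \<open>r\<close> is a simple root modulo \<open>p\<close>.\<close>

definition root_lift :: "nat \<Rightarrow> int \<Rightarrow> int" where
  "root_lift p r = (SOME s. int p dvd s - r \<and> (int p)\<^sup>2 dvd poly g s)"

lemma root_lift:
  assumes p: "prime p" "simple_at p" "int p dvd poly g r"
  shows "int p dvd root_lift p r - r" "(int p)\<^sup>2 dvd poly g (root_lift p r)"
proof -
  have "\<exists>s. int p dvd s - r \<and> (int p)\<^sup>2 dvd poly g s"
  proof -
    have "coprime (int p) (poly (pderiv g) r)" using p by (simp add: simple_at_def prime_imp_coprime)
    then obtain x y where xy: "x * int p + y * poly (pderiv g) r = 1" by (metis bezout_int coprime_imp_gcd_eq_1)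
    obtain k where k: "poly g r = int p * k" using p(3) by blast
    obtain h where h: "poly g (r + - (y * poly g r)) = poly g r + - (y * poly g r) * poly (pderiv g) r + (- (y * poly g r))\<^sup>2 * h"
      using poly_taylor2 by blast
    also have "\<dots> = poly g r * (1 - y * poly (pderiv g) r) + (- (y * poly g r))\<^sup>2 * h" by (simp add: algebra_simps)
    also have "1 - y * poly (pderiv g) r = x * int p" using xy by linarith
    also have "poly g r * (x * int p) + (- (y * poly g r))\<^sup>2 * h = (int p)\<^sup>2 * (k * x + y\<^sup>2 * k\<^sup>2 * h)"
      by (simp add: k power2_eq_square algebra_simps)
    finally have "(int p)\<^sup>2 dvd poly g (r + - (y * poly g r))" by simp
    moreover have "int p dvd (r + - (y * poly g r)) - r" using p(3) by simp
    ultimately show ?thesis by blast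
  qed
  then have "int p dvd root_lift p r - r \<and> (int p)\<^sup>2 dvd poly g (root_lift p r)"
    unfolding root_lift_def by (rule someI_ex)
  then show "int p dvd root_lift p r - r" "(int p)\<^sup>2 dvd poly g (root_lift p r)" by blast+
qed

text \<open>Ideals of index at least \<open>p\<^sup>2\<close> that account for every excess of the norm over the product of primes
  at common roots: either the residue field at \<open>p\<close> is not of prime order, or \<open>z\<close> vanishes to
  second order at a root.\<close>

definition bad_ideals :: "nat \<Rightarrow> int poly set set" where
  "bad_ideals p = {M. maximal_ideal M \<and> [:int p:] \<in> M \<and> (\<forall>r. [:-r,1:] \<notin> M)} \<union>
           (\<lambda>r. eval_ideal (int (p\<^sup>2)) (root_lift p r)) ` roots p"

lemma card_bad:
  assumes p: "prime p" shows "finite (bad_ideals p)" "card (bad_ideals p) \<le> 2 * d"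
proof -
  let ?A = "{M. maximal_ideal M \<and> [:int p:] \<in> M \<and> (\<forall>r. [:-r,1:] \<notin> M)}"
  have sub: "?A \<subseteq> {M. maximal_ideal M \<and> [:int p:] \<in> M}" by blast
  have A: "finite ?A" "card ?A \<le> d"
    using finite_subset[OF sub maximal_above_prime(1)[OF p]]
      card_mono[OF maximal_above_prime(1)[OF p] sub] maximal_above_prime(2)[OF p] by auto
  show "finite (bad_ideals p)" unfolding bad_ideals_def using A(1) by simp
  have "card (bad_ideals p) \<le> card ?A + card ((\<lambda>r. eval_ideal (int (p\<^sup>2)) (root_lift p r)) ` roots p)"
    unfolding bad_ideals_def by (rule card_Un_le)
  also have "card ((\<lambda>r. eval_ideal (int (p\<^sup>2)) (root_lift p r)) ` roots p) \<le> card (roots p)"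
    by (rule card_image_le) simp
  finally show "card (bad_ideals p) \<le> 2 * d" using A(2) card_roots_le[OF p] by linarith
qed

text \<open>The \<open>p\<^sup>2\<close> polynomials \<open>a + b x\<close> with \<open>a, b < p\<close> are incongruent: otherwise \<open>x\<close> would be congruent to
  an integer.\<close>

lemma ideal_index_nonlinear:
  assumes M: "maximal_ideal M" and p: "prime p" "[:int p:] \<in> M" and nl: "\<And>r. [:-r,1:] \<notin> M"
  shows "p\<^sup>2 \<le> ideal_index M"
proof -
  have id: "is_ideal M" and fin: "finite_index M" using M by (simp_all add: maximal_ideal_def)
  let ?S = "{..<p} \<times> {..<p}"
  have "inj_on (\<lambda>(a,b). residue_class M [:int a, int b:]) ?S"
  proof (rule inj_onI)
    fix x y assume xy: "x \<in> ?S" "y \<in> ?S"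
      "(\<lambda>(a,b). residue_class M [:int a, int b:]) x = (\<lambda>(a,b). residue_class M [:int a, int b:]) y"
    obtain a b a' b' where ab: "x = (a, b)" "y = (a', b')" by (cases x, cases y)
    have *: "a \<in> {..<p}" "b \<in> {..<p}" "a' \<in> {..<p}" "b' \<in> {..<p}"
      "residue_class M [:int a, int b:] = residue_class M [:int a', int b':]" using xy by (auto simp: ab)
    have m: "[:int a - int a', int b - int b':] \<in> M" using *(5) residue_class_eq_iff[OF id] by auto
    have "int p dvd int b - int b'"
    proof (rule ccontr)
      assume "\<not> int p dvd int b - int b'"
      then have "coprime (int p) (int b - int b')" using p(1) by (simp add: prime_imp_coprime)
      then obtain x y where xy: "x * int p + y * (int b - int b') = 1" by (metis bezout_int coprime_imp_gcd_eq_1)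
      have "[:0,x:] * [:int p:] + [:y:] * [:int a - int a', int b - int b':] \<in> M"
        by (intro ideal_add[OF id] ideal_mult[OF id] p(2) m)
      also have "[:0,x:] * [:int p:] + [:y:] * [:int a - int a', int b - int b':] = [:- (- (y * (int a - int a'))), 1:]"
        using xy by (simp add: algebra_simps)
      finally show False using nl by blast
    qed
    then have bb: "b = b'" using *(2,4) by (metis lessThan_iff mod_eq_dvd_iff mod_less of_nat_eq_iff zmod_int)
    then have "[:int a - int a':] \<in> M" using m by simp
    then have "int p dvd int a - int a'" using maximal_char_dvd[OF M p] by blast
    then have "a = a'" using *(1,3) by (metis lessThan_iff mod_eq_dvd_iff mod_less of_nat_eq_iff zmod_int)
    then show "x = y" using bb by (simp add: ab)
  qed
  moreover have "(\<lambda>(a,b). residue_class M [:int a, int b:]) ` ?S \<subseteq> range (residue_class M)" by auto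
  ultimately have "card ?S \<le> card (range (residue_class M))"
    using card_inj_on_le[of _ ?S] fin unfolding finite_index_def by blast
  then show ?thesis by (simp add: ideal_index_def power2_eq_square card_cartesian_product)
qed

lemma bad_ideal:
  assumes p: "prime p" "simple_at p" and I: "I \<in> bad_ideals p"
  shows "is_ideal I" "finite_index I" "p\<^sup>2 \<le> ideal_index I" "[:int (p\<^sup>2):] \<in> I"
proof -
  consider (M) "maximal_ideal I" "[:int p:] \<in> I" "\<forall>r. [:-r,1:] \<notin> I"
    | (E) r where "r \<in> roots p" "I = eval_ideal (int (p\<^sup>2)) (root_lift p r)"
    using I unfolding bad_ideals_def by blast
  then have "is_ideal I \<and> finite_index I \<and> p\<^sup>2 \<le> ideal_index I \<and> [:int (p\<^sup>2):] \<in> I"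
  proof cases
    case M
    then have id: "is_ideal I" by (simp add: maximal_ideal_def)
    have "[:int p:] * [:int p:] \<in> I" by (rule ideal_mult[OF id M(2)])
    then show ?thesis using M(1) ideal_index_nonlinear[OF M(1) p(1) M(2)] M(3)
      by (auto simp: maximal_ideal_def power2_eq_square)
  next
    case E
    have gl: "int (p\<^sup>2) dvd poly g (root_lift p r)" using root_lift(2)[OF p] E(1) by (simp add: roots_def)
    have "p\<^sup>2 > 0" using prime_gt_0_nat[OF p(1)] by simp
    then show ?thesis using ideal_index_eval_ideal[OF gl] is_ideal_eval_ideal[OF gl] E(2) by (simp add: eval_ideal_def)
  qed
  then show "is_ideal I" "finite_index I" "p\<^sup>2 \<le> ideal_index I" "[:int (p\<^sup>2):] \<in> I" by blast+
qed

text \<open>Let \<open>J\<close> be the intersection of the evaluation ideals at the common roots. Its index is at most the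
  product on the right, so it suffices that every \<open>w \<in> J\<close> is a multiple of \<open>z\<close>. If not, some maximal ideal
  \<open>M\<close> contains all \<open>y\<close> for which \<open>y * w\<close> is a multiple of \<open>z\<close>. By assumption \<open>M\<close> is the evaluation ideal at
  a simple root, and \<open>z\<close> vanishes there only to first order, while \<open>w\<close> vanishes too. So \<open>w\<close> is a multiple of
  \<open>z\<close> locally at \<open>M\<close>: some \<open>y1\<close> outside \<open>M\<close> makes \<open>y1 * w\<close> a multiple of \<open>z\<close>, a contradiction.\<close>

lemma ideal_norm_le_prod_common_roots:
  assumes z: "\<not> g dvd z"
    and good: "\<And>p M. prime p \<Longrightarrow> maximal_ideal M \<Longrightarrow> [:int p:] \<in> M \<Longrightarrow> z \<in> M \<Longrightarrow>
                 simple_at p \<and> z \<notin> \<Union>(bad_ideals p)"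
  shows "ideal_norm z \<le> root_prod z"
proof -
  define J where "J = {w. \<forall>(p,r)\<in>common_roots z. int p dvd poly w r}"
  have Jid: "is_ideal J" unfolding is_ideal_def J_def common_roots_def by auto
  have "J \<subseteq> principal z"
  proof
    fix w assume w: "w \<in> J"
    show "w \<in> principal z"
    proof (rule ccontr)
      assume nw: "w \<notin> principal z"
      define Q where "Q = {y. y * w \<in> principal z}"
      have Qid: "is_ideal Q" unfolding is_ideal_def
      proof (intro conjI ballI allI)
        show "g \<in> Q" using ideal_g[OF is_ideal_principal] by (simp add: Q_def)
        show "a - b \<in> Q" if "a \<in> Q" "b \<in> Q" for a b
          using ideal_diff[OF is_ideal_principal] that by (simp add: Q_def left_diff_distrib)
        show "c * a \<in> Q" if "a \<in> Q" for a c
          using ideal_mult[OF is_ideal_principal] that by (simp add: Q_def mult.assoc)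
      qed
      have PQ: "principal z \<subseteq> Q" unfolding Q_def using ideal_mult'[OF is_ideal_principal] by blast
      have "finite_index Q" by (rule finite_index_mono(1)[OF is_ideal_principal Qid PQ principal_finite[OF z]])
      moreover have "1 \<notin> Q" using nw by (simp add: Q_def)
      ultimately obtain M where M: "maximal_ideal M" "Q \<subseteq> M" using ex_maximal_ideal[OF Qid] by metis
      have id: "is_ideal M" using M(1) by (simp add: maximal_ideal_def)
      have zM: "z \<in> M" using PQ M(2) principal_mem by blast
      obtain p where p: "prime p" "[:int p:] \<in> M" by (rule maximal_residue_char[OF M(1)])
      have gd: "simple_at p" "z \<notin> \<Union>(bad_ideals p)" using good[OF p(1) M(1) p(2) zM] by auto
      then have "M \<notin> bad_ideals p" using zM by blast
      then obtain r where r: "[:-r,1:] \<in> M" using M(1) p(2) by (auto simp: bad_ideals_def)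
      define r0 where "r0 = r mod int p"
      have Mr: "f \<in> M \<longleftrightarrow> int p dvd poly f r0" for f
        unfolding r0_def by (rule linear_mem_iff[OF M(1) p r])
      have p0: "int p > 0" using prime_gt_0_nat[OF p(1)] by simp
      have r0: "r0 \<in> {0..<int p}" using p0 by (simp add: r0_def)
      have gr: "int p dvd poly g r0" using Mr[of g] id by (simp add: is_ideal_def)
      have zr: "int p dvd poly z r0" using Mr zM by blast
      have "(p, r0) \<in> common_roots z" using p(1) r0 gr zr by (simp add: common_roots_def)
      then have wr: "int p dvd poly w r0" using w by (auto simp: J_def)
      define s where "s = root_lift p r0"
      have s: "int p dvd s - r0" "(int p)\<^sup>2 dvd poly g s" unfolding s_def using root_lift[OF p(1) gd(1) gr] by auto
      have cong: "int p dvd poly f s \<longleftrightarrow> int p dvd poly f r0" for f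
        using dvd_trans[OF s(1) poly_diff_dvd[of s r0 f]] dvd_diff_right_iff by (metis dvd_add_left_iff diff_add_cancel)
      have "r0 \<in> roots p" using r0 gr by (simp add: roots_def)
      then have "z \<notin> eval_ideal (int (p\<^sup>2)) s" using gd(2) unfolding bad_ideals_def s_def by blast
      then have nz: "\<not> (int p)\<^sup>2 dvd poly z s" by (simp add: eval_ideal_def)
      obtain a where a: "poly z s = int p * a" using cong[of z] zr by blast
      obtain b where b: "poly w s = int p * b" using cong[of w] wr by blast
      obtain e where e: "poly g s = int p * (int p * e)"
        using s(2) unfolding power2_eq_square by (metis dvdE mult.assoc)
      have na: "\<not> int p dvd a" using nz a by (auto simp: power2_eq_square)
      define h where "h = synthetic_div g s"
      define t where "t = synthetic_div z s"
      define u where "u = synthetic_div w s"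
      have gh: "g = [:-s,1:] * h + [:int p:] * [:int p * e:]"
      proof -
        have "[:int p:] * [:int p * e:] = [:poly g s:]" using e by (simp add: ac_simps)
        then show ?thesis using synthetic_div_correct'[of s g] by (metis h_def)
      qed
      have zt: "z = [:-s,1:] * t + [:int p:] * [:a:]"
        using synthetic_div_correct'[of s z] a by (simp add: t_def mult.commute)
      have wu: "w = [:-s,1:] * u + [:int p:] * [:b:]"
        using synthetic_div_correct'[of s w] b by (simp add: u_def mult.commute)
      \<comment> \<open>Since \<open>[:-s,1:] * h\<close> is divisible by \<open>p\<^sup>2\<close> modulo \<open>g\<close>, multiplication by \<open>h\<close>, which is a unit at \<open>M\<close>,
        turns \<open>z\<close> and \<open>w\<close> into \<open>p * y1\<close> and \<open>p * y2\<close>.\<close>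
      define y1 where "y1 = [:a:] * h - [:int p * e:] * t"
      define y2 where "y2 = [:b:] * h - [:int p * e:] * u"
      have hz: "h * z = g * t + [:int p:] * y1"
        by (subst zt, subst gh) (simp only: y1_def algebra_simps)
      have hw: "h * w = g * u + [:int p:] * y2"
        by (subst wu, subst gh) (simp only: y2_def algebra_simps)
      have "[:int p:] * (y1 * w - y2 * z) = ([:int p:] * y1) * w - ([:int p:] * y2) * z"
        by (simp only: algebra_simps)
      also have "\<dots> = (h * z - g * t) * w - (h * w - g * u) * z" by (simp only: hz hw add_diff_cancel_left')
      also have "\<dots> = g * (u * z - t * w)" by (simp only: algebra_simps)
      finally have "g dvd [:int p:] * (y1 * w - y2 * z)" by (metis dvd_triv_left)
      then have "g dvd y1 * w - y2 * z" using g_dvd_multD not_g_dvd_const[of "int p"] p0 by (metis less_irrefl)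
      then have "y1 * w \<in> principal z" unfolding principal_dvd by (metis mult.commute)
      then have "y1 \<in> M" using M(2) unfolding Q_def by blast
      then have "int p dvd poly y1 s" using Mr cong by blast
      then have "int p dvd a * poly h s"
        unfolding y1_def by (simp add: mult.assoc dvd_diff_left_iff)
      then have "int p dvd poly h s" using na p(1) prime_dvd_mult_iff[of "int p"] by simp
      moreover have "pderiv g = h + [:-s,1:] * pderiv h"
        by (subst gh) (simp add: pderiv_add pderiv_diff pderiv_mult pderiv_pCons pderiv_smult)
      then have "poly (pderiv g) s = poly h s" by simp
      ultimately have "int p dvd poly (pderiv g) s" by simp
      moreover have "int p dvd poly g s" using cong gr by blast
      ultimately show False using gd(1) by (simp add: simple_at_def)
    qed
  qed
  have fz: "finite (common_roots z)" by (rule common_roots_bound(1)[OF z])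
  let ?T = "PiE (common_roots z) (\<lambda>(p,r). {0..<int p})"
  define \<phi> where "\<phi> w = restrict (\<lambda>(p,r). poly w r mod int p) (common_roots z)" for w
  have \<phi>: "\<phi> w \<in> ?T" for w unfolding \<phi>_def by (auto simp: common_roots_def prime_gt_0_nat)
  have fT: "finite ?T" using fz by (intro finite_PiE) auto
  have sub\<phi>: "range \<phi> \<subseteq> ?T" using \<phi> by blast
  have fr: "finite (range \<phi>)" by (rule finite_subset[OF sub\<phi> fT])
  have eq: "residue_class J w = residue_class J w'" if "\<phi> w = \<phi> w'" for w w'
  proof -
    have "w - w' \<in> J" unfolding J_def
    proof (intro CollectI, clarify)
    fix p r assume pr: "(p,r) \<in> common_roots z"
    have "poly w r mod int p = poly w' r mod int p" using fun_cong[OF that, of "(p,r)"] pr by (simp add: \<phi>_def)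
    then show "int p dvd poly (w - w') r" by (simp add: mod_eq_dvd_iff)
    qed
    then show ?thesis using residue_class_eq_iff[OF Jid] by blast
  qed
  define \<psi> where "\<psi> x = residue_class J (SOME w. \<phi> w = x)" for x
  have \<psi>: "\<psi> (\<phi> w) = residue_class J w" for w unfolding \<psi>_def by (rule eq) (rule someI, rule refl)
  have rc: "range (residue_class J) = \<psi> ` range \<phi>" using \<psi> by (simp add: image_image)
  have finJ: "finite_index J" unfolding finite_index_def rc using fr by simp
  have "ideal_index J \<le> card (range \<phi>)" unfolding ideal_index_def rc by (rule card_image_le[OF fr])
  also have "\<dots> \<le> card ?T" by (rule card_mono[OF fT sub\<phi>])
  also have "\<dots> = root_prod z" using fz by (auto simp: card_PiE intro!: prod.cong)
  finally have "ideal_index J \<le> root_prod z" .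
  moreover have "ideal_norm z \<le> ideal_index J" unfolding ideal_norm_def
    by (rule finite_index_mono(2)[OF Jid is_ideal_principal \<open>J \<subseteq> principal z\<close> finJ])
  ultimately show ?thesis by linarith
qed

text \<open>\<open>D\<close> is a nonzero integer in the ideal generated by \<open>g\<close> and its derivative.\<close>

lemma ex_discriminant:
  obtains D :: nat where "D > 0" "\<And>p. prime p \<Longrightarrow> \<not> p dvd D \<Longrightarrow> simple_at p"
proof -
  have "pderiv g \<noteq> 0" using d_pos by (simp add: pderiv_eq_0_iff)
  then have "\<not> g dvd pderiv g" using g_dvd_degree[of "pderiv g"] d_pos degree_pderiv[of g] by fastforce
  then obtain b n where bn: "n \<noteq> 0" "g dvd pderiv g * b - [:n:]" using inverse_up_to_integer by blast
  then obtain c where c: "pderiv g * b - [:n:] = g * c" by blast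
  have "simple_at p" if p: "prime p" "\<not> p dvd nat \<bar>n\<bar>" for p
    unfolding simple_at_def
  proof (intro allI impI notI)
    fix r assume r: "int p dvd poly g r" "int p dvd poly (pderiv g) r"
    have "poly (pderiv g * b - [:n:]) r = poly (g * c) r" using c by simp
    then have "n = poly (pderiv g) r * poly b r - poly g r * poly c r" by simp
    then have "int p dvd n" using r by simp
    then show False using p(2) by simp
  qed
  then show thesis using that[of "nat \<bar>n\<bar>"] bn(1) by simp
qed

section \<open>The average number of roots modulo primes: upper bound\<close>

abbreviation c :: real where "c \<equiv> real_of_int C"

lemma c_ge_1: "c \<ge> 1" using C_ge_1 by simp

lemma ex_root_floor: "\<exists>A::nat. A ^ d \<le> n \<and> n < (A + 1) ^ d"
proof -
  define A where "A = (LEAST A. n < (A + 1) ^ d)"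
  have "n < (n + 1) ^ d" using d_pos by (meson less_add_one less_le_trans self_le_power le_add2)
  then have A: "n < (A + 1) ^ d" unfolding A_def by (rule LeastI)
  have "A ^ d \<le> n"
  proof (cases A)
    case 0 show ?thesis unfolding 0 zero_power[OF d_pos] by simp
  next
    case (Suc B)
    then have "B < (LEAST A. n < (A + 1) ^ d)" unfolding A_def by simp
    then have "\<not> n < (B + 1) ^ d" by (rule not_less_Least)
    then show ?thesis using Suc by simp
  qed
  then show ?thesis using A by blast
qed

lemma coset_count:
  assumes I: "is_ideal I" "finite_index I"
  shows "\<exists>A::nat. A ^ d \<le> ideal_index I \<and>
    real (card (coset_points (int X) y0 I) * ideal_index I) \<le> (real X + 2 * c * A) ^ d \<and>
    (2 * c * A \<le> X \<longrightarrow> (real X - 2 * c * A) ^ d \<le> real (card (coset_points (int X) y0 I) * ideal_index I))"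
proof -
  obtain A where A: "A ^ d \<le> ideal_index I" "ideal_index I < (A + 1) ^ d" using ex_root_floor by blast
  have C0: "C \<ge> 0" using C_ge_1 by simp
  let ?n = "card (coset_points (int X) y0 I) * ideal_index I"
  have "real ?n \<le> real (nat (int X + 2 * (C * int A)) ^ d)"
    using coset_count_upper[OF I A(2)] of_nat_le_iff by blast
  also have "\<dots> = (real X + 2 * c * A) ^ d" using C0 by (simp add: of_nat_nat mult.assoc)
  finally have 1: "real ?n \<le> (real X + 2 * c * A) ^ d" .
  have 2: "(real X - 2 * c * A) ^ d \<le> real ?n" if "2 * c * A \<le> X"
  proof -
    have "real_of_int (2 * (C * int A)) \<le> real_of_int (int X)" using that by simp
    then have "2 * (C * int A) \<le> int X" by (simp only: of_int_le_iff)
    then have "(real X - 2 * c * A) ^ d = real (nat (int X - 2 * (C * int A)) ^ d)"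
      by (simp add: of_nat_nat mult.assoc)
    also have "\<dots> \<le> real ?n"
      using coset_count_lower[OF I A(2)] of_nat_le_iff by blast
    finally show ?thesis .
  qed
  show ?thesis using A(1) 1 2 by (intro exI[of _ A] conjI impI)
qed

lemma root_le: assumes "A ^ d \<le> n" "real n \<le> x ^ d" "x \<ge> 0" shows "real A \<le> x"
proof (rule ccontr)
  assume "\<not> real A \<le> x"
  then have "x ^ d < real A ^ d" using assms(3) d_pos by (intro power_strict_mono) auto
  also have "real A ^ d \<le> real n" using assms(1) by (metis of_nat_le_iff of_nat_power)
  finally show False using assms(2) by simp
qed

text \<open>The points of a coset number at most \<open>(1 + 2 * c * t) ^ d\<close> times the expected number as long as the
  index is at most \<open>(t * X) ^ d\<close>; for small \<open>t\<close> this factor is close to \<open>1\<close>.\<close>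

lemma coset_count_le:
  assumes I: "is_ideal I" "finite_index I" and t: "(t::real) \<ge> 0" "real (ideal_index I) \<le> (t * X) ^ d"
  shows "real (card (coset_points (int X) y0 I)) * ideal_index I \<le> ((1 + 2 * c * t) * X) ^ d"
proof -
  obtain A where A: "A ^ d \<le> ideal_index I"
    "real (card (coset_points (int X) y0 I) * ideal_index I) \<le> (real X + 2 * c * A) ^ d"
    using coset_count[OF I, of X y0] by blast
  have "real A \<le> t * X" using root_le[OF A(1) t(2)] t(1) by simp
  then have "2 * c * real A \<le> 2 * c * (t * X)" using c_ge_1 C_ge_1 by (intro mult_left_mono) auto
  then have "(real X + 2 * c * A) ^ d \<le> ((1 + 2 * c * t) * X) ^ d"
    using c_ge_1 C_ge_1 by (intro power_mono) (auto simp: algebra_simps)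
  then show ?thesis using A(2) by simp
qed

lemma coset_count_ge:
  assumes I: "is_ideal I" "finite_index I" and t: "(t::real) \<ge> 0" "real (ideal_index I) \<le> (t * X) ^ d" "2 * c * t \<le> 1"
  shows "((1 - 2 * c * t) * X) ^ d \<le> real (card (coset_points (int X) y0 I)) * ideal_index I"
proof -
  obtain A where A: "A ^ d \<le> ideal_index I"
    "2 * c * A \<le> X \<longrightarrow> (real X - 2 * c * A) ^ d \<le> real (card (coset_points (int X) y0 I) * ideal_index I)"
    using coset_count[OF I, of X y0] by blast
  have "real A \<le> t * X" using root_le[OF A(1) t(2)] t(1) by simp
  then have le: "2 * c * real A \<le> 2 * c * (t * X)" using c_ge_1 C_ge_1 by (intro mult_left_mono) auto
  have "2 * c * t * real X \<le> 1 * real X" using t(3) by (intro mult_right_mono) auto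
  then have le2: "2 * c * real A \<le> X" using le by (simp add: mult.assoc)
  have "((1 - 2 * c * t) * X) ^ d \<le> (real X - 2 * c * A) ^ d"
  proof (rule power_mono)
    show "(1 - 2 * c * t) * X \<le> real X - 2 * c * A" using le by (simp add: algebra_simps)
    show "0 \<le> (1 - 2 * c * t) * X" using t(3) by simp
  qed
  then show ?thesis using A(2) le2 by simp
qed

text \<open>A bound for all indices, with a constant factor lost; the summand \<open>1\<close> covers indices beyond \<open>X ^ d\<close>.\<close>

lemma coset_count_crude:
  assumes I: "is_ideal I" "finite_index I" and m: "m > 0" "m \<le> ideal_index I"
  shows "real (card (coset_points (int X) y0 I)) \<le> (1 + 2 * c) ^ d * (real X ^ d / m + 1)"
proof -
  obtain A where A: "A ^ d \<le> ideal_index I"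
    "real (card (coset_points (int X) y0 I) * ideal_index I) \<le> (real X + 2 * c * A) ^ d"
    using coset_count[OF I, of X y0] by blast
  let ?n = "card (coset_points (int X) y0 I)"
  note C1 = c_ge_1
  have A': "real A ^ d \<le> real (ideal_index I)" using A(1) by (metis of_nat_le_iff of_nat_power)
  have i0: "real (ideal_index I) > 0" using ideal_index_pos[OF I] by simp
  have "real ?n * ideal_index I \<le> ((1 + 2 * c) * max (real X) A) ^ d"
  proof -
    have "2 * c * real A \<le> 2 * c * max (real X) A" using C1 by (intro mult_left_mono) auto
    moreover have "real X \<le> max (real X) A" by simp
    ultimately have "real X + 2 * c * A \<le> (1 + 2 * c) * max (real X) A"
      unfolding distrib_right by linarith
    then have "(real X + 2 * c * A) ^ d \<le> ((1 + 2 * c) * max (real X) A) ^ d"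
      using C1 by (intro power_mono) auto
    then show ?thesis using A(2) by simp
  qed
  also have "\<dots> = (1 + 2 * c) ^ d * max (real X) A ^ d" by (simp add: power_mult_distrib)
  also have "\<dots> \<le> (1 + 2 * c) ^ d * (real X ^ d + ideal_index I)"
  proof (rule mult_left_mono)
    show "max (real X) (real A) ^ d \<le> real X ^ d + real (ideal_index I)"
      using A' by (cases "real X \<le> real A") (auto simp: max_def intro: add_increasing)
  qed (use C1 in simp)
  finally have "real ?n \<le> (1 + 2 * c) ^ d * (real X ^ d + ideal_index I) / ideal_index I" using i0 by (simp add: field_simps)
  also have "\<dots> = (1 + 2 * c) ^ d * (real X ^ d / ideal_index I + 1)" using i0 by (simp add: field_simps)
  also have "\<dots> \<le> (1 + 2 * c) ^ d * (real X ^ d / m + 1)"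
    using m i0 C1 by (intro mult_left_mono add_right_mono divide_left_mono) auto
  finally show ?thesis by simp
qed

definition root_sum :: "nat \<Rightarrow> real" where
  "root_sum n = (\<Sum>p\<in>primes_le n. card (roots p) * ln p / p)"

lemma root_sum_mono: "m \<le> n \<Longrightarrow> root_sum m \<le> root_sum n"
  unfolding root_sum_def by (intro sum_mono2) (auto simp: primes_le_def prime_ge_1_nat)

lemma eval_ideal_root: assumes "prime p" "r \<in> roots p"
  shows "is_ideal (eval_ideal (int p) r)" "finite_index (eval_ideal (int p) r)" "ideal_index (eval_ideal (int p) r) = p"
  using is_ideal_eval_ideal[of "int p" r] ideal_index_eval_ideal[of p r] assms prime_gt_0_nat[of p] by (auto simp: roots_def)

lemma common_roots_Sigma:
  assumes "\<not> g dvd z" "ideal_norm z \<le> K"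
  shows "common_roots z = Sigma (primes_le K) (\<lambda>p. {r \<in> roots p. int p dvd poly z r})"
proof -
  have "p \<le> K" if "(p, r) \<in> common_roots z" for p r
    using common_roots_bound(3)[OF assms(1) that] assms(2) by simp
  then show ?thesis by (auto simp: common_roots_def primes_le_def roots_def)
qed

text \<open>Exchanging sums: for each root of \<open>g\<close> modulo \<open>p\<close>, the \<open>y\<close> for which it is a root of \<open>z y\<close> are
  counted.\<close>

lemma sum_common_roots:
  assumes "finite Y" "\<And>y. y \<in> Y \<Longrightarrow> \<not> g dvd z y" "\<And>y. y \<in> Y \<Longrightarrow> ideal_norm (z y) \<le> K"
  shows "(\<Sum>y\<in>Y. ln (real (root_prod (z y)))) =
         (\<Sum>p\<in>primes_le K. \<Sum>r\<in>roots p. ln p * card {y \<in> Y. z y \<in> eval_ideal (int p) r})"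
proof -
  have "ln (real (root_prod (z y))) = (\<Sum>p\<in>primes_le K. \<Sum>r\<in>roots p. if int p dvd poly (z y) r then ln p else 0)"
    if y: "y \<in> Y" for y
  proof -
    have fin: "finite (common_roots (z y))" by (rule common_roots_bound(1)[OF assms(2)[OF y]])
    have "real (root_prod (z y)) = (\<Prod>x\<in>common_roots (z y). real (fst x))"
      by (simp add: case_prod_unfold)
    also have "ln \<dots> = (\<Sum>x\<in>common_roots (z y). ln (real (fst x)))"
      using fin prime_gt_0_nat by (intro ln_prod) (force simp: common_roots_def)+
    also have "\<dots> = (\<Sum>p\<in>primes_le K. \<Sum>r\<in>{r \<in> roots p. int p dvd poly (z y) r}. ln p)"
      unfolding common_roots_Sigma[OF assms(2,3)[OF y]]
      by (subst sum.Sigma) (auto simp: case_prod_unfold)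
    also have "\<dots> = (\<Sum>p\<in>primes_le K. \<Sum>r\<in>roots p. if int p dvd poly (z y) r then ln p else 0)"
      by (intro sum.cong refl sum.inter_filter) simp
    finally show ?thesis .
  qed
  then have "(\<Sum>y\<in>Y. ln (real (root_prod (z y)))) =
     (\<Sum>y\<in>Y. \<Sum>p\<in>primes_le K. \<Sum>r\<in>roots p. if int p dvd poly (z y) r then ln p else 0)"
    by (rule sum.cong[OF refl])
  also have "\<dots> = (\<Sum>p\<in>primes_le K. \<Sum>y\<in>Y. \<Sum>r\<in>roots p. if int p dvd poly (z y) r then ln p else 0)"
    by (rule sum.swap)
  also have "\<dots> = (\<Sum>p\<in>primes_le K. \<Sum>r\<in>roots p. \<Sum>y\<in>Y. if int p dvd poly (z y) r then ln p else 0)"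
    by (intro sum.cong refl sum.swap)
  also have "\<dots> = (\<Sum>p\<in>primes_le K. \<Sum>r\<in>roots p. ln p * card {y \<in> Y. z y \<in> eval_ideal (int p) r})"
    using assms(1) by (intro sum.cong refl) (simp add: sum.inter_filter[symmetric] eval_ideal_def)
  finally show ?thesis .
qed

text \<open>Over the box, the logarithm of the norm is summed in two ways: each value is at most
  \<open>d * ln (3 * c * X)\<close>, and the common roots contribute at least the left-hand side times \<open>X ^ d\<close>.\<close>

lemma root_sum_upper_box:
  assumes t: "(t::real) \<ge> 0" "2 * c * t < 1" and X: "(X::nat) \<ge> 1" and n: "real n \<le> (t * X) ^ d"
  shows "(1 - 2 * c * t) ^ d * root_sum n \<le> d * ln (3 * c * X)"
proof -
  \<comment> \<open>All coefficients are nonnegative, and the shift by \<open>1\<close> makes the constant one positive, so that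
    \<open>z y\<close> is not \<open>0\<close>.\<close>
  define z where "z y = y - [:-1:]" for y :: "int poly"
  let ?Y = "box 0 (int X)"
  have Xd: "real X ^ d > 0" using X by simp
  have zs: "small (int X) (z y)" "\<not> g dvd z y" if y: "y \<in> ?Y" for y
  proof -
    have "z y = y + [:1:]" by (simp add: z_def)
    moreover have "small 1 [:1:]" using d_pos by (auto simp: small_def coeff_pCons split: nat.splits)
    ultimately have zb: "z y \<in> box (0 - 1) (int X + 1)" using box_add[OF y] by metis
    have c0: "coeff (z y) 0 \<ge> 1" using box_coeff(1)[OF y, of 0] d_pos by (simp add: z_def)
    have "\<bar>coeff (z y) i\<bar> \<le> int X" for i
      using box_coeff[OF zb, of i] X by (cases "i < d") auto
    then show "small (int X) (z y)" using box_coeff(3)[OF zb] by (simp add: small_def)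
    then have "degree (z y) < d" unfolding small_def deg_lt by blast
    moreover have "z y \<noteq> 0" using c0 by auto
    ultimately show "\<not> g dvd z y" using g_dvd_degree by blast
  qed
  define K where "K = nat (2 * C * int X + 1) ^ d"
  have NK: "ideal_norm (z y) \<le> K" if "y \<in> ?Y" for y
    unfolding K_def using ideal_norm_upper[OF zs(2,1)[OF that]] by simp
  have Npos: "ideal_norm (z y) > 0" if "y \<in> ?Y" for y
    unfolding ideal_norm_def using ideal_index_pos[OF is_ideal_principal principal_finite[OF zs(2)[OF that]]] .
  have K3: "real K \<le> (3 * c * X) ^ d"
  proof -
    have CX: "1 \<le> C * int X" using c_ge_1 C_ge_1 X using mult_mono[of 1 C 1 "int X"] by simp
    have "real K = (2 * real_of_int (C * int X) + 1) ^ d" using c_ge_1 C_ge_1 by (simp add: K_def of_nat_nat mult.assoc)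
    also have "\<dots> \<le> (3 * c * X) ^ d"
    proof (rule power_mono)
      have "real_of_int 1 \<le> real_of_int (C * int X)" using CX by (simp only: of_int_le_iff)
      moreover have "3 * c * X = 3 * real_of_int (C * int X)" by simp
      ultimately show "2 * real_of_int (C * int X) + 1 \<le> 3 * c * X" by linarith
    qed (use C_ge_1 in simp)
    finally show ?thesis .
  qed
  have lnN: "ln (real (root_prod (z y))) \<le> d * ln (3 * c * X)" if y: "y \<in> ?Y" for y
  proof -
    have "root_prod (z y) > 0"
      by (rule prod_pos) (auto simp: common_roots_def prime_gt_0_nat)
    then have "real (root_prod (z y)) > 0" by (simp only: of_nat_0_less_iff)
    moreover have "real (root_prod (z y)) \<le> (3 * c * X) ^ d"
    proof -
      have "root_prod (z y) \<le> K" using common_roots_bound(2)[OF zs(2)[OF y]] NK[OF y] by linarith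
      then show ?thesis using K3 by linarith
    qed
    ultimately have "ln (real (root_prod (z y))) \<le> ln ((3 * c * X) ^ d)"
      by (subst ln_le_cancel_iff) linarith+
    also have "\<dots> = d * ln (3 * c * X)" using c_ge_1 C_ge_1 X by (subst ln_realpow) auto
    finally show ?thesis .
  qed
  have n_K: "primes_le n \<subseteq> primes_le K"
  proof -
    have "real n \<le> real X ^ d"
    proof -
      have "t \<le> 2 * c * t" using c_ge_1 C_ge_1 t(1) by (simp add: mult_le_cancel_right1)
      then have "t * real X \<le> 1 * real X" using t by (intro mult_right_mono) auto
      then have "(t * real X) ^ d \<le> (1 * real X) ^ d" using t by (intro power_mono) auto
      then show ?thesis using n unfolding mult_1 by linarith
    qed
    also have "\<dots> = real (X ^ d)" by simp
    finally have "n \<le> X ^ d" by (simp only: of_nat_le_iff)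
    also have "\<dots> \<le> K" unfolding K_def
    proof (rule power_mono)
      have "1 * int X \<le> C * int X" using c_ge_1 C_ge_1 by (intro mult_right_mono) auto
      then show "X \<le> nat (2 * C * int X + 1)" by linarith
    qed simp
    finally show ?thesis by (auto simp: primes_le_def)
  qed
  have "(1 - 2 * c * t) ^ d * root_sum n * X ^ d = (\<Sum>p\<in>primes_le n. \<Sum>r\<in>roots p. ln p * (((1 - 2 * c * t) * X) ^ d / p))"
    unfolding root_sum_def power_mult_distrib by (simp add: sum_distrib_left sum_distrib_right mult_ac)
  also have "\<dots> \<le> (\<Sum>p\<in>primes_le n. \<Sum>r\<in>roots p. ln p * card {y \<in> ?Y. z y \<in> eval_ideal (int p) r})"
  proof (intro sum_mono mult_left_mono)
    fix p r assume pr: "p \<in> primes_le n" "r \<in> roots p"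
    then have p: "prime p" "p \<le> n" by (auto simp: primes_le_def)
    note e = eval_ideal_root[OF p(1) pr(2)]
    have p0: "real p > 0" using prime_gt_0_nat[OF p(1)] by simp
    have "real (ideal_index (eval_ideal (int p) r)) \<le> (t * X) ^ d" unfolding e(3) using p(2) n by linarith
    then have "((1 - 2 * c * t) * X) ^ d \<le> real (card {y \<in> ?Y. z y \<in> eval_ideal (int p) r}) * p"
      using coset_count_ge[OF e(1,2) t(1), of X "[:-1:]"] t(2) unfolding e(3) z_def by simp
    then show "((1 - 2 * c * t) * X) ^ d / p \<le> card {y \<in> ?Y. z y \<in> eval_ideal (int p) r}"
      using p0 by (simp add: field_simps)
    show "0 \<le> ln (real p)" using prime_ge_1_nat[OF p(1)] by simp
  qed
  also have "\<dots> \<le> (\<Sum>p\<in>primes_le K. \<Sum>r\<in>roots p. ln p * card {y \<in> ?Y. z y \<in> eval_ideal (int p) r})"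
    using n_K by (intro sum_mono2 sum_nonneg mult_nonneg_nonneg) (auto simp: primes_le_def prime_ge_1_nat)
  also have "\<dots> = (\<Sum>y\<in>?Y. ln (real (root_prod (z y))))"
    by (rule sum_common_roots[symmetric]) (use zs(2) NK in auto)
  also have "\<dots> \<le> (\<Sum>y\<in>?Y. d * ln (3 * c * X))" by (rule sum_mono) (rule lnN)
  also have "\<dots> = d * ln (3 * c * X) * X ^ d" by (simp add: card_box)
  finally show ?thesis using Xd by simp
qed

text \<open>Given \<open>n\<close>, the side \<open>X\<close> of the box is chosen as the least integer with \<open>n \<le> (t * X) ^ d\<close>, where \<open>t\<close> is a
  small constant; then \<open>d * ln X\<close> exceeds \<open>ln n\<close> by a bounded amount.\<close>

lemma root_sum_upper:
  assumes e: "e > 0" shows "\<exists>K. \<forall>n\<ge>1. root_sum n \<le> (1 + e) * ln n + K"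
proof -
  note C1 = c_ge_1
  have "((\<lambda>t. (1 + e) * (1 - 2 * c * t) ^ d) \<longlongrightarrow> (1 + e) * (1 - 2 * c * 0) ^ d) (at_right 0)"
    by (intro tendsto_intros)
  then have "\<forall>\<^sub>F t in at_right 0. (1 + e) * (1 - 2 * c * t) ^ d > 1"
    by (rule order_tendstoD(1)) (use e in simp)
  moreover have "\<forall>\<^sub>F t in at_right 0. t \<in> {0<..<1 / (2 * c)}"
    by (rule eventually_at_right_real) (use C1 in simp)
  ultimately obtain t where t: "(1 + e) * (1 - 2 * c * t) ^ d > 1" "t > 0" "t < 1 / (2 * c)"
    using eventually_happens'[OF trivial_limit_at_right_real eventually_conj] by fastforce
  have t': "2 * c * t < 1" using t(3) C1 by (simp add: field_simps)
  define \<eta> where "\<eta> = (1 - 2 * c * t) ^ d"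
  have \<eta>: "\<eta> > 0" "1 / \<eta> \<le> 1 + e" using t(1) t' by (auto simp: \<eta>_def field_simps)
  define K where "K = d * ln (3 * c * (2 / t)) / \<eta>"
  have t1: "t \<le> 1" using t(3) C1 by (smt (verit) divide_le_eq_1)
  have "root_sum n \<le> (1 + e) * ln n + K" if n: "n \<ge> 1" for n
  proof -
    define x where "x = root d n"
    have x: "x \<ge> 1" "x ^ d = n" using n d_pos by (auto simp: x_def)
    define X where "X = nat \<lceil>x / t\<rceil>"
    have "real_of_int \<lceil>x / t\<rceil> \<ge> x / t" by (rule le_of_int_ceiling)
    moreover have "x / t \<ge> 1" using x(1) t(2) t1 by (simp add: field_simps)
    ultimately have X: "real X \<ge> x / t" "real X \<le> 2 * x / t" "X \<ge> 1"
    proof -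
      assume a: "x / t \<ge> 1" "real_of_int \<lceil>x / t\<rceil> \<ge> x / t"
      have rX: "real X = of_int \<lceil>x / t\<rceil>" using a by (simp add: X_def)
      show "real X \<ge> x / t" using rX a by simp
      have "real X < x / t + 1" unfolding rX using ceiling_correct[of "x / t"] by linarith
      then show "real X \<le> 2 * x / t" using a(1) by simp
      show "X \<ge> 1" using rX a by linarith
    qed
    have "x \<le> t * X" using X(1) t(2) by (simp add: field_simps)
    then have "real n \<le> (t * X) ^ d" using x power_mono[of x "t * X" d] by simp
    then have "\<eta> * root_sum n \<le> d * ln (3 * c * X)" unfolding \<eta>_def using root_sum_upper_box[OF _ t' X(3)] t(2) by simp
    also have "\<dots> \<le> d * ln (3 * c * (2 * x / t))"
      using X C1 by (intro mult_left_mono ln_mono mult_left_mono) auto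
    also have "3 * c * (2 * x / t) = (3 * c * (2 / t)) * x" by simp
    also have "ln \<dots> = ln (3 * c * (2 / t)) + ln x" using x(1) t(2) C1 by (intro ln_mult_pos) auto
    also have "d * \<dots> = d * ln (3 * c * (2 / t)) + ln n"
      using x ln_realpow[of x d] by (simp add: algebra_simps)
    finally have "root_sum n \<le> ln n * (1 / \<eta>) + K" using \<eta>(1) by (simp add: K_def field_simps)
    also have "ln n * (1 / \<eta>) \<le> ln n * (1 + e)" using \<eta>(2) n by (intro mult_left_mono) auto
    finally show ?thesis by (simp add: mult.commute)
  qed
  then show ?thesis by blast
qed

section \<open>The average number of roots modulo primes: lower bound\<close>

text \<open>Since \<open>B\<close> is invertible modulo \<open>I\<close>, the condition on \<open>y\<close> is again a congruence modulo \<open>I\<close>.\<close>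

lemma affine_coset:
  assumes I: "is_ideal I" and m: "[:m:] \<in> I" "coprime m B"
  shows "\<exists>y0. {y \<in> Y. z0 + smult B y \<in> I} \<subseteq> {y \<in> Y. y - y0 \<in> I}"
proof (cases "{y \<in> Y. z0 + smult B y \<in> I} = {}")
  case False
  then obtain y0 where y0: "z0 + smult B y0 \<in> I" by blast
  obtain u v where uv: "u * m + v * B = 1" using m(2) by (metis bezout_int coprime_imp_gcd_eq_1)
  have "y - y0 \<in> I" if y: "z0 + smult B y \<in> I" for y
  proof -
    have "(z0 + smult B y) - (z0 + smult B y0) = smult B (y - y0)" by (simp add: smult_diff_right)
    then have "smult B (y - y0) \<in> I" using ideal_diff[OF I y y0] by metis
    then have "smult u ((y - y0) * [:m:]) + smult v (smult B (y - y0)) \<in> I"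
      by (rule ideal_add[OF I ideal_smult[OF I ideal_mult[OF I m(1)]] ideal_smult[OF I]])
    also have "smult u ((y - y0) * [:m:]) + smult v (smult B (y - y0)) = smult (u * m + v * B) (y - y0)"
      by (simp add: smult_add_left)
    finally show ?thesis by (simp add: uv)
  qed
  then show ?thesis by blast
qed blast

text \<open>The norm is summed over the polynomials \<open>z y = 1 + B (C + 1) X + B y\<close> with \<open>y\<close> in a box. They have norm at
  least \<open>X ^ d\<close>, and they are congruent to \<open>1\<close> modulo \<open>B\<close>, which is divisible by all primes up to \<open>p0\<close> and
  by all those at which some root is not simple; so only the other primes matter. The \<open>y\<close> for which \<open>z y\<close> lies in a bad
  ideal make up a fraction at most \<open>e\<close> of the box, because bad ideals at \<open>p\<close> have index at least \<open>p\<^sup>2\<close> and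
  the sum of \<open>1 / p\<^sup>2\<close> over \<open>p > p0\<close> is small. For all other \<open>y\<close> the norm is the product of the primes
  at the common roots, and exchanging sums bounds the total from above.\<close>

lemma root_sum_lower_box:
  assumes e: "e > 0" "e < 1"
  shows "\<exists>t K X0. t > 0 \<and> t \<le> 1 \<and> (\<forall>X\<ge>X0. (1 - e) * (d * ln (real X)) \<le> (1 + e) * root_sum (nat \<lfloor>(t * real X) ^ d\<rfloor>) + K)"
proof -
  obtain D where D: "D > 0" "\<And>p. prime p \<Longrightarrow> \<not> p dvd D \<Longrightarrow> simple_at p"
    using ex_discriminant by blast
  have d1: "real d \<ge> 1" using d_pos by simp
  define \<kappa> where "\<kappa> = (1 + 2 * c) ^ d"
  have \<kappa>: "\<kappa> \<ge> 1" using c_ge_1 unfolding \<kappa>_def by (intro one_le_power) simp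
  \<comment> \<open>A prime has at most \<open>2 * d\<close> bad ideals, each with at most \<open>\<kappa> (X ^ d / p\<^sup>2 + 1)\<close> points; the two summands
    are to contribute at most \<open>e / 2\<close> each.\<close>
  define \<delta> where "\<delta> = e / (4 * real d * \<kappa>)"
  have \<delta>: "\<delta> > 0" unfolding \<delta>_def using e d1 \<kappa> by (intro divide_pos_pos mult_pos_pos) auto
  define p0 where "p0 = nat \<lceil>1 / \<delta>\<rceil>"
  have p0: "real p0 \<ge> 1 / \<delta>" unfolding p0_def using real_nat_ceiling_ge by simp
  have p0_pos: "p0 \<ge> 1"
  proof -
    have "real p0 > 0" using p0 \<delta> by (smt (verit) zero_less_divide_1_iff)
    then show ?thesis by simp
  qed
  have p0': "1 / real p0 \<le> \<delta>" using p0 \<delta> p0_pos by (simp add: field_simps)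
  define B where "B = D * fact p0"
  have B: "B \<ge> 1" using D(1) by (simp add: B_def Suc_le_eq)
  have pB: "p > p0 \<and> simple_at p" if "prime p" "\<not> p dvd B" for p
  proof -
    have "\<not> p dvd D" "\<not> p dvd fact p0" using that(2) by (auto simp: B_def)
    then show ?thesis using D(2)[OF that(1)] dvd_fact[of p p0] prime_ge_1_nat[OF that(1)] by (meson not_le)
  qed
  \<comment> \<open>The coefficients of \<open>z y\<close> are at most \<open>B * (C + 3) * X\<close>, so that all norms are at most
    \<open>(k * X) ^ d\<close>.\<close>
  define k where "k = nat (2 * C * (int B * (C + 3)) + 1)"
  have k: "int k = 2 * C * (int B * (C + 3)) + 1" using C_ge_1 by (simp add: k_def)
  have "((\<lambda>t. (1 + 2 * c * t) ^ d) \<longlongrightarrow> (1 + 2 * c * 0) ^ d) (at_right 0)"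
    by (intro tendsto_intros)
  then have "\<forall>\<^sub>F t in at_right 0. (1 + 2 * c * t) ^ d < 1 + e"
    by (rule order_tendstoD(2)) (use e in simp)
  moreover have "\<forall>\<^sub>F t in at_right 0. t \<in> {0<..<1::real}"
    by (rule eventually_at_right_real) simp
  ultimately obtain t :: real where t: "(1 + 2 * c * t) ^ d < 1 + e" "t > 0" "t < 1"
    using eventually_happens'[OF trivial_limit_at_right_real eventually_conj] by fastforce
  \<comment> \<open>Primes between \<open>(t * X) ^ d\<close> and \<open>(k * X) ^ d\<close> have at most \<open>L\<close> points per root; they contribute \<open>O(X ^ d)\<close>
    in total by the bound for the sum of \<open>ln p\<close>.\<close>
  define L where "L = (1 + 2 * c * k) ^ d / t ^ d"
  have L: "L \<ge> 0" using t c_ge_1 by (simp add: L_def)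
  define K where "K = 2 * real d * L * real k ^ d"
  \<comment> \<open>For \<open>X\<close> at least this, the square root of \<open>(k * X) ^ d\<close>, which bounds the number of primes with bad
    ideals, is at most \<open>\<delta> * X ^ d\<close>.\<close>
  define X0 where "X0 = nat \<lceil>real k ^ d / \<delta>\<^sup>2\<rceil> + 1"
  have "(1 - e) * (d * ln (real X)) \<le> (1 + e) * root_sum (nat \<lfloor>(t * real X) ^ d\<rfloor>) + K" if X: "X \<ge> X0" for X
  proof -
    have X1: "X \<ge> 1" using X by (simp add: X0_def)
    have Xd: "real X ^ d > 0" using X1 by simp
    let ?Y = "box 0 (int X)"
    define z0 where "z0 = [:1 + int B * (C + 1) * int X:]"
    define z where "z y = z0 + smult (int B) y" for y
    have NL: "\<not> g dvd z y" "X ^ d \<le> ideal_norm (z y)" if "y \<in> ?Y" for y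
      using ideal_norm_lower[OF that _ _ refl, of "int B"] X1 B unfolding z_def z0_def by simp_all
    define Kx where "Kx = (k * X) ^ d"
    have NU: "ideal_norm (z y) \<le> Kx" if y: "y \<in> ?Y" for y
    proof -
      have BX: "1 \<le> int B * int X" using B X1 mult_mono[of 1 "int B" 1 "int X"] by simp
      have y0: "0 \<in> ?Y" using X1 by (simp add: box_def)
      have sy: "small (int X) y"
        using box_diff_small[OF y y0] X1 small_mono[of "int X - 1" y "int X"] by simp
      have s: "small (int B * (C + 3) * int X) (z y)" unfolding small_def
      proof (intro conjI allI impI)
        fix i
        have "\<bar>coeff (z y) i\<bar> \<le> \<bar>coeff z0 i\<bar> + int B * \<bar>coeff y i\<bar>"
          by (simp add: z_def abs_triangle_ineq[THEN order_trans] abs_mult)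
        also have "\<bar>coeff z0 i\<bar> \<le> 1 + int B * (C + 1) * int X"
          using C_ge_1 by (auto simp: z0_def coeff_pCons split: nat.splits)
        also have "int B * \<bar>coeff y i\<bar> \<le> int B * int X"
          using sy by (intro mult_left_mono) (auto simp: small_def)
        also have "1 + int B * (C + 1) * int X + int B * int X \<le> int B * (C + 3) * int X"
          using BX by (simp add: algebra_simps)
        finally show "\<bar>coeff (z y) i\<bar> \<le> int B * (C + 3) * int X" by simp
      next
        fix i assume "i \<ge> d"
        then show "coeff (z y) i = 0"
          using d_pos sy by (auto simp: z_def z0_def small_def coeff_pCons split: nat.splits)
      qed
      have "ideal_norm (z y) \<le> nat (2 * C * (int B * (C + 3) * int X) + 1) ^ d"
        by (rule ideal_norm_upper[OF NL(1)[OF y] s]) (use C_ge_1 in simp)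
      also have "\<dots> \<le> (k * X) ^ d"
      proof (rule power_mono)
        have "int (k * X) = (2 * C * (int B * (C + 3)) + 1) * int X" by (simp add: k)
        also have "\<dots> \<ge> 2 * C * (int B * (C + 3) * int X) + 1" using X1 by (simp add: algebra_simps)
        finally show "nat (2 * C * (int B * (C + 3) * int X) + 1) \<le> k * X" by linarith
      qed simp
      finally show ?thesis by (simp add: Kx_def)
    qed
    have idz: "z y = 1 + [:int B:] * ([:(C + 1) * int X:] + y)" for y
      by (simp add: z_def z0_def algebra_simps smult_add_right one_pCons)
    have F1: "\<not> p dvd B" if "is_ideal M" "[:int p:] \<in> M" "z y \<in> M" "1 \<notin> M" for p M y
    proof
      assume "p dvd B"
      then obtain b where "B = p * b" by blast
      then have "[:int B:] = [:int p:] * [:int b:]" by simp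
      then have "[:int B:] \<in> M" using ideal_mult'[OF that(1,2)] by metis
      then have "z y - [:int B:] * ([:(C + 1) * int X:] + y) \<in> M"
        by (intro ideal_diff[OF that(1) that(3)] ideal_mult'[OF that(1)])
      then show False using that(4) idz[of y] by simp
    qed
    define Bd where "Bd = {y \<in> ?Y. \<exists>p. prime p \<and> \<not> p dvd B \<and> z y \<in> \<Union>(bad_ideals p)}"
    have good: "d * ln (real X) \<le> ln (real (root_prod (z y)))" if y: "y \<in> ?Y - Bd" for y
    proof -
      have "ideal_norm (z y) \<le> root_prod (z y)"
      proof (rule ideal_norm_le_prod_common_roots)
        show "\<not> g dvd z y" using NL(1) y by blast
        fix p M assume M: "prime p" "maximal_ideal M" "[:int p:] \<in> M" "z y \<in> M"
        then have "\<not> p dvd B" using F1[of M p y] unfolding maximal_ideal_def by blast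
        then show "simple_at p \<and> z y \<notin> \<Union>(bad_ideals p)" using pB M(1) y unfolding Bd_def by blast
      qed
      then have "X ^ d \<le> root_prod (z y)" using NL(2)[of y] y by simp
      then have "real X ^ d \<le> real (root_prod (z y))" by (metis of_nat_le_iff of_nat_power)
      then have "ln (real X ^ d) \<le> ln (real (root_prod (z y)))" using Xd by (intro ln_mono) auto
      then show ?thesis using X1 by (simp add: ln_realpow)
    qed
    have count_sub: "\<exists>y0. {y \<in> ?Y. z y \<in> I} \<subseteq> coset_points (int X) y0 I"
      if "is_ideal I" "[:int (p ^ j):] \<in> I" "prime p" "\<not> p dvd B" for I p j
      unfolding z_def
    proof (rule affine_coset[OF that(1,2)])
      have "coprime p B" using that(3,4) by (rule prime_imp_coprime)
      then show "coprime (int (p ^ j)) (int B)" by simp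
    qed
    have fY: "finite {y \<in> ?Y. P y}" for P by simp
    have cardBd: "real (card Bd) \<le> e * real X ^ d"
    proof -
      define Q where "Q = {p. prime p \<and> \<not> p dvd B \<and> p\<^sup>2 \<le> Kx}"
      define s where "s = nat \<lfloor>sqrt (real Kx)\<rfloor>"
      have Qs: "Q \<subseteq> {1..s}"
      proof
        fix p assume "p \<in> Q"
        then have p: "prime p" "p\<^sup>2 \<le> Kx" by (auto simp: Q_def)
        have "(real p)\<^sup>2 \<le> real Kx" using p(2) by (metis of_nat_le_iff of_nat_power)
        then have "real p \<le> sqrt (real Kx)" by (rule real_le_rsqrt)
        then have "p \<le> s" unfolding s_def by (simp add: le_nat_floor)
        then show "p \<in> {1..s}" using prime_ge_1_nat[OF p(1)] by simp
      qed
      have fQ: "finite Q" by (rule finite_subset[OF Qs]) simp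
      have "card Q \<le> s" using card_mono[OF _ Qs] by simp
      then have "real (card Q) \<le> real s" by simp
      also have "\<dots> \<le> sqrt (real Kx)" unfolding s_def by simp
      also have "\<dots> \<le> \<delta> * real X ^ d"
      proof (rule real_le_lsqrt)
        have "real k ^ d / \<delta>\<^sup>2 \<le> real X"
        proof -
          have "real_of_int \<lceil>real k ^ d / \<delta>\<^sup>2\<rceil> \<le> real X" using X unfolding X0_def by linarith
          then show ?thesis using le_of_int_ceiling order_trans by blast
        qed
        also have "real X \<le> real X ^ d" using X1 d_pos by (intro self_le_power) auto
        finally have "real k ^ d \<le> \<delta>\<^sup>2 * real X ^ d" using \<delta> by (simp add: field_simps)
        then have "real k ^ d * real X ^ d \<le> \<delta>\<^sup>2 * real X ^ d * real X ^ d" by (rule mult_right_mono) simp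
        then show "real Kx \<le> (\<delta> * real X ^ d)\<^sup>2"
          by (simp add: Kx_def power_mult_distrib power2_eq_square mult_ac)
      qed (use \<delta> in simp_all)
      finally have cQ: "real (card Q) \<le> \<delta> * real X ^ d" .
      have sub: "Bd \<subseteq> (\<Union>p\<in>Q. \<Union>I\<in>bad_ideals p. {y \<in> ?Y. z y \<in> I})"
      proof
        fix y assume "y \<in> Bd"
        then obtain p I where p: "y \<in> ?Y" "prime p" "\<not> p dvd B" "I \<in> bad_ideals p" "z y \<in> I" unfolding Bd_def by blast
        have sp: "simple_at p" using pB p by blast
        note b = bad_ideal[OF p(2) sp p(4)]
        have "ideal_index I \<le> ideal_norm (z y)" unfolding ideal_norm_def
          by (rule finite_index_mono(2)[OF is_ideal_principal b(1) principal_sub[OF b(1) p(5)] principal_finite[OF NL(1)[OF p(1)]]])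
        then have "p\<^sup>2 \<le> Kx" using b(3) NU[OF p(1)] by linarith
        then show "y \<in> (\<Union>p\<in>Q. \<Union>I\<in>bad_ideals p. {y \<in> ?Y. z y \<in> I})" using p unfolding Q_def by blast
      qed
      have fin: "finite (\<Union>p\<in>Q. \<Union>I\<in>bad_ideals p. {y \<in> ?Y. z y \<in> I})"
        by (rule finite_subset[of _ ?Y]) auto
      have "card Bd \<le> card (\<Union>p\<in>Q. \<Union>I\<in>bad_ideals p. {y \<in> ?Y. z y \<in> I})" by (rule card_mono[OF fin sub])
      also have "\<dots> \<le> (\<Sum>p\<in>Q. card (\<Union>I\<in>bad_ideals p. {y \<in> ?Y. z y \<in> I}))" by (rule card_UN_le[OF fQ])
      also have "\<dots> \<le> (\<Sum>p\<in>Q. \<Sum>I\<in>bad_ideals p. card {y \<in> ?Y. z y \<in> I})"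
        by (intro sum_mono card_UN_le card_bad) (simp add: Q_def)
      finally have "real (card Bd) \<le> real (\<Sum>p\<in>Q. \<Sum>I\<in>bad_ideals p. card {y \<in> ?Y. z y \<in> I})"
        by (simp only: of_nat_le_iff)
      also have "\<dots> = (\<Sum>p\<in>Q. \<Sum>I\<in>bad_ideals p. real (card {y \<in> ?Y. z y \<in> I}))" by simp
      also have "\<dots> \<le> (\<Sum>p\<in>Q. 2 * real d * (\<kappa> * (real X ^ d * (1 / (real p)\<^sup>2) + 1)))"
      proof (rule sum_mono)
        fix p assume "p \<in> Q"
        then have p: "prime p" "\<not> p dvd B" by (auto simp: Q_def)
        have sp: "simple_at p" using pB p by blast
        have "(\<Sum>I\<in>bad_ideals p. real (card {y \<in> ?Y. z y \<in> I})) \<le> (\<Sum>I\<in>bad_ideals p. \<kappa> * (real X ^ d * (1 / (real p)\<^sup>2) + 1))"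
        proof (rule sum_mono)
          fix I assume I: "I \<in> bad_ideals p"
          note b = bad_ideal[OF p(1) sp I]
          obtain y0 where y0: "{y \<in> ?Y. z y \<in> I} \<subseteq> coset_points (int X) y0 I"
            using count_sub[OF b(1,4) p] by blast
          have "real (card {y \<in> ?Y. z y \<in> I}) \<le> real (card (coset_points (int X) y0 I))"
            using card_mono[OF fY y0] by simp
          also have "\<dots> \<le> \<kappa> * (real X ^ d / real (p\<^sup>2) + 1)" unfolding \<kappa>_def
            by (rule coset_count_crude[OF b(1,2) _ b(3)]) (use prime_gt_0_nat[OF p(1)] in simp)
          finally show "real (card {y \<in> ?Y. z y \<in> I}) \<le> \<kappa> * (real X ^ d * (1 / (real p)\<^sup>2) + 1)" by simp
        qed
        also have "\<dots> = real (card (bad_ideals p)) * (\<kappa> * (real X ^ d * (1 / (real p)\<^sup>2) + 1))" by simp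
        also have "\<dots> \<le> 2 * real d * (\<kappa> * (real X ^ d * (1 / (real p)\<^sup>2) + 1))"
        proof (rule mult_right_mono)
          have "real (card (bad_ideals p)) \<le> real (2 * d)" using card_bad(2)[OF p(1)] by (simp only: of_nat_le_iff)
          then show "real (card (bad_ideals p)) \<le> 2 * real d" by simp
        qed (use \<kappa> in simp)
        finally show "(\<Sum>I\<in>bad_ideals p. real (card {y \<in> ?Y. z y \<in> I})) \<le> 2 * real d * (\<kappa> * (real X ^ d * (1 / (real p)\<^sup>2) + 1))" .
      qed
      also have "\<dots> = 2 * real d * \<kappa> * (real X ^ d * (\<Sum>p\<in>Q. 1 / (real p)\<^sup>2) + real (card Q))"
        by (simp add: sum_distrib_left sum.distrib algebra_simps)
      also have "\<dots> \<le> 2 * real d * \<kappa> * (real X ^ d * \<delta> + \<delta> * real X ^ d)"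
      proof (intro mult_left_mono add_mono cQ)
        have "(\<Sum>p\<in>Q. 1 / (real p)\<^sup>2) \<le> 1 / real p0"
          by (rule sum_inverse_squares_le[OF p0_pos fQ]) (use pB in \<open>auto simp: Q_def\<close>)
        then show "(\<Sum>p\<in>Q. 1 / (real p)\<^sup>2) \<le> \<delta>" using p0' by linarith
      qed (use \<kappa> in auto)
      also have "\<dots> = e * real X ^ d" using d1 \<kappa> by (simp add: \<delta>_def field_simps)
      finally show ?thesis .
    qed
    define P where "P = nat \<lfloor>(t * real X) ^ d\<rfloor>"
    have tX: "(t * real X) ^ d \<ge> 0" using t(2) by simp
    have cnt: "ln (real p) * real (card {y \<in> ?Y. z y \<in> eval_ideal (int p) r}) \<le>
        (if p \<le> P then (1 + e) * real X ^ d * (ln (real p) / real p) else 0) + ln (real p) * L"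
      if pr: "p \<in> primes_le Kx" "r \<in> roots p" for p r
    proof -
      have p: "prime p" "p \<le> Kx" using pr by (auto simp: primes_le_def)
      note ev = eval_ideal_root[OF p(1) pr(2)]
      have pp: "real p > 0" using prime_gt_0_nat[OF p(1)] by simp
      have lnp: "ln (real p) \<ge> 0" using prime_ge_1_nat[OF p(1)] by simp
      have m1: "1 \<notin> eval_ideal (int p) r" using prime_gt_1_nat[OF p(1)] by (auto simp: eval_ideal_def)
      have pm: "[:int p:] \<in> eval_ideal (int p) r" by (simp add: eval_ideal_def)
      show ?thesis
      proof (cases "p dvd B")
        \<comment> \<open>A polynomial congruent to \<open>1\<close> modulo \<open>p\<close> has no root modulo \<open>p\<close>.\<close>
        case True
        then have "{y \<in> ?Y. z y \<in> eval_ideal (int p) r} = {}" using F1[OF ev(1) pm _ m1] by blast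
        then have c0: "card {y \<in> ?Y. z y \<in> eval_ideal (int p) r} = 0" by (simp only: card.empty)
        show ?thesis unfolding c0 using lnp L e by simp
      next
        case False
        obtain y0 where y0: "{y \<in> ?Y. z y \<in> eval_ideal (int p) r} \<subseteq> coset_points (int X) y0 (eval_ideal (int p) r)"
          using count_sub[OF ev(1), of p 1] pm p(1) False by auto
        have cc: "real (card {y \<in> ?Y. z y \<in> eval_ideal (int p) r}) \<le> real (card (coset_points (int X) y0 (eval_ideal (int p) r)))"
          using card_mono[OF fY y0] by simp
        show ?thesis
        proof (cases "p \<le> P")
          case True
          then have "real p \<le> (t * real X) ^ d" unfolding P_def using tX by (simp add: le_nat_iff le_floor_iff)
          then have "real (ideal_index (eval_ideal (int p) r)) \<le> (t * real X) ^ d" by (simp add: ev(3))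
          then have "real (card (coset_points (int X) y0 (eval_ideal (int p) r))) * p \<le> ((1 + 2 * c * t) * X) ^ d"
            using coset_count_le[OF ev(1,2), of t X y0] t(2) by (simp add: ev(3))
          also have "\<dots> \<le> (1 + e) * real X ^ d"
            unfolding power_mult_distrib using t(1) by (intro mult_right_mono) auto
          finally have "real (card (coset_points (int X) y0 (eval_ideal (int p) r))) \<le> (1 + e) * real X ^ d / p"
            using pp by (simp add: pos_le_divide_eq)
          then have "real (card {y \<in> ?Y. z y \<in> eval_ideal (int p) r}) \<le> (1 + e) * real X ^ d / p"
            using cc by linarith
          then have "ln (real p) * real (card {y \<in> ?Y. z y \<in> eval_ideal (int p) r}) \<le> ln (real p) * ((1 + e) * real X ^ d / p)"
            using lnp by (rule mult_left_mono)
          moreover have "0 \<le> ln (real p) * L" using lnp L by simp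
          ultimately show ?thesis using True by (simp add: mult_ac)
        next
          case False
          then have pl: "(t * real X) ^ d \<le> real p" unfolding P_def using tX by linarith
          have "real (ideal_index (eval_ideal (int p) r)) \<le> (real k * real X) ^ d"
            using p(2) by (simp add: ev(3) Kx_def) (metis of_nat_le_iff of_nat_mult of_nat_power)
          then have "real (card (coset_points (int X) y0 (eval_ideal (int p) r))) * p \<le> ((1 + 2 * c * k) * X) ^ d"
            using coset_count_le[OF ev(1,2), of "real k" X y0] by (simp add: ev(3))
          also have "\<dots> = L * (t * real X) ^ d" using t(2) by (simp add: L_def power_mult_distrib)
          also have "\<dots> \<le> L * real p" using pl L by (rule mult_left_mono)
          finally have "real (card (coset_points (int X) y0 (eval_ideal (int p) r))) \<le> L" using pp by simp
          then have "real (card {y \<in> ?Y. z y \<in> eval_ideal (int p) r}) \<le> L" using cc by linarith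
          then have "ln (real p) * real (card {y \<in> ?Y. z y \<in> eval_ideal (int p) r}) \<le> ln (real p) * L"
            using lnp by (rule mult_left_mono)
          then show ?thesis using False by simp
        qed
      qed
    qed
    have lnX: "d * ln (real X) \<ge> 0" using X1 by simp
    have fBd: "finite Bd" unfolding Bd_def by simp
    have BdY: "Bd \<subseteq> ?Y" unfolding Bd_def by blast
    have "(1 - e) * real X ^ d * (d * ln (real X)) \<le> real (card (?Y - Bd)) * (d * ln (real X))"
    proof (rule mult_right_mono[OF _ lnX])
      have "card (?Y - Bd) = X ^ d - card Bd" using card_Diff_subset[OF fBd BdY] by (simp add: card_box)
      moreover have "card Bd \<le> X ^ d" using card_mono[OF finite_box BdY] by (simp add: card_box)
      ultimately have "real (card (?Y - Bd)) = real X ^ d - real (card Bd)" by (simp add: of_nat_diff)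
      then show "(1 - e) * real X ^ d \<le> real (card (?Y - Bd))" using cardBd by (simp add: algebra_simps)
    qed
    also have "\<dots> = (\<Sum>y\<in>?Y - Bd. d * ln (real X))" by simp
    also have "\<dots> \<le> (\<Sum>y\<in>?Y - Bd. ln (real (root_prod (z y))))" by (rule sum_mono) (rule good)
    also have "\<dots> \<le> (\<Sum>y\<in>?Y. ln (real (root_prod (z y))))"
    proof (rule sum_mono2)
      fix y assume "y \<in> ?Y - (?Y - Bd)"
      have "root_prod (z y) > 0" by (rule prod_pos) (auto simp: common_roots_def prime_gt_0_nat)
      then have "real (root_prod (z y)) \<ge> real 1" by (simp only: of_nat_le_iff)
      then show "0 \<le> ln (real (root_prod (z y)))" by (intro ln_ge_zero) simp
    qed auto
    also have "\<dots> = (\<Sum>p\<in>primes_le Kx. \<Sum>r\<in>roots p. ln p * card {y \<in> ?Y. z y \<in> eval_ideal (int p) r})"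
      by (rule sum_common_roots) (use NL NU in auto)
    also have "\<dots> \<le> (\<Sum>p\<in>primes_le Kx. \<Sum>r\<in>roots p.
        (if p \<le> P then (1 + e) * real X ^ d * (ln (real p) / real p) else 0) + ln (real p) * L)"
      by (intro sum_mono cnt)
    also have "\<dots> = (\<Sum>p\<in>primes_le Kx. if p \<le> P then (1 + e) * real X ^ d * (card (roots p) * ln p / p) else 0)
        + (\<Sum>p\<in>primes_le Kx. real (card (roots p)) * (ln p * L))"
      by (simp add: sum.distrib[symmetric]) (intro sum.cong refl, simp add: algebra_simps)
    also have "\<dots> \<le> (1 + e) * real X ^ d * root_sum P + K * real X ^ d"
    proof (rule add_mono)
      have "(\<Sum>p\<in>primes_le Kx. if p \<le> P then (1 + e) * real X ^ d * (card (roots p) * ln p / p) else 0)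
          = (\<Sum>p\<in>{p \<in> primes_le Kx. p \<le> P}. (1 + e) * real X ^ d * (card (roots p) * ln p / p))"
        by (rule sum.inter_filter[symmetric]) simp
      also have "\<dots> \<le> (\<Sum>p\<in>primes_le P. (1 + e) * real X ^ d * (card (roots p) * ln p / p))"
        using e by (intro sum_mono2) (auto simp: primes_le_def prime_ge_1_nat)
      finally show "(\<Sum>p\<in>primes_le Kx. if p \<le> P then (1 + e) * real X ^ d * (card (roots p) * ln p / p) else 0)
          \<le> (1 + e) * real X ^ d * root_sum P" by (simp add: root_sum_def sum_distrib_left)
      have "(\<Sum>p\<in>primes_le Kx. real (card (roots p)) * (ln p * L)) \<le> (\<Sum>p\<in>primes_le Kx. real d * (ln p * L))"
        using card_roots_le L ln_primes_le_nonneg[of _ Kx]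
        by (intro sum_mono mult_right_mono mult_nonneg_nonneg) (auto simp: ln_primes_le_nonneg primes_le_def[of Kx])
      also have "\<dots> = real d * L * (\<Sum>p\<in>primes_le Kx. ln (real p))" by (simp add: sum_distrib_left mult_ac)
      also have "\<dots> \<le> real d * L * (2 * real Kx)" using sum_ln_primes_le L by (intro mult_left_mono) auto
      also have "\<dots> = K * real X ^ d" by (simp add: K_def Kx_def power_mult_distrib)
      finally show "(\<Sum>p\<in>primes_le Kx. real (card (roots p)) * (ln p * L)) \<le> K * real X ^ d" .
    qed
    finally have "((1 - e) * (d * ln (real X))) * real X ^ d \<le> ((1 + e) * root_sum P + K) * real X ^ d"
      by (simp add: algebra_simps)
    then show ?thesis using Xd unfolding P_def by simp
  qed
  then show ?thesis using t(2,3) by (intro exI[of _ t] exI[of _ K] exI[of _ X0]) auto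
qed

text \<open>The previous bound is applied with \<open>X\<close> the integer part of the \<open>d\<close>-th root of \<open>n\<close>.\<close>

lemma root_sum_lower:
  assumes e: "e > 0" "e < 1" shows "\<exists>K. \<forall>\<^sub>F n in sequentially. (1 - e) * ln (real n) \<le> (1 + e) * root_sum n + K"
proof -
  obtain t K X0 where t: "t > 0" "t \<le> 1" and
    *: "\<And>X. X \<ge> X0 \<Longrightarrow> (1 - e) * (d * ln (real X)) \<le> (1 + e) * root_sum (nat \<lfloor>(t * real X) ^ d\<rfloor>) + K"
    using root_sum_lower_box[OF e] by blast
  have "(1 - e) * ln (real n) \<le> (1 + e) * root_sum n + (K + d * ln 2)" if n: "n \<ge> max 1 (Suc X0 ^ d)" for n
  proof -
    obtain X where X: "X ^ d \<le> n" "n < (X + 1) ^ d" using ex_root_floor by blast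
    have "Suc X0 ^ d < (X + 1) ^ d" using n X(2) by simp
    then have "X \<ge> X0 + 1" using d_pos by (simp add: power_less_imp_less_base)  (metis Suc_leI Suc_less_eq power_less_imp_less_base zero_le)
    then have X1: "X \<ge> 1" "X \<ge> X0" by auto
    have "(X + 1) ^ d \<le> (2 * X) ^ d" using X1 by (intro power_mono) auto
    then have "n \<le> (2 * X) ^ d" using X(2) by linarith
    then have "real n \<le> (2 * real X) ^ d" by (metis of_nat_le_iff of_nat_mult of_nat_numeral of_nat_power)
    moreover have "n \<ge> 1" using n by (meson max.boundedE)
    then have "real n > 0" by simp
    ultimately have "ln (real n) \<le> ln ((2 * real X) ^ d)" by (intro ln_mono) auto
    also have "\<dots> = d * ln 2 + d * ln (real X)" using X1 by (simp add: ln_realpow ln_mult_pos algebra_simps)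
    finally have "(1 - e) * ln (real n) \<le> (1 - e) * (d * ln 2) + (1 - e) * (d * ln (real X))"
      using e mult_left_mono[of _ _ "1 - e"] by (fastforce simp: distrib_left[symmetric])
    also have "(1 - e) * (d * ln 2) \<le> 1 * (d * ln 2)" using e by (intro mult_right_mono) auto
    also have "(1 - e) * (d * ln (real X)) \<le> (1 + e) * root_sum (nat \<lfloor>(t * real X) ^ d\<rfloor>) + K" by (rule *[OF X1(2)])
    also have "root_sum (nat \<lfloor>(t * real X) ^ d\<rfloor>) \<le> root_sum n"
    proof (rule root_sum_mono)
      have "(t * real X) ^ d \<le> (1 * real X) ^ d" using t by (intro power_mono mult_right_mono) auto
      also have "\<dots> \<le> real n" using X(1) by (metis mult_1 of_nat_le_iff of_nat_power)
      finally show "nat \<lfloor>(t * real X) ^ d\<rfloor> \<le> n" by linarith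
    qed
    finally show ?thesis using e by simp
  qed
  then show ?thesis unfolding eventually_sequentially by blast
qed

text \<open>Mertens' theorem for the field defined by \<open>g\<close>, in a weak form: the number of roots of \<open>g\<close> modulo \<open>p\<close> is
  \<open>1\<close> on average.\<close>

theorem root_sum_asymptotics: "(\<lambda>n. root_sum n / ln n) \<longlonglongrightarrow> 1"
proof (rule tendstoI)
  fix \<epsilon> :: real assume \<epsilon>: "\<epsilon> > 0"
  define e where "e = min (1/2) (\<epsilon> / 8)"
  have e: "e > 0" "e < 1" "e \<le> \<epsilon> / 8" "e \<le> 1 / 2" using \<epsilon> by (auto simp: e_def)
  obtain K1 where K1: "\<And>n. n \<ge> 1 \<Longrightarrow> root_sum n \<le> (1 + e) * ln n + K1" using root_sum_upper[OF e(1)] by blast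
  obtain K2 where K2: "\<forall>\<^sub>F n in sequentially. (1 - e) * ln (real n) \<le> (1 + e) * root_sum n + K2" using root_sum_lower[OF e(1,2)] by blast
  have l: "filterlim (\<lambda>n. ln (real n)) at_top sequentially"
    by (rule filterlim_compose[OF ln_at_top filterlim_real_sequentially])
  have "\<forall>\<^sub>F n in sequentially. ln (real n) \<ge> max 1 (max (\<bar>K1\<bar> / e) (\<bar>K2\<bar> / e))"
    using l by (simp only: filterlim_at_top)
  then show "\<forall>\<^sub>F n in sequentially. dist (root_sum n / ln n) 1 < \<epsilon>"
    using K2 eventually_ge_at_top[of 1]
  proof eventually_elim
    case (elim n)
    define l where "l = ln (real n)"
    have l: "l \<ge> 1" "\<bar>K1\<bar> \<le> e * l" "\<bar>K2\<bar> \<le> e * l" using elim(1) e(1) by (auto simp: l_def field_simps)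
    have u: "root_sum n \<le> (1 + 2 * e) * l" using K1[OF elim(3)] l(2) unfolding l_def[symmetric] by (simp add: algebra_simps)
    have "(1 - 2 * e) * l \<le> (1 + e) * root_sum n" using elim(2) l(3) unfolding l_def[symmetric] by (simp add: algebra_simps)
    moreover have "(1 + e) * ((1 - 3 * e) * l) \<le> (1 - 2 * e) * l"
    proof -
      have "(1 + e) * (1 - 3 * e) \<le> 1 - 2 * e" using e(1) by (simp add: algebra_simps)
      then show ?thesis using l(1) mult_right_mono[of "(1 + e) * (1 - 3 * e)" "1 - 2 * e" l] by simp
    qed
    ultimately have "(1 + e) * ((1 - 3 * e) * l) \<le> (1 + e) * root_sum n" by linarith
    then have lo: "(1 - 3 * e) * l \<le> root_sum n" using e(1) by simp
    have "root_sum n / l \<le> 1 + 2 * e" "1 - 3 * e \<le> root_sum n / l" using u lo l(1) by (auto simp: field_simps)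
    then show ?case using e(1,3) \<epsilon> unfolding l_def[symmetric] dist_real_def by linarith
  qed
qed

end

section \<open>Pure and cyclotomic polynomials\<close>

definition power_residue :: "nat \<Rightarrow> nat \<Rightarrow> int \<Rightarrow> bool" where
  "power_residue q p x \<longleftrightarrow> (\<exists>y::int. [y ^ q = x] (mod int p))"

definition root_count :: "int poly \<Rightarrow> nat \<Rightarrow> nat" where
  "root_count g p = card {r \<in> {0..<int p}. int p dvd poly g r}"

text \<open>Averages over primes are taken with the weights \<open>ln p / p\<close>, whose sum up to \<open>n\<close> is asymptotic to
  \<open>ln n\<close> (\<open>log_sum_one\<close>).\<close>

definition log_sum :: "(nat \<Rightarrow> real) \<Rightarrow> nat \<Rightarrow> real" where
  "log_sum w n = (\<Sum>p\<in>primes_le n. w p * (ln p / p))"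

theorem root_count_average:
  assumes "monic_irreducible g"
  shows "(\<lambda>n. log_sum (\<lambda>p. real (root_count g p)) n / ln n) \<longlonglongrightarrow> 1"
proof -
  interpret monic_irreducible g by fact
  show ?thesis using root_sum_asymptotics unfolding root_sum_def log_sum_def root_count_def roots_def by simp
qed

lemma log_sum_diff: "log_sum (\<lambda>p. w p - w' p) n = log_sum w n - log_sum w' n"
  by (simp only: log_sum_def left_diff_distrib sum_subtractf)

lemma log_sum_mult: "log_sum (\<lambda>p. a * w p) n = a * log_sum w n"
  by (simp add: log_sum_def sum_distrib_left mult.assoc)

lemma log_sum_sum: "log_sum (\<lambda>p. \<Sum>v\<in>V. w v p) n = (\<Sum>v\<in>V. log_sum (w v) n)"
  unfolding log_sum_def sum_distrib_right by (rule sum.swap)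

lemma ln_div_nonneg: "p \<in> primes_le n \<Longrightarrow> 0 \<le> ln (real p) / real p"
  using ln_primes_le_nonneg by simp

lemma log_sum_le_const:
  assumes "\<And>p. prime p \<Longrightarrow> p > M \<Longrightarrow> w p \<le> 0"
  shows "\<exists>K. \<forall>n. log_sum w n \<le> K"
proof -
  have "log_sum w n \<le> (\<Sum>p\<in>primes_le M. \<bar>w p\<bar> * (ln p / p))" for n
  proof -
    have "log_sum w n \<le> (\<Sum>p\<in>primes_le n. if p \<le> M then \<bar>w p\<bar> * (ln p / p) else 0)"
      unfolding log_sum_def
    proof (rule sum_mono)
      fix p assume p: "p \<in> primes_le n"
      then have "prime p" by (simp add: primes_le_def)
      then show "w p * (ln p / p) \<le> (if p \<le> M then \<bar>w p\<bar> * (ln p / p) else 0)"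
        using assms[of p] mult_right_mono[of "w p" "\<bar>w p\<bar>", OF _ ln_div_nonneg[OF p]]
          mult_right_mono[of "w p" 0, OF _ ln_div_nonneg[OF p]] by auto
    qed
    also have "\<dots> = (\<Sum>p\<in>{p \<in> primes_le n. p \<le> M}. \<bar>w p\<bar> * (ln p / p))"
      by (rule sum.inter_filter[symmetric]) simp
    also have "\<dots> \<le> (\<Sum>p\<in>primes_le M. \<bar>w p\<bar> * (ln p / p))"
      using ln_div_nonneg[of _ M] by (intro sum_mono2 mult_nonneg_nonneg) (auto simp: primes_le_def)
    finally show ?thesis .
  qed
  then show ?thesis by blast
qed

lemma ln_real_at_top: "filterlim (\<lambda>n. ln (real n)) at_top sequentially"
  by (rule filterlim_compose[OF ln_at_top filterlim_real_sequentially])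

lemma log_sum_ignore_finite:
  assumes eq: "\<And>p. prime p \<Longrightarrow> p > M \<Longrightarrow> w p = w' p"
    and lim: "(\<lambda>n. log_sum w n / ln n) \<longlonglongrightarrow> l"
  shows "(\<lambda>n. log_sum w' n / ln n) \<longlonglongrightarrow> l"
proof -
  define c where "c = (\<Sum>p\<in>primes_le M. (w' p - w p) * (ln p / p))"
  have "log_sum w' n = log_sum w n + c" if n: "n \<ge> M" for n
  proof -
    have "log_sum w' n - log_sum w n = (\<Sum>p\<in>primes_le n. (w' p - w p) * (ln p / p))"
      by (simp only: log_sum_def left_diff_distrib sum_subtractf)
    also have "\<dots> = c" unfolding c_def
      using n eq by (intro sum.mono_neutral_right) (auto simp: primes_le_def not_le)
    finally show ?thesis by simp
  qed
  then have ev: "\<forall>\<^sub>F n in sequentially. log_sum w n / ln n + c / ln n = log_sum w' n / ln n"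
    by (intro eventually_sequentiallyI[of M]) (simp add: add_divide_distrib)
  have "(\<lambda>n. log_sum w n / ln n + c / ln n) \<longlonglongrightarrow> l + 0"
    by (intro tendsto_add lim real_tendsto_divide_at_top[OF tendsto_const] ln_real_at_top)
  then show ?thesis using Lim_transform_eventually[OF _ ev] by simp
qed

definition primitive_root :: "nat \<Rightarrow> int \<Rightarrow> bool" where
  "primitive_root p \<gamma> \<longleftrightarrow> \<not> int p dvd \<gamma> \<and>
     (\<forall>x. \<not> int p dvd x \<longrightarrow> (\<exists>i. [x = \<gamma> ^ i] (mod int p))) \<and>
     (\<forall>i j. [\<gamma> ^ i = \<gamma> ^ j] (mod int p) \<longleftrightarrow> [i = j] (mod (p - 1)))"

lemma primitive_rootD:
  assumes "primitive_root p \<gamma>"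
  shows "\<not> int p dvd \<gamma>" "\<And>x. \<not> int p dvd x \<Longrightarrow> \<exists>i. [x = \<gamma> ^ i] (mod int p)"
    "\<And>i j. [\<gamma> ^ i = \<gamma> ^ j] (mod int p) \<longleftrightarrow> [i = j] (mod (p - 1))"
  using assms unfolding primitive_root_def by blast+

lemma ex_primitive_root:
  assumes p: "prime p"
  shows "\<exists>\<gamma>. primitive_root p \<gamma>"
proof -
  obtain h where h: "residue_primroot p h" using prime_primitive_root_exists[of p] p prime_gt_1_nat[OF p] by blast
  have h': "coprime p h" "ord p h = p - 1" using h p by (auto simp: residue_primroot_def totient_prime)
  have "primitive_root p (int h)" unfolding primitive_root_def
  proof (intro conjI allI impI)
    show "\<not> int p dvd int h" using h'(1) p by (metis coprime_absorb_left int_dvd_int_iff not_prime_unit)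
    show "\<exists>i. [x = int h ^ i] (mod int p)" if x: "\<not> int p dvd x" for x
    proof -
      define y where "y = nat (x mod int p)"
      have p0: "int p > 0" using prime_gt_0_nat[OF p] by simp
      have y: "int y = x mod int p" using p0 by (simp add: y_def)
      have "int y \<noteq> 0" using x unfolding y by (simp add: dvd_eq_mod_eq_0)
      moreover have "int y < int p" unfolding y using p0 by simp
      ultimately have "y \<in> totatives p" using p by (auto simp: totatives_prime)
      then obtain i where "y = h ^ i mod p"
        using residue_primroot_is_generator[OF prime_gt_1_nat[OF p] h] unfolding bij_betw_def by blast
      then have "int y = int h ^ i mod int p" by (simp add: zmod_int)
      then show ?thesis using y by (auto simp: cong_def)
    qed
    show "[int h ^ i = int h ^ j] (mod int p) \<longleftrightarrow> [i = j] (mod (p - 1))" for i j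
      using order_divides_expdiff[OF h'(1), of i j] h'(2) cong_int_iff[of "h ^ i" "h ^ j" p] by simp
  qed
  then show ?thesis ..
qed

lemma prime_power_not_dvd: "prime p \<Longrightarrow> \<not> int p dvd x \<Longrightarrow> \<not> int p dvd x ^ k"
  by (metis prime_dvd_power prime_nat_int_transfer)

lemma power_residue_log:
  assumes p: "prime p" and q: "prime q" and \<gamma>: "primitive_root p \<gamma>" and pq: "q dvd p - 1"
  shows "power_residue q p (\<gamma> ^ e) \<longleftrightarrow> q dvd e"
proof
  assume "power_residue q p (\<gamma> ^ e)"
  then obtain y where y: "[y ^ q = \<gamma> ^ e] (mod int p)" by (auto simp: power_residue_def)
  have "\<not> int p dvd y ^ q" using y prime_power_not_dvd[OF p primitive_rootD(1)[OF \<gamma>]] by (metis cong_dvd_iff)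
  then have "\<not> int p dvd y" using prime_gt_0_nat[OF q] by (metis dvd_power dvd_trans)
  then obtain i where "[y = \<gamma> ^ i] (mod int p)" using primitive_rootD(2)[OF \<gamma>] by blast
  then have "[y ^ q = \<gamma> ^ (i * q)] (mod int p)" by (simp add: power_mult cong_pow)
  then have "[\<gamma> ^ (i * q) = \<gamma> ^ e] (mod int p)" using y by (metis cong_sym cong_trans)
  then have "[i * q = e] (mod (p - 1))" using primitive_rootD(3)[OF \<gamma>] by blast
  then have "[i * q = e] (mod q)" using pq by (rule cong_dvd_modulus_nat)
  then show "q dvd e" by (metis cong_dvd_iff dvd_triv_right)
next
  assume "q dvd e"
  then obtain i where "e = q * i" by blast
  then have "\<gamma> ^ e = (\<gamma> ^ i) ^ q" by (simp add: power_mult[symmetric] mult.commute)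
  then show "power_residue q p (\<gamma> ^ e)" by (auto simp: power_residue_def intro: exI[of _ "\<gamma> ^ i"])
qed

text \<open>The discrete logarithm to a primitive root, read modulo \<open>q\<close>.\<close>

lemma residue_character:
  assumes p: "prime p" and q: "prime q" and pq: "q dvd p - 1"
  obtains \<chi> :: "int \<Rightarrow> int" where
    "\<And>x y. \<not> int p dvd x \<Longrightarrow> \<not> int p dvd y \<Longrightarrow> [\<chi> (x * y) = \<chi> x + \<chi> y] (mod int q)"
    "\<And>x. \<not> int p dvd x \<Longrightarrow> power_residue q p x \<longleftrightarrow> int q dvd \<chi> x"
proof -
  obtain \<gamma> where \<gamma>0: "primitive_root p \<gamma>" using ex_primitive_root[OF p] ..
  note \<gamma> = primitive_rootD[OF \<gamma>0]
  obtain i where i: "\<And>x. \<not> int p dvd x \<Longrightarrow> [x = \<gamma> ^ i x] (mod int p)" using \<gamma>(2) by metis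
  show thesis
  proof (rule that[of "\<lambda>x. int (i x)"])
    fix x y assume xy: "\<not> int p dvd x" "\<not> int p dvd y"
    then have nd: "\<not> int p dvd x * y" using p by (metis prime_dvd_multD prime_nat_int_transfer)
    have "[x * y = \<gamma> ^ (i x + i y)] (mod int p)" unfolding power_add using i xy by (intro cong_mult) auto
    then have "[\<gamma> ^ i (x * y) = \<gamma> ^ (i x + i y)] (mod int p)" by (rule cong_trans[OF cong_sym[OF i[OF nd]]])
    then have "[i (x * y) = i x + i y] (mod q)" using \<gamma>(3) cong_dvd_modulus_nat[OF _ pq] by blast
    then show "[int (i (x * y)) = int (i x) + int (i y)] (mod int q)" by (metis cong_int_iff of_nat_add)
  next
    fix x assume x: "\<not> int p dvd x"
    have "power_residue q p x \<longleftrightarrow> power_residue q p (\<gamma> ^ i x)"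
      unfolding power_residue_def using i[OF x] by (metis cong_sym cong_trans)
    also have "\<dots> \<longleftrightarrow> q dvd i x" by (rule power_residue_log[OF p q \<gamma>0 pq])
    finally show "power_residue q p x \<longleftrightarrow> int q dvd int (i x)" by simp
  qed
qed

abbreviation pure :: "nat \<Rightarrow> nat \<Rightarrow> int poly" where
  "pure q m \<equiv> monom 1 q - [:int m:]"

lemma root_count_log:
  assumes p: "prime p" and \<gamma>0: "primitive_root p \<gamma>" and e: "[int m = \<gamma> ^ e] (mod int p)" and q: "q > 0"
  shows "root_count (pure q m) p = card {i \<in> {..<p - 1}. [q * i = e] (mod (p - 1))}"
proof -
  note \<gamma> = primitive_rootD[OF \<gamma>0]
  have p0: "int p > 0" "p - 1 > 0" using prime_gt_1_nat[OF p] by auto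
  have ev: "int p dvd poly (pure q m) r \<longleftrightarrow> [r ^ q = \<gamma> ^ e] (mod int p)" for r
  proof -
    have "int p dvd poly (pure q m) r \<longleftrightarrow> [r ^ q = int m] (mod int p)"
      by (simp add: poly_monom cong_iff_dvd_diff)
    also have "\<dots> \<longleftrightarrow> [r ^ q = \<gamma> ^ e] (mod int p)" using e by (metis cong_sym cong_trans)
    finally show ?thesis .
  qed
  have pw: "[(\<gamma> ^ i mod int p) ^ q = \<gamma> ^ e] (mod int p) \<longleftrightarrow> [q * i = e] (mod (p - 1))" for i
  proof -
    have "[(\<gamma> ^ i mod int p) ^ q = (\<gamma> ^ i) ^ q] (mod int p)" by (intro cong_pow) (simp add: cong_def)
    then have "[(\<gamma> ^ i mod int p) ^ q = \<gamma> ^ e] (mod int p) \<longleftrightarrow> [\<gamma> ^ (q * i) = \<gamma> ^ e] (mod int p)"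
      by (metis cong_sym cong_trans mult.commute power_mult)
    then show ?thesis using \<gamma>(3) by simp
  qed
  have "bij_betw (\<lambda>i. \<gamma> ^ i mod int p) {i \<in> {..<p - 1}. [q * i = e] (mod (p - 1))}
          {r \<in> {0..<int p}. int p dvd poly (pure q m) r}"
  proof (rule bij_betwI')
    fix x y assume "x \<in> {i \<in> {..<p - 1}. [q * i = e] (mod (p - 1))}" "y \<in> {i \<in> {..<p - 1}. [q * i = e] (mod (p - 1))}"
    then have xy: "x < p - 1" "y < p - 1" by auto
    have "\<gamma> ^ x mod int p = \<gamma> ^ y mod int p \<longleftrightarrow> [x = y] (mod (p - 1))"
      using \<gamma>(3)[of x y] unfolding cong_def by blast
    also have "\<dots> \<longleftrightarrow> x = y" using xy by (simp add: cong_def)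
    finally show "(\<gamma> ^ x mod int p = \<gamma> ^ y mod int p) = (x = y)" .
  next
    fix x assume "x \<in> {i \<in> {..<p - 1}. [q * i = e] (mod (p - 1))}"
    then show "\<gamma> ^ x mod int p \<in> {r \<in> {0..<int p}. int p dvd poly (pure q m) r}"
      using p0 pw unfolding ev by auto
  next
    fix r assume r: "r \<in> {r \<in> {0..<int p}. int p dvd poly (pure q m) r}"
    then have rq: "[r ^ q = \<gamma> ^ e] (mod int p)" unfolding ev by simp
    then have "\<not> int p dvd r ^ q" using prime_power_not_dvd[OF p \<gamma>(1)] by (metis cong_dvd_iff)
    then have "\<not> int p dvd r" using q by (metis dvd_power dvd_trans)
    then obtain i where i: "[r = \<gamma> ^ i] (mod int p)" using \<gamma>(2) by blast
    define j where "j = i mod (p - 1)"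
    have "[j = i] (mod (p - 1))" by (simp add: j_def cong_def)
    then have "[\<gamma> ^ j = \<gamma> ^ i] (mod int p)" using \<gamma>(3) by blast
    then have "\<gamma> ^ j mod int p = r mod int p" using i by (simp add: cong_def)
    then have rj: "r = \<gamma> ^ j mod int p" using r by simp
    then have "[q * j = e] (mod (p - 1))" using rq pw by blast
    then show "\<exists>x\<in>{i \<in> {..<p - 1}. [q * i = e] (mod (p - 1))}. r = \<gamma> ^ x mod int p"
      using rj p0 by (intro bexI[of _ j]) (auto simp: j_def)
  qed
  from bij_betw_same_card[OF this, symmetric] show ?thesis unfolding root_count_def .
qed

lemma card_cong_class:
  assumes "M > 0" shows "card {i \<in> {..<q * M}. [i = a] (mod M)} = (q::nat)"
proof -
  have "bij_betw (\<lambda>k. a mod M + k * M) {..<q} {i \<in> {..<q * M}. [i = a] (mod M)}"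
  proof (rule bij_betwI')
    fix k assume "k \<in> {..<q}"
    then have "Suc k * M \<le> q * M" by (intro mult_le_mono1) auto
    moreover have "a mod M < M" using assms by simp
    ultimately have "a mod M + k * M < q * M" by simp
    then show "a mod M + k * M \<in> {i \<in> {..<q * M}. [i = a] (mod M)}" by (simp add: cong_def)
  next
    fix i assume i: "i \<in> {i \<in> {..<q * M}. [i = a] (mod M)}"
    then have "i = a mod M + (i div M) * M" by (simp add: cong_def) (metis mod_div_mult_eq)
    moreover have "i div M < q" using i assms by (simp add: less_mult_imp_div_less)
    ultimately show "\<exists>k\<in>{..<q}. i = a mod M + k * M" by blast
  qed (use assms in auto)
  from bij_betw_same_card[OF this, symmetric] show ?thesis by simp
qed

text \<open>For \<open>q\<close> dividing \<open>p - 1\<close>, the congruence \<open>q * i \<equiv> e (mod p - 1)\<close> for the logarithm of a root has \<open>q\<close>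
  solutions or none.\<close>

lemma root_count_split:
  assumes p: "prime p" and q: "prime q" and pm: "\<not> p dvd m" and pq: "q dvd p - 1"
  shows "root_count (pure q m) p = (if power_residue q p (int m) then q else 0)"
proof -
  obtain \<gamma> where \<gamma>0: "primitive_root p \<gamma>" using ex_primitive_root[OF p] ..
  note \<gamma> = primitive_rootD[OF \<gamma>0]
  obtain e where e: "[int m = \<gamma> ^ e] (mod int p)" using \<gamma>(2)[of "int m"] pm by auto
  have q0: "q > 0" using prime_gt_0_nat[OF q] .
  have rc: "root_count (pure q m) p = card {i \<in> {..<p - 1}. [q * i = e] (mod (p - 1))}"
    by (rule root_count_log[OF p \<gamma>0 e q0])
  have "power_residue q p (int m) \<longleftrightarrow> power_residue q p (\<gamma> ^ e)"
    unfolding power_residue_def using e by (metis cong_sym cong_trans)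
  then have pr: "power_residue q p (int m) \<longleftrightarrow> q dvd e" using power_residue_log[OF p q \<gamma>0 pq] by simp
  obtain M where M: "p - 1 = q * M" using pq by blast
  have M0: "M > 0" using M prime_gt_1_nat[OF p] by (cases M) auto
  show ?thesis
  proof (cases "q dvd e")
    case True
    then obtain a where a: "e = q * a" by blast
    have "[q * i = e] (mod (p - 1)) \<longleftrightarrow> [i = a] (mod M)" for i
      using q0 unfolding a M cong_def by (metis mult_mod_right mult_left_cancel less_irrefl)
    then have "root_count (pure q m) p = q" unfolding rc M using card_cong_class[OF M0] by simp
    then show ?thesis using pr True by simp
  next
    case False
    have "\<not> [q * i = e] (mod (p - 1))" for i
    proof
      assume "[q * i = e] (mod (p - 1))"
      then have "[q * i = e] (mod q)" using pq by (rule cong_dvd_modulus_nat)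
      then show False using False by (metis cong_dvd_iff dvd_triv_left)
    qed
    then show ?thesis using pr False rc by simp
  qed
qed

text \<open>The \<open>q\<close>-th power map is a bijection on the units modulo \<open>p\<close> when \<open>q\<close> is prime to \<open>p - 1\<close>.\<close>

lemma power_residue_trivial:
  assumes p: "prime p" and q: "prime q" and pq: "\<not> q dvd p - 1" and x: "\<not> int p dvd x"
  shows "power_residue q p x"
proof -
  have "coprime q (p - 1)" using q pq by (rule prime_imp_coprime)
  then obtain u where u: "[q * u = 1] (mod (p - 1))"
    using cong_solve_coprime_nat[of q "p - 1"] by auto
  obtain \<gamma> where \<gamma>0: "primitive_root p \<gamma>" using ex_primitive_root[OF p] ..
  note \<gamma> = primitive_rootD[OF \<gamma>0]
  obtain e where e: "[x = \<gamma> ^ e] (mod int p)" using \<gamma>(2) x by auto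
  have "[q * u * e = 1 * e] (mod (p - 1))" using u by (rule cong_scalar_right)
  then have "[\<gamma> ^ (q * u * e) = \<gamma> ^ e] (mod int p)" using \<gamma>(3) by simp
  moreover have "\<gamma> ^ (q * u * e) = (\<gamma> ^ (u * e)) ^ q" by (simp add: power_mult[symmetric] ac_simps)
  ultimately have "[(\<gamma> ^ (u * e)) ^ q = x] (mod int p)" using e by (metis cong_sym cong_trans)
  then show ?thesis by (auto simp: power_residue_def)
qed

lemma root_count_inert:
  assumes p: "prime p" and q: "prime q" and pm: "\<not> p dvd m" and pq: "\<not> q dvd p - 1"
  shows "root_count (pure q m) p = 1"
proof -
  have "coprime q (p - 1)" using q pq by (rule prime_imp_coprime)
  obtain \<gamma> where \<gamma>0: "primitive_root p \<gamma>" using ex_primitive_root[OF p] ..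
  note \<gamma> = primitive_rootD[OF \<gamma>0]
  obtain e where e: "[int m = \<gamma> ^ e] (mod int p)" using \<gamma>(2)[of "int m"] pm by auto
  have p1: "p - 1 > 0" using prime_gt_1_nat[OF p] by simp
  obtain u where u: "[q * u = 1] (mod (p - 1))"
    using cong_solve_coprime_nat[of q "p - 1"] \<open>coprime q (p - 1)\<close> by auto
  define i0 where "i0 = (u * e) mod (p - 1)"
  have "[q * i = e] (mod (p - 1)) \<longleftrightarrow> i = i0" if i: "i < p - 1" for i
  proof
    assume "[q * i = e] (mod (p - 1))"
    then have "[u * (q * i) = u * e] (mod (p - 1))" by (rule cong_scalar_left)
    moreover have "[q * u * i = 1 * i] (mod (p - 1))" using u by (rule cong_scalar_right)
    ultimately have "[i = u * e] (mod (p - 1))" by (metis cong_sym cong_trans mult.left_commute mult.assoc mult_1)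
    then show "i = i0" using i by (simp add: cong_def i0_def)
  next
    assume "i = i0"
    then have "[q * i = q * (u * e)] (mod (p - 1))" by (intro cong_scalar_left) (simp add: i0_def cong_def)
    moreover have "[q * u * e = 1 * e] (mod (p - 1))" using u by (rule cong_scalar_right)
    ultimately show "[q * i = e] (mod (p - 1))" by (metis cong_trans mult.assoc mult_1)
  qed
  then have "{i \<in> {..<p - 1}. [q * i = e] (mod (p - 1))} = {i0}" using p1 by (auto simp: i0_def)
  then show ?thesis using root_count_log[OF p \<gamma>0 e prime_gt_0_nat[OF q]] by simp
qed

text \<open>Up to sign, the constant coefficient is the leading one times the product of the roots.\<close>

lemma map_poly_of_int_prod_roots:
  fixes a :: "int poly" and \<rho> :: real
  assumes "a \<noteq> 0" and \<rho>: "\<And>x::complex. poly (map_poly of_int a) x = 0 \<Longrightarrow> norm x = \<rho>"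
  shows "real_of_int \<bar>coeff a 0\<bar> = real_of_int \<bar>lead_coeff a\<bar> * \<rho> ^ degree a"
proof -
  define A where "A = (map_poly of_int a :: complex poly)"
  have A: "A \<noteq> 0" "degree A = degree a" "lead_coeff A = of_int (lead_coeff a)" "poly A 0 = of_int (coeff a 0)"
    using assms(1) unfolding A_def
    by (auto simp: map_poly_eq_0_iff degree_map_poly coeff_map_poly poly_0_coeff_0)
  obtain R where R: "size R = degree A" "A = smult (lead_coeff A) (\<Prod>x\<in>#R. [:-x, 1:])"
    using alg_closed_imp_factorization[OF A(1)] by blast
  have "norm x = \<rho>" if "x \<in># R" for x
  proof (rule \<rho>)
    have "poly (\<Prod>x\<in>#R. [:-x, 1:]) x = 0"
      using that by (auto simp: poly_prod_mset prod_mset_zero_iff image_iff)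
    then have "poly (smult (lead_coeff A) (\<Prod>x\<in>#R. [:-x, 1:])) x = 0" by simp
    then show "poly (map_poly of_int a) x = 0" using R(2) unfolding A_def[symmetric] by simp
  qed
  then have "(\<Prod>x\<in>#R. norm (- x)) = (\<Prod>x\<in>#R. \<rho>)" by (intro arg_cong[of _ _ prod_mset] image_mset_cong) auto
  then have pr: "(\<Prod>x\<in>#R. norm (- x)) = \<rho> ^ size R" by simp
  have "norm (\<Prod>x\<in>#R. - x) = (\<Prod>x\<in>#R. norm (- x))" by (induction R) (auto simp: norm_mult)
  moreover have "poly A 0 = lead_coeff A * (\<Prod>x\<in>#R. - x)"
    by (subst R(2)) (simp add: poly_prod_mset)
  ultimately have "norm (poly A 0) = norm (lead_coeff A) * \<rho> ^ degree a"
    using pr R(1) A(2) by (simp add: norm_mult)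
  then show ?thesis unfolding A(3,4) by simp
qed

text \<open>All complex roots have absolute value \<open>root q m\<close>. A factor of degree \<open>k\<close> would therefore have a constant
  coefficient of absolute value \<open>root q m ^ k\<close>, so that \<open>m ^ k\<close> is a \<open>q\<close>-th power. For \<open>0 < k < q\<close> then so
  is \<open>m\<close>, because \<open>k\<close> is prime to \<open>q\<close>.\<close>

lemma pure_irreducible:
  assumes q: "prime q" and m: "m > 0" "\<And>a::nat. a ^ q \<noteq> m"
  shows "monic_irreducible (pure q m)"
proof
  have q0: "q > 0" using prime_gt_0_nat[OF q] .
  have cf: "coeff (pure q m) i = (if i = q then 1 else if i = 0 then - int m else 0)" for i
    using q0 by (auto simp: coeff_pCons split: nat.splits)
  have deg: "degree (pure q m) = q"
    by (rule antisym[OF degree_le le_degree]) (auto simp: cf simp del: coeff_diff)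
  show lc: "lead_coeff (pure q m) = 1" unfolding deg cf by simp
  show "irreducible (pure q m)"
  proof (rule irreducibleI)
    show pure0: "pure q m \<noteq> 0" using deg q0 by (metis degree_0 less_irrefl)
    show "\<not> pure q m dvd 1"
    proof
      assume "pure q m dvd 1"
      then have "degree (pure q m) \<le> degree (1 :: int poly)" by (rule dvd_imp_degree_le) simp
      then show False using deg q0 by simp
    qed
    fix a b assume ab: "pure q m = a * b"
    have ab0: "a \<noteq> 0" "b \<noteq> 0" using pure0 unfolding ab by auto
    have "lead_coeff a * lead_coeff b = 1" using lc unfolding ab lead_coeff_mult .
    then have l: "\<bar>lead_coeff a\<bar> = 1" "lead_coeff a dvd 1" "lead_coeff b dvd 1"
      by (auto simp: zmult_eq_1_iff)
    have dab: "degree a + degree b = q" using deg ab0 unfolding ab by (simp add: degree_mult_eq)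
    have unit: "c dvd 1" if "degree c = 0" "lead_coeff c dvd 1" for c :: "int poly"
    proof -
      obtain k where "c = [:k:]" using \<open>degree c = 0\<close> degree_eq_zeroE by blast
      then show ?thesis using that(2) by (simp add: is_unit_const_poly_iff)
    qed
    show "a dvd 1 \<or> b dvd 1"
    proof (rule ccontr)
      assume "\<not> (a dvd 1 \<or> b dvd 1)"
      then have "degree a \<noteq> 0" "degree b \<noteq> 0" using unit[OF _ l(2)] unit[OF _ l(3)] by blast+
      then have da: "0 < degree a" "degree a < q" using dab by linarith+
      define k where "k = degree a"
      have nx: "norm x = root q m" if x: "poly (map_poly of_int a) x = 0" for x :: complex
      proof -
        have "map_poly of_int (pure q m) = (map_poly of_int a * map_poly of_int b :: complex poly)"
          unfolding ab by (rule poly_eqI) (simp add: coeff_map_poly coeff_mult)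
        then have "poly (map_poly of_int (pure q m)) x = 0" using x by simp
        moreover have "map_poly of_int (pure q m) = (monom 1 q - [:of_nat m:] :: complex poly)"
          by (rule poly_eqI) (auto simp: coeff_map_poly coeff_pCons split: nat.splits)
        ultimately have "x ^ q = of_nat m" by (simp add: poly_monom)
        then have "norm x ^ q = real m" by (metis norm_of_nat norm_power)
        then show ?thesis using q0 by (metis norm_ge_zero real_root_power_cancel)
      qed
      have a0: "real_of_int \<bar>coeff a 0\<bar> = root q m ^ k"
        using map_poly_of_int_prod_roots[OF ab0(1) nx] l(1) unfolding k_def by simp
      define n where "n = nat \<bar>coeff a 0\<bar>"
      have "real n = root q m ^ k" using a0 by (simp add: n_def)
      then have "real n ^ q = (root q m ^ q) ^ k" by (simp add: power_mult[symmetric] mult.commute)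
      also have "\<dots> = real m ^ k" using q0 by (simp add: real_root_pow_pos2)
      finally have nm: "n ^ q = m ^ k" by (metis of_nat_eq_iff of_nat_power)
      have "is_nth_power q (m ^ k)" by (rule is_nth_powerI[of _ n]) (simp add: nm)
      have cop: "coprime q k" using q nat_dvd_not_less[OF da] unfolding k_def by (rule prime_imp_coprime)
      have "is_nth_power q m"
        unfolding is_nth_power_conv_multiplicity_nat[OF q0]
      proof (intro allI impI)
        fix p :: nat assume p: "prime p"
        have "q dvd multiplicity p (m ^ k)"
          using \<open>is_nth_power q (m ^ k)\<close> p unfolding is_nth_power_conv_multiplicity_nat[OF q0] by blast
        also have "multiplicity p (m ^ k) = k * multiplicity p m"
          using p m(1) by (simp add: prime_elem_multiplicity_power_distrib)
        finally show "q dvd multiplicity p m" using cop by (simp add: coprime_dvd_mult_right_iff)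
      qed
      then show False using m(2) by (auto elim!: is_nth_powerE)
    qed
  qed
qed

lemma X_irreducible: "monic_irreducible [:0, 1:]"
proof
  show "irreducible [:0, 1::int:]" by (rule irreducible_linear_poly) auto
qed simp

lemma log_sum_one: "(\<lambda>n. log_sum (\<lambda>p. 1) n / ln n) \<longlonglongrightarrow> 1"
proof (rule log_sum_ignore_finite[OF _ root_count_average[OF X_irreducible]])
  fix p :: nat assume "prime p" "p > 0"
  have "{r \<in> {0..<int p}. int p dvd r} = {0}"
  proof -
    have "r = 0" if "0 \<le> r" "r < int p" "int p dvd r" for r
      using that zdvd_imp_le[of "int p" r] by (cases "r = 0") auto
    then show ?thesis using \<open>p > 0\<close> by auto
  qed
  then show "real (root_count [:0, 1:] p) = 1" by (simp add: root_count_def)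
qed

text \<open>Modulo a prime other than \<open>q\<close>, the roots of such a factor are elements of multiplicative order \<open>q\<close>.\<close>

lemma cyclotomic_factor:
  assumes q: "prime q"
  obtains g where "monic_irreducible g" "g dvd (\<Sum>i<q. monom 1 i)" "degree g \<le> q - 1"
proof -
  define f :: "int poly" where "f = (\<Sum>i<q. monom 1 i)"
  have q1: "q > 1" using prime_gt_1_nat[OF q] .
  have cf: "coeff f i = (if i < q then 1 else 0)" for i
    unfolding f_def coeff_sum coeff_monom using sum.delta[of "{..<q}" i "\<lambda>_. 1::int"] by simp
  have deg: "degree f = q - 1"
    by (rule antisym[OF degree_le le_degree]) (use q1 in \<open>auto simp: cf\<close>)
  have lc: "lead_coeff f = 1" using q1 by (simp add: deg cf)
  have f0: "f \<noteq> 0" using lc by auto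
  have "\<not> f dvd 1"
  proof
    assume "f dvd 1"
    then have "degree f \<le> degree (1 :: int poly)" by (rule dvd_imp_degree_le) simp
    then show False using deg q1 by simp
  qed
  then obtain h where h: "h dvd f" "prime h" using prime_divisor_exists[OF f0] by blast
  then obtain h' where h': "f = h * h'" by blast
  have "lead_coeff h * lead_coeff h' = 1" using lc unfolding h' lead_coeff_mult .
  then have lh: "lead_coeff h * lead_coeff h = 1" "lead_coeff h dvd 1" by (auto simp: zmult_eq_1_iff)
  define g where "g = smult (lead_coeff h) h"
  have "h \<noteq> 0" using f0 h' by auto
  then have "lead_coeff g = 1" using lh by (simp add: g_def)
  moreover have "irreducible g"
  proof -
    have "irreducible h" using h(2) by (simp add: prime_elem_imp_irreducible)
    moreover have "g = [:lead_coeff h:] * h" by (simp add: g_def)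
    moreover have "is_unit [:lead_coeff h:]" using lh(2) by (simp add: is_unit_const_poly_iff)
    ultimately show ?thesis using irreducible_mult_unit_left[of "[:lead_coeff h:]" h] by metis
  qed
  ultimately have "monic_irreducible g" by unfold_locales
  moreover have "f = g * smult (lead_coeff h) h'" using lh(1) by (simp add: g_def h')
  then have "g dvd f" by (rule dvdI)
  then have "degree g \<le> q - 1" using dvd_imp_degree_le[OF _ f0] deg by metis
  ultimately show thesis using that \<open>g dvd f\<close> unfolding f_def by blast
qed

text \<open>Dirichlet's theorem for the residue class \<open>1\<close> modulo \<open>q\<close>. Modulo \<open>p > q\<close>, a root of the cyclotomic factor \<open>g\<close>
  has order \<open>q\<close>; so \<open>g\<close> has roots only modulo \<open>p \<equiv> 1 (mod q)\<close>, and at most \<open>q - 1\<close> of them, while it has one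
  root on average.\<close>

lemma log_sum_primes_1_mod:
  assumes q: "prime q"
  shows "\<forall>\<^sub>F n in sequentially. ln n / 2 \<le> (real q - 1) * log_sum (\<lambda>p. if q dvd p - 1 then 1 else 0) n"
proof -
  obtain g where g: "monic_irreducible g" "g dvd (\<Sum>i<q. monom 1 i)" "degree g \<le> q - 1"
    using cyclotomic_factor[OF q] by blast
  have "root_count g p \<le> (if q dvd p - 1 then real q - 1 else 0)" if p: "prime p" "p > q" for p
  proof (cases "q dvd p - 1")
    case True
    interpret monic_irreducible g by fact
    have "root_count g p \<le> q - 1" using card_roots_le[OF p(1)] g(3) by (simp add: root_count_def roots_def)
    then have "real (root_count g p) \<le> real (q - 1)" by (simp only: of_nat_le_iff)
    then show ?thesis using True prime_gt_0_nat[OF q] by (simp add: of_nat_diff)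
  next
    case False
    have "\<not> int p dvd poly g r" for r
    proof
      assume "int p dvd poly g r"
      then have "int p dvd poly (\<Sum>i<q. monom 1 i) r" using g(2) by (auto elim!: dvdE)
      then have s: "int p dvd (\<Sum>i<q. r ^ i)" by (simp add: poly_sum poly_monom)
      then have "int p dvd (r - 1) * (\<Sum>i<q. r ^ i)" by simp
      then have rq: "[r ^ q = 1] (mod int p)" by (simp add: power_diff_1_eq cong_iff_dvd_diff)
      have nr: "\<not> int p dvd r"
      proof
        assume "int p dvd r"
        then have "int p dvd r ^ q" using prime_gt_0_nat[OF q] by (metis dvd_power dvd_trans)
        then have "int p dvd 1" using rq by (metis cong_dvd_iff)
        then show False using p(1) by (simp add: prime_nat_iff)
      qed
      obtain \<gamma> where \<gamma>0: "primitive_root p \<gamma>" using ex_primitive_root[OF p(1)] ..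
      note \<gamma> = primitive_rootD[OF \<gamma>0]
      obtain i where i: "[r = \<gamma> ^ i] (mod int p)" using \<gamma>(2)[OF nr] by blast
      then have "[r ^ q = \<gamma> ^ (i * q)] (mod int p)" by (simp add: power_mult cong_pow)
      then have "[\<gamma> ^ (i * q) = \<gamma> ^ 0] (mod int p)" using rq by (metis cong_sym cong_trans power_0)
      then have "[i * q = 0] (mod (p - 1))" using \<gamma>(3) by blast
      then have "p - 1 dvd i * q" by (simp add: cong_0_iff)
      moreover have "coprime (p - 1) q" using q False by (metis coprime_commute prime_imp_coprime)
      ultimately have "p - 1 dvd i" by (simp add: coprime_dvd_mult_left_iff)
      then have "[i = 0] (mod (p - 1))" by (simp add: cong_0_iff)
      then have "[\<gamma> ^ i = \<gamma> ^ 0] (mod int p)" using \<gamma>(3) by blast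
      then have r1: "[r = 1] (mod int p)" using i by (metis cong_trans power_0)
      then have "[(\<Sum>i<q. r ^ i) = (\<Sum>i<q. 1)] (mod int p)"
        by (intro cong_sum) (metis cong_pow power_one)
      then have "int p dvd int q" using s by (simp add: cong_dvd_iff)
      then show False using p(2) prime_gt_0_nat[OF q] by (auto dest: zdvd_imp_le)
    qed
    then have "root_count g p = 0" by (simp add: root_count_def)
    then show ?thesis using False by simp
  qed
  then obtain K where K: "\<And>n. log_sum (\<lambda>p. real (root_count g p) - (if q dvd p - 1 then real q - 1 else 0)) n \<le> K"
    using log_sum_le_const[of q "\<lambda>p. real (root_count g p) - (if q dvd p - 1 then real q - 1 else 0)"] by fastforce
  have eq: "log_sum (\<lambda>p. if q dvd p - 1 then real q - 1 else 0) n
      = (real q - 1) * log_sum (\<lambda>p. if q dvd p - 1 then 1 else 0) n" for n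
    unfolding log_sum_mult[symmetric] by (intro arg_cong2[of _ _ _ _ log_sum]) auto
  have "\<forall>\<^sub>F n in sequentially. log_sum (\<lambda>p. real (root_count g p)) n / ln n > 3 / 4"
    by (rule order_tendstoD(1)[OF root_count_average[OF g(1)]]) simp
  moreover have "\<forall>\<^sub>F n in sequentially. ln (real n) \<ge> max 1 (4 * K)"
    using ln_real_at_top by (simp only: filterlim_at_top)
  ultimately show ?thesis
  proof eventually_elim
    case (elim n)
    have "3 / 4 * ln (real n) \<le> log_sum (\<lambda>p. real (root_count g p)) n" using elim by (simp add: field_simps)
    moreover have "log_sum (\<lambda>p. real (root_count g p)) n - (real q - 1) * log_sum (\<lambda>p. if q dvd p - 1 then 1 else 0) n \<le> K"
      using K[of n] unfolding log_sum_diff eq .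
    ultimately show ?case using elim(2) by simp
  qed
qed

section \<open>Primes with a prescribed kernel of power residues\<close>

definition vec_add :: "nat \<Rightarrow> nat \<Rightarrow> (nat \<Rightarrow> int) \<Rightarrow> int \<Rightarrow> (nat \<Rightarrow> int) \<Rightarrow> nat \<Rightarrow> int" where
  "vec_add n q v c w = (\<lambda>i\<in>{..<n}. (v i + c * w i) mod int q)"

text \<open>The linear form with coefficients \<open>b\<close>; its values are integers and matter modulo \<open>q\<close>.\<close>

definition form :: "nat \<Rightarrow> (nat \<Rightarrow> int) \<Rightarrow> (nat \<Rightarrow> int) \<Rightarrow> int" where
  "form n b v = (\<Sum>i<n. b i * v i)"

lemma carrier_Fq: "q > 0 \<Longrightarrow> carrier (Fq q) = {0..<int q}"
  by (auto simp: residue_ring_def)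

lemma vecs_eq: "q > 0 \<Longrightarrow> vecs n q = ({..<n} \<rightarrow>\<^sub>E {0..<int q})"
  by (simp add: vecs_def carrier_Fq)

lemma vecs_memD: "v \<in> vecs n q \<Longrightarrow> q > 0 \<Longrightarrow> i < n \<Longrightarrow> v i \<in> {0..<int q}"
  using PiE_mem[of v "{..<n}" "\<lambda>_. {0..<int q}" i] by (simp add: vecs_eq)

lemma finite_vecs: "q > 0 \<Longrightarrow> finite (vecs n q)" by (simp add: vecs_eq finite_PiE)

lemma vec_add_vecs: "q > 0 \<Longrightarrow> vec_add n q v c w \<in> vecs n q"
  by (auto simp: vecs_eq vec_add_def)

lemma form_vec_add: "[form n b (vec_add n q v c w) = form n b v + c * form n b w] (mod int q)"
proof -
  have "form n b (vec_add n q v c w) = (\<Sum>i<n. b i * ((v i + c * w i) mod int q))"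
    unfolding form_def vec_add_def by (intro sum.cong) auto
  also have "[\<dots> = (\<Sum>i<n. b i * (v i + c * w i))] (mod int q)"
    by (intro cong_sum cong_scalar_left) (simp add: cong_def)
  also have "(\<Sum>i<n. b i * (v i + c * w i)) = form n b v + c * form n b w"
    by (simp add: form_def sum_distrib_left sum.distrib algebra_simps)
  finally show ?thesis .
qed

text \<open>A form that does not vanish at \<open>w\<close> splits the subspace \<open>A\<close> into translates of its kernel by the
  multiples of \<open>w\<close>.\<close>

lemma card_subspace_kernel:
  assumes q: "prime q" and A: "A \<subseteq> vecs n q" "\<And>v c w. v \<in> A \<Longrightarrow> w \<in> A \<Longrightarrow> vec_add n q v c w \<in> A"
    and w: "w \<in> A" "\<not> int q dvd form n b w"
  shows "card A = q * card {v \<in> A. int q dvd form n b v}"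
proof -
  have q0: "q > 0" using prime_gt_0_nat[OF q] .
  have "coprime (form n b w) (int q)" using w(2) q by (metis coprime_commute prime_imp_coprime prime_nat_int_transfer)
  then obtain u where u: "[form n b w * u = 1] (mod int q)" using cong_solve_coprime_int by blast
  let ?K = "{v \<in> A. int q dvd form n b v}"
  have vA: "v i \<in> {0..<int q}" if "v \<in> A" "i < n" for v i
    using that A(1) q0 by (intro vecs_memD) auto
  have ext: "v i = undefined" if "v \<in> A" "\<not> i < n" for v i
  proof -
    have "v \<in> {..<n} \<rightarrow>\<^sub>E {0..<int q}" using that(1) A(1) vecs_eq[OF q0] by blast
    then show ?thesis by (rule PiE_arb) (use that(2) in simp)
  qed
  have undo: "vec_add n q (vec_add n q v c w) (- c) w = v" if v: "v \<in> A" for v c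
  proof
    fix i show "vec_add n q (vec_add n q v c w) (- c) w i = v i"
    proof (cases "i < n")
      case True
      have "((v i + c * w i) mod int q + - c * w i) mod int q = ((v i + c * w i) + - c * w i) mod int q"
        by (rule mod_add_left_eq)
      also have "\<dots> = v i" using vA[OF v True] by simp
      finally show ?thesis using True by (simp add: vec_add_def)
    next
      case False then show ?thesis using ext[OF v False] by (simp add: vec_add_def)
    qed
  qed
  let ?back = "\<lambda>v. (vec_add n q v (- ((form n b v * u) mod int q)) w, (form n b v * u) mod int q)"
  have "bij_betw (\<lambda>(v, c). vec_add n q v c w) (?K \<times> {0..<int q}) A"
  proof (rule bij_betw_byWitness[where f' = ?back])
    show "\<forall>a\<in>?K \<times> {0..<int q}. ?back
        ((\<lambda>(v, c). vec_add n q v c w) a) = a"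
    proof
      fix x assume x: "x \<in> ?K \<times> {0..<int q}"
      obtain v c where vc: "x = (v, c)" by (cases x)
      have v: "v \<in> A" "int q dvd form n b v" and c: "c \<in> {0..<int q}" using x vc by auto
      have "[form n b (vec_add n q v c w) = 0 + c * form n b w] (mod int q)"
        by (rule cong_trans[OF form_vec_add cong_add[OF _ cong_refl]]) (use v(2) in \<open>simp add: cong_0_iff\<close>)
      then have "[form n b (vec_add n q v c w) * u = (c * form n b w) * u] (mod int q)"
        by (intro cong_scalar_right) simp
      also have "(c * form n b w) * u = c * (form n b w * u)" by simp
      also have "[c * (form n b w * u) = c * 1] (mod int q)" using u by (rule cong_scalar_left)
      finally have "(form n b (vec_add n q v c w) * u) mod int q = c" using c by (simp add: cong_def)
      then show "?back
        ((\<lambda>(v, c). vec_add n q v c w) x) = x" using undo[OF v(1)] by (simp add: vc)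
    qed
    show "\<forall>v\<in>A. (\<lambda>(v, c). vec_add n q v c w)
        (vec_add n q v (- ((form n b v * u) mod int q)) w, (form n b v * u) mod int q) = v"
      using undo[of _ "- c" for c] by simp
    show "(\<lambda>(v, c). vec_add n q v c w) ` (?K \<times> {0..<int q}) \<subseteq> A" using A(2) w(1) by auto
    show "?back ` A \<subseteq> ?K \<times> {0..<int q}"
    proof (rule image_subsetI)
      fix v assume v: "v \<in> A"
      let ?c = "(form n b v * u) mod int q"
      have "[form n b (vec_add n q v (- ?c) w) = form n b v + (- ?c) * form n b w] (mod int q)" by (rule form_vec_add)
      also have "[form n b v + (- ?c) * form n b w = form n b v + (- (form n b v * u)) * form n b w] (mod int q)"
        by (intro cong_add cong_refl cong_scalar_right cong_minus_minus_iff[THEN iffD2]) (simp add: cong_def)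
      also have "form n b v + (- (form n b v * u)) * form n b w = form n b v * 1 - form n b v * (form n b w * u)"
        by (simp add: algebra_simps)
      also have "[form n b v * 1 - form n b v * (form n b w * u) = form n b v * 1 - form n b v * 1] (mod int q)"
        by (intro cong_diff cong_refl cong_scalar_left u)
      finally have "int q dvd form n b (vec_add n q v (- ?c) w)" by (simp add: cong_0_iff)
      then show "(vec_add n q v (- ?c) w, ?c) \<in> ?K \<times> {0..<int q}" using A(2)[OF v w(1)] q0 by simp
    qed
  qed
  then have "card (?K \<times> {0..<int q}) = card A" by (rule bij_betw_same_card)
  then show ?thesis by (simp add: card_cartesian_product mult.commute)
qed

text \<open>If the second form does not vanish on the kernel of the first, then the inequality is an equality. If it
  does, the kernel of the first form is strictly contained in that of the second; this is
  impossible, because the second kernel consists of \<open>1 / q\<close> of all vectors and the first of at least as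
  many.\<close>

lemma kernel_count:
  assumes q: "prime q" and w0: "w0 \<in> vecs n q" "\<not> int q dvd form n b w0"
    and ne: "{v \<in> vecs n q. int q dvd form n a v} \<noteq> {v \<in> vecs n q. int q dvd form n b v}"
  shows "q * card {v \<in> vecs n q. int q dvd form n a v \<and> int q dvd form n b v}
    \<le> card {v \<in> vecs n q. int q dvd form n a v}"
    "card (vecs n q) = q * card {v \<in> vecs n q. int q dvd form n b v}"
proof -
  have q0: "q > 0" using prime_gt_0_nat[OF q] .
  let ?V = "vecs n q"
  let ?H = "{v \<in> ?V. int q dvd form n a v}" and ?K = "{v \<in> ?V. int q dvd form n b v}"
  have clV: "vec_add n q v c w \<in> ?V" for v c w by (rule vec_add_vecs[OF q0])
  have clH: "vec_add n q v c w \<in> ?H" if "v \<in> ?H" "w \<in> ?H" for v c w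
    using that clV form_vec_add[of n a q v c w] by (simp add: cong_dvd_iff)
  show V: "card ?V = q * card ?K" by (rule card_subspace_kernel[OF q subset_refl clV w0])
  have fV: "finite ?V" by (rule finite_vecs[OF q0])
  show "q * card {v \<in> ?V. int q dvd form n a v \<and> int q dvd form n b v} \<le> card ?H"
  proof (cases "\<exists>w\<in>?H. \<not> int q dvd form n b w")
    case True
    then obtain w where w: "w \<in> ?H" "\<not> int q dvd form n b w" by blast
    have "card ?H = q * card {v \<in> ?H. int q dvd form n b v}"
      by (rule card_subspace_kernel[OF q _ clH w]) auto
    moreover have "{v \<in> ?H. int q dvd form n b v} = {v \<in> ?V. int q dvd form n a v \<and> int q dvd form n b v}" by blast
    ultimately show ?thesis by simp
  next
    case False
    then have sub: "?H \<subset> ?K" using ne by blast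
    have "card ?H < card ?K" by (rule psubset_card_mono[OF _ sub]) (use fV in simp)
    moreover have "card ?K \<le> card ?H"
    proof (cases "\<exists>w\<in>?V. \<not> int q dvd form n a w")
      case True
      then obtain w where "w \<in> ?V" "\<not> int q dvd form n a w" by blast
      then have "card ?V = q * card ?H" by (intro card_subspace_kernel[OF q subset_refl clV])
      then show ?thesis using V q0 by simp
    next
      case False
      then have "?H = ?V" by blast
      then show ?thesis using card_mono[OF fV, of ?K] by auto
    qed
    ultimately show ?thesis by simp
  qed
qed

definition monomial :: "nat list \<Rightarrow> (nat \<Rightarrow> int) \<Rightarrow> nat" where
  "monomial ps v = (\<Prod>i<length ps. ps ! i ^ nat (v i))"

lemma multiplicity_monomial:
  assumes ps: "distinct ps" "\<And>p. p \<in> set ps \<Longrightarrow> prime p" and i: "i < length ps"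
  shows "multiplicity (ps ! i) (monomial ps v) = nat (v i)"
proof -
  have pr: "prime (ps ! j)" if "j < length ps" for j using that ps(2) by simp
  have "multiplicity (ps ! i) (monomial ps v) = (\<Sum>j<length ps. multiplicity (ps ! i) (ps ! j ^ nat (v j)))"
    unfolding monomial_def
    by (subst prime_elem_multiplicity_prod_distrib) (use pr i in \<open>auto simp: prime_gt_0_nat image_iff\<close>)
  also have "\<dots> = (\<Sum>j<length ps. if j = i then nat (v j) else 0)"
  proof (intro sum.cong refl)
    fix j assume "j \<in> {..<length ps}"
    then have j: "j < length ps" by simp
    show "multiplicity (ps ! i) (ps ! j ^ nat (v j)) = (if j = i then nat (v j) else 0)"
    proof (cases "j = i")
      case True then show ?thesis using pr[OF j] by (simp add: multiplicity_same_power prime_gt_0_nat)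
    next
      case False
      then have "ps ! i \<noteq> ps ! j" using ps(1) i j by (simp add: nth_eq_iff_index_eq)
      then have "\<not> ps ! i dvd ps ! j ^ nat (v j)" using pr[OF i] pr[OF j]
        by (metis prime_dvd_power primes_dvd_imp_eq)
      then show ?thesis using False by (simp add: not_dvd_imp_multiplicity_0)
    qed
  qed
  also have "\<dots> = nat (v i)" using i sum.delta[of "{..<length ps}" i "\<lambda>j. nat (v j)"] by simp
  finally show ?thesis .
qed

lemma monomial_pos: "(\<And>p. p \<in> set ps \<Longrightarrow> prime p) \<Longrightarrow> monomial ps v > 0"
  unfolding monomial_def by (intro prod_pos) (auto simp: prime_gt_0_nat)

lemma monomial_not_power:
  assumes ps: "distinct ps" "\<And>p. p \<in> set ps \<Longrightarrow> prime p" and q: "prime q"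
    and v: "v \<in> vecs (length ps) q" "v \<noteq> zero_vec (length ps) q"
  shows "a ^ q \<noteq> monomial ps v"
proof
  assume a: "a ^ q = monomial ps v"
  have q0: "q > 0" using prime_gt_0_nat[OF q] .
  have "v i = zero_vec (length ps) q i" for i
  proof (cases "i < length ps")
    case True
    then have "prime (ps ! i)" using ps(2) by simp
    moreover have "a \<noteq> 0" using a monomial_pos[OF ps(2)] q0 by (metis less_irrefl zero_power)
    ultimately have "nat (v i) = q * multiplicity (ps ! i) a"
      using multiplicity_monomial[OF ps True, of v] a[symmetric]
      by (simp add: prime_elem_multiplicity_power_distrib)
    moreover have "v i \<in> {0..<int q}" by (rule vecs_memD[OF v(1) q0 True])
    ultimately have "v i = 0" by (cases "multiplicity (ps ! i) a") auto
    then show ?thesis using True by (simp add: zero_vec_def residue_ring_def)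
  next
    case False
    have "v \<in> {..<length ps} \<rightarrow>\<^sub>E {0..<int q}" using v(1) vecs_eq[OF q0] by blast
    then have "v i = undefined" by (rule PiE_arb) (use False in simp)
    then show ?thesis using False by (simp add: zero_vec_def)
  qed
  then show False using v(2) by blast
qed

text \<open>The coefficients of the form are the values of the residue character at the primes in the list.\<close>

lemma monomial_residue_form:
  assumes ps: "\<And>p. p \<in> set ps \<Longrightarrow> prime p" and q: "prime q" and p: "prime p" "q dvd p - 1" "p \<notin> set ps"
  obtains a where "\<And>v. v \<in> vecs (length ps) q \<Longrightarrow>
    power_residue q p (int (monomial ps v)) \<longleftrightarrow> int q dvd form (length ps) a v"
proof -
  obtain \<chi> :: "int \<Rightarrow> int" where \<chi>: "\<And>x y. \<not> int p dvd x \<Longrightarrow> \<not> int p dvd y \<Longrightarrow> [\<chi> (x * y) = \<chi> x + \<chi> y] (mod int q)"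
    "\<And>x. \<not> int p dvd x \<Longrightarrow> power_residue q p x \<longleftrightarrow> int q dvd \<chi> x"
    using residue_character[OF p(1) q p(2)] by blast
  have ip: "prime (int p)" using p(1) by simp
  have "[\<chi> (1 * 1) = \<chi> 1 + \<chi> 1] (mod int q)"
    by (rule \<chi>(1)) (use prime_gt_1_nat[OF p(1)] in auto)
  then have one: "[\<chi> 1 = 0] (mod int q)" using cong_diff[OF _ cong_refl, of "\<chi> 1" "\<chi> 1 + \<chi> 1" "int q" "\<chi> 1"] by (simp add: cong_sym)
  have pw: "[\<chi> (x ^ k) = int k * \<chi> x] (mod int q)" if x: "\<not> int p dvd x" for x k
  proof (induction k)
    case (Suc k)
    have "[\<chi> (x * x ^ k) = \<chi> x + \<chi> (x ^ k)] (mod int q)"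
      by (rule \<chi>(1)[OF x prime_power_not_dvd[OF p(1) x]])
    also have "[\<chi> x + \<chi> (x ^ k) = \<chi> x + int k * \<chi> x] (mod int q)" by (intro cong_add cong_refl Suc)
    finally show ?case by (simp add: algebra_simps)
  qed (use one in simp)
  have nd: "\<not> int p dvd int (ps ! i)" if "i < length ps" for i
    using that ps[of "ps ! i"] p(1,3) by (metis int_dvd_int_iff nth_mem primes_dvd_imp_eq)
  have pr: "\<not> int p dvd (\<Prod>i<m. int (ps ! i) ^ nat (v i)) \<and>
      [\<chi> (\<Prod>i<m. int (ps ! i) ^ nat (v i)) = (\<Sum>i<m. int (nat (v i)) * \<chi> (int (ps ! i)))] (mod int q)"
    if "m \<le> length ps" for m and v :: "nat \<Rightarrow> int"
    using that
  proof (induction m)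
    case 0 then show ?case using one prime_gt_1_nat[OF p(1)] by simp
  next
    case (Suc m)
    let ?P = "\<Prod>i<m. int (ps ! i) ^ nat (v i)" and ?x = "int (ps ! m) ^ nat (v m)"
    have IH: "\<not> int p dvd ?P" "[\<chi> ?P = (\<Sum>i<m. int (nat (v i)) * \<chi> (int (ps ! i)))] (mod int q)"
      using Suc by auto
    have x: "\<not> int p dvd ?x" using Suc.prems by (intro prime_power_not_dvd[OF p(1)] nd) simp
    have "[\<chi> (?P * ?x) = \<chi> ?P + \<chi> ?x] (mod int q)" by (rule \<chi>(1)[OF IH(1) x])
    also have "[\<chi> ?P + \<chi> ?x = (\<Sum>i<m. int (nat (v i)) * \<chi> (int (ps ! i))) + int (nat (v m)) * \<chi> (int (ps ! m))] (mod int q)"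
      using Suc.prems by (intro cong_add IH(2) pw nd) simp
    finally show ?case using IH(1) x ip by (simp add: prime_dvd_mult_iff)
  qed
  show thesis
  proof (rule that[of "\<lambda>i. \<chi> (int (ps ! i))"])
    fix v assume v: "v \<in> vecs (length ps) q"
    have "v i \<ge> 0" if "i < length ps" for i
      using vecs_memD[OF v prime_gt_0_nat[OF q] that] by simp
    then have "(\<Sum>i<length ps. int (nat (v i)) * \<chi> (int (ps ! i))) = form (length ps) (\<lambda>i. \<chi> (int (ps ! i))) v"
      unfolding form_def by (intro sum.cong) (auto simp: mult.commute)
    moreover have "(\<Prod>i<length ps. int (ps ! i) ^ nat (v i)) = int (monomial ps v)" by (simp add: monomial_def)
    ultimately show "power_residue q p (int (monomial ps v)) \<longleftrightarrow> int q dvd form (length ps) (\<lambda>i. \<chi> (int (ps ! i))) v"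
      using pr[OF le_refl, of v] \<chi>(2)[of "int (monomial ps v)"] by (simp add: cong_dvd_iff)
  qed
qed

lemma zero_vec_vecs: "q > 0 \<Longrightarrow> zero_vec n q \<in> vecs n q"
  by (auto simp: vecs_eq zero_vec_def residue_ring_def)

lemma form_zero_vec: "form n b (zero_vec n q) = 0"
  by (simp add: form_def zero_vec_def residue_ring_def)

text \<open>Suppose that the kernel \<open>K\<close> of the form is not the kernel \<open>H p\<close> of the residue form for any large prime
  \<open>p \<equiv> 1 (mod q)\<close>. The weight \<open>w v p\<close> of a vector is the number of roots of \<open>x\<^sup>q - m\<close> modulo \<open>p\<close> minus \<open>1\<close>, where
  \<open>m\<close> is the monomial of \<open>v\<close>; its average is \<open>0\<close> for every \<open>v \<noteq> 0\<close>. The combination \<open>F\<close> of the weights would be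
  at most \<open>0\<close> at every large prime, although its average is that of \<open>(q - 1) * w 0\<close>, which is positive.\<close>

theorem ex_prime_with_residue_kernel:
  assumes ps: "distinct ps" "\<And>p. p \<in> set ps \<Longrightarrow> prime p" and q: "prime q"
    and b: "i0 < length ps" "\<not> int q dvd b i0"
  obtains p where "prime p" "p > M" "q dvd p - 1"
    "\<And>v. v \<in> vecs (length ps) q \<Longrightarrow>
       power_residue q p (int (monomial ps v)) \<longleftrightarrow> int q dvd form (length ps) b v"
proof (rule ccontr)
  let ?n = "length ps"
  let ?V = "vecs ?n q"
  let ?K = "{v \<in> ?V. int q dvd form ?n b v}"
  let ?z = "zero_vec ?n q"
  assume no: "\<not> thesis"
  note goal = that
  have q0: "q > 0" and q1: "q > 1" using prime_gt_0_nat[OF q] prime_gt_1_nat[OF q] .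
  have fV: "finite ?V" by (rule finite_vecs[OF q0])
  have w0: "\<exists>w0\<in>?V. \<not> int q dvd form ?n b w0"
  proof
    let ?w = "\<lambda>i\<in>{..<?n}. if i = i0 then 1 else 0 :: int"
    show "?w \<in> ?V" using q1 by (auto simp: vecs_eq)
    have "form ?n b ?w = (\<Sum>i<?n. if i = i0 then b i else 0)" unfolding form_def by (intro sum.cong) auto
    also have "\<dots> = b i0" using b(1) sum.delta[of "{..<?n}" i0 b] by simp
    finally show "\<not> int q dvd form ?n b ?w" using b(2) by simp
  qed
  define H where "H p = {v \<in> ?V. power_residue q p (int (monomial ps v))}" for p
  define w where "w v p = (if q dvd p - 1 then (if v \<in> H p then real q - 1 else -1) else 0)" for v p
  \<comment> \<open>Beyond \<open>M'\<close> no prime divides any of the monomials.\<close>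
  define M' where "M' = Max (insert M (set ps))"
  have M': "M \<le> M'" "\<And>p. p \<in> set ps \<Longrightarrow> p \<le> M'" unfolding M'_def by auto
  have mono_nd: "\<not> p dvd monomial ps v" if p: "prime p" "p > M'" for p v
  proof
    assume "p dvd monomial ps v"
    then obtain i where "i < ?n" "p dvd ps ! i ^ nat (v i)"
      unfolding monomial_def using p(1) by (auto simp: prime_dvd_prod_iff)
    then have "p dvd ps ! i" using p(1) prime_dvd_power by blast
    then have "p = ps ! i" using p(1) ps(2) \<open>i < ?n\<close> by (metis nth_mem primes_dvd_imp_eq)
    then show False using M'(2)[of p] p(2) \<open>i < ?n\<close> by simp
  qed
  have lim0: "(\<lambda>n. log_sum (w v) n / ln n) \<longlonglongrightarrow> 0" if v: "v \<in> ?V - {?z}" for v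
  proof -
    have irr: "monic_irreducible (pure q (monomial ps v))"
      by (rule pure_irreducible[OF q monomial_pos[OF ps(2)] monomial_not_power[OF ps q]]) (use v in auto)
    have "(\<lambda>n. log_sum (\<lambda>p. real (root_count (pure q (monomial ps v)) p)) n / ln n - log_sum (\<lambda>p. 1) n / ln n) \<longlonglongrightarrow> 1 - 1"
      by (intro tendsto_diff root_count_average[OF irr] log_sum_one)
    then have lim: "(\<lambda>n. log_sum (\<lambda>p. real (root_count (pure q (monomial ps v)) p) - 1) n / ln n) \<longlonglongrightarrow> 0"
      by (simp add: log_sum_diff diff_divide_distrib)
    show ?thesis
    proof (rule log_sum_ignore_finite[OF _ lim])
      fix p assume p: "prime p" "p > M'"
      show "real (root_count (pure q (monomial ps v)) p) - 1 = w v p"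
      proof (cases "q dvd p - 1")
        case True
        then show ?thesis using root_count_split[OF p(1) q mono_nd[OF p] True] v q0 by (simp add: w_def H_def)
      next
        case False
        then show ?thesis using root_count_inert[OF p(1) q mono_nd[OF p] False] by (simp add: w_def)
      qed
    qed
  qed
  \<comment> \<open>By orthogonality, \<open>F p\<close> is \<open>q ^ n * (q - 1)\<close> if \<open>p \<equiv> 1 (mod q)\<close> and \<open>H p = K\<close>, and \<open>0\<close> for all other
    large \<open>p\<close>.\<close>
  define F where "F p = real q * (\<Sum>v\<in>?K. w v p) - (\<Sum>v\<in>?V. w v p)" for p
  have Fle: "F p \<le> 0" if p: "prime p" "p > M'" for p
  proof (cases "q dvd p - 1")
    case True
    have "p \<notin> set ps" using M'(2) p(2) by fastforce
    then obtain a where a: "\<And>v. v \<in> ?V \<Longrightarrow> power_residue q p (int (monomial ps v)) \<longleftrightarrow> int q dvd form ?n a v"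
      using monomial_residue_form[OF ps(2) q p(1) True] by blast
    have Ha: "H p = {v \<in> ?V. int q dvd form ?n a v}" unfolding H_def using a by blast
    have "H p \<noteq> ?K"
    proof
      assume "H p = ?K"
      then have "power_residue q p (int (monomial ps v)) \<longleftrightarrow> int q dvd form ?n b v" if "v \<in> ?V" for v
        using that unfolding H_def by blast
      moreover have "p > M" using p(2) M'(1) by simp
      ultimately show False using no goal[OF p(1) _ True] by blast
    qed
    then have ne: "{v \<in> ?V. int q dvd form ?n a v} \<noteq> ?K" unfolding Ha .
    obtain w1 where w1: "w1 \<in> ?V" "\<not> int q dvd form ?n b w1" using w0 by blast
    note kc = kernel_count[OF q w1 ne]
    have sw: "(\<Sum>v\<in>A. w v p) = real q * real (card (A \<inter> H p)) - real (card A)" if A: "A \<subseteq> ?V" for A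
    proof -
      have fA: "finite A" using A fV by (rule finite_subset)
      have "(\<Sum>v\<in>A. w v p) = (\<Sum>v\<in>A. (if v \<in> H p then real q else 0) - 1)"
        using True by (intro sum.cong) (auto simp: w_def)
      also have "\<dots> = (\<Sum>v\<in>A. if v \<in> H p then real q else 0) - real (card A)" by (simp add: sum_subtractf)
      also have "(\<Sum>v\<in>A. if v \<in> H p then real q else 0) = real q * real (card (A \<inter> H p))"
        using fA by (simp add: sum.If_cases)
      finally show ?thesis .
    qed
    have i1: "?K \<inter> H p = {v \<in> ?V. int q dvd form ?n a v \<and> int q dvd form ?n b v}" unfolding Ha by blast
    have i2: "?V \<inter> H p = {v \<in> ?V. int q dvd form ?n a v}" unfolding Ha by blast
    have "real q * real (card (?K \<inter> H p)) \<le> real (card (?V \<inter> H p))"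
      unfolding i1 i2 of_nat_mult[symmetric] of_nat_le_iff by (rule kc(1))
    then have "real q * (real q * real (card (?K \<inter> H p))) \<le> real q * real (card (?V \<inter> H p))"
      by (rule mult_left_mono) simp
    moreover have "real (card ?V) = real q * real (card ?K)" using kc(2) by simp
    moreover have "(\<Sum>v\<in>?K. w v p) = real q * real (card (?K \<inter> H p)) - real (card ?K)" by (rule sw) blast
    moreover have "(\<Sum>v\<in>?V. w v p) = real q * real (card (?V \<inter> H p)) - real (card ?V)" by (rule sw) blast
    ultimately show ?thesis unfolding F_def by (simp only: right_diff_distrib)
  next
    case False
    then show ?thesis by (simp add: F_def w_def)
  qed
  obtain K0 where K0: "\<And>n. log_sum F n \<le> K0" using log_sum_le_const[of M' F] Fle by blast
  have zK: "?z \<in> ?K" using zero_vec_vecs[OF q0] form_zero_vec by simp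
  have fK: "finite ?K" using fV by simp
  define G where "G n = real q * (\<Sum>v\<in>?K - {?z}. log_sum (w v) n) - (\<Sum>v\<in>?V - {?z}. log_sum (w v) n)" for n
  have FG: "log_sum F n = (real q - 1) * log_sum (w ?z) n + G n" for n
  proof -
    have "log_sum F n = real q * (\<Sum>v\<in>?K. log_sum (w v) n) - (\<Sum>v\<in>?V. log_sum (w v) n)"
      unfolding F_def log_sum_diff log_sum_mult log_sum_sum ..
    also have "(\<Sum>v\<in>?K. log_sum (w v) n) = log_sum (w ?z) n + (\<Sum>v\<in>?K - {?z}. log_sum (w v) n)"
      using fK zK by (rule sum.remove)
    also have "(\<Sum>v\<in>?V. log_sum (w v) n) = log_sum (w ?z) n + (\<Sum>v\<in>?V - {?z}. log_sum (w v) n)"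
      using fV zero_vec_vecs[OF q0] by (rule sum.remove)
    finally show ?thesis by (simp add: G_def algebra_simps)
  qed
  have "(\<lambda>n. real q * (\<Sum>v\<in>?K - {?z}. log_sum (w v) n / ln n) - (\<Sum>v\<in>?V - {?z}. log_sum (w v) n / ln n)) \<longlonglongrightarrow>
     real q * (\<Sum>v\<in>?K - {?z}. 0) - (\<Sum>v\<in>?V - {?z}. 0)"
    by (intro tendsto_diff tendsto_mult tendsto_const tendsto_sum lim0) auto
  moreover have "G n / ln n = real q * (\<Sum>v\<in>?K - {?z}. log_sum (w v) n / ln n) -
      (\<Sum>v\<in>?V - {?z}. log_sum (w v) n / ln n)" for n
    by (simp only: G_def diff_divide_distrib times_divide_eq_right[symmetric] sum_divide_distrib)
  ultimately have "(\<lambda>n. G n / ln n) \<longlonglongrightarrow> 0" by simp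
  then have evG: "\<forall>\<^sub>F n in sequentially. G n / ln n > - (1/8)" by (rule order_tendstoD(1)) simp
  have z1: "log_sum (w ?z) n = (real q - 1) * log_sum (\<lambda>p. if q dvd p - 1 then 1 else 0) n" for n
  proof -
    have "monomial ps ?z = 1" by (simp add: monomial_def zero_vec_def residue_ring_def)
    then have "?z \<in> H p" for p unfolding H_def power_residue_def
      using zero_vec_vecs[OF q0] by (auto intro!: exI[of _ 1])
    then show ?thesis unfolding log_sum_mult[symmetric] w_def
      by (intro arg_cong2[of _ _ _ _ log_sum]) auto
  qed
  have "\<forall>\<^sub>F n in sequentially. ln (real n) \<ge> max 1 (4 * K0)"
    using ln_real_at_top by (simp only: filterlim_at_top)
  then have "\<forall>\<^sub>F n in sequentially. False"
    using evG log_sum_primes_1_mod[OF q]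
  proof eventually_elim
    case (elim n)
    have l: "ln (real n) \<ge> 1" "4 * K0 \<le> ln (real n)" using elim(1) by auto
    have g: "G n > - (1/8) * ln (real n)" using elim(2) l(1) by (simp add: field_simps)
    have z: "log_sum (w ?z) n \<ge> ln (real n) / 2" unfolding z1 by (rule elim(3))
    have "1 * (ln (real n) / 2) \<le> (real q - 1) * log_sum (w ?z) n"
      using z l(1) q1 by (intro mult_mono) auto
    then show False using FG[of n] K0[of n] g l by simp
  qed
  then show False by simp
qed

section \<open>Powers modulo composite numbers and exponent vectors\<close>

lemma Fq_finsum:
  fixes n :: nat
  assumes q: "prime q" and f: "\<And>i. i < n \<Longrightarrow> f i \<in> carrier (Fq q)"
  shows "finsum (Fq q) f {..<n} = (\<Sum>i<n. f i) mod int q"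
proof -
  have q1: "int q > 1" using prime_gt_1_nat[OF q] by simp
  interpret residues "int q" "Fq q" using q1 by unfold_locales auto
  show ?thesis using f
  proof (induction n)
    case 0
    have "finsum (Fq q) f {..<0} = \<zero>\<^bsub>Fq q\<^esub>" by simp
    then show ?case by (simp add: residue_ring_def)
  next
    case (Suc n)
    have "finsum (Fq q) f {..<Suc n} = f n \<oplus>\<^bsub>Fq q\<^esub> finsum (Fq q) f {..<n}"
      unfolding lessThan_Suc using Suc.prems by (intro finsum_insert) auto
    also have "\<dots> = (\<Sum>i<Suc n. f i) mod int q"
      using Suc by (simp add: residue_ring_def mod_add_right_eq add.commute)
    finally show ?case .
  qed
qed

lemma mat_vec_eq:
  assumes q: "prime q" and i: "i < n"
  shows "mat_vec n q A v i = (\<Sum>j<n. A i j * v j) mod int q"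
proof -
  have q0: "q > 0" using prime_gt_0_nat[OF q] .
  have m: "x \<otimes>\<^bsub>Fq q\<^esub> y = (x * y) mod int q" for x y by (simp add: residue_ring_def)
  have "mat_vec n q A v i = finsum (Fq q) (\<lambda>j. (A i j * v j) mod int q) {..<n}"
    using i unfolding mat_vec_def m by simp
  also have "\<dots> = (\<Sum>j<n. (A i j * v j) mod int q) mod int q"
    by (rule Fq_finsum[OF q]) (use q0 carrier_Fq[OF q0] in simp)
  finally have "mat_vec n q A v i = (\<Sum>j<n. (A i j * v j) mod int q) mod int q" .
  then show ?thesis by (simp add: mod_sum_eq)
qed

lemma scale_vec_eq: "i < n \<Longrightarrow> scale_vec n q c v i = (c * v i) mod int q"
  by (simp add: scale_vec_def residue_ring_def)

definition pullback :: "nat \<Rightarrow> (nat \<Rightarrow> nat \<Rightarrow> int) \<Rightarrow> (nat \<Rightarrow> int) \<Rightarrow> nat \<Rightarrow> int" where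
  "pullback n A a j = (\<Sum>i<n. a i * A i j)"

lemma form_mat_vec:
  assumes q: "prime q"
  shows "[form n a (mat_vec n q A (scale_vec n q c v)) = c * form n (pullback n A a) v] (mod int q)"
proof -
  have "form n a (mat_vec n q A (scale_vec n q c v)) =
     (\<Sum>i<n. a i * ((\<Sum>j<n. A i j * ((c * v j) mod int q)) mod int q))"
    unfolding form_def by (intro sum.cong refl) (simp add: mat_vec_eq[OF q] scale_vec_eq)
  also have "[\<dots> = (\<Sum>i<n. a i * (\<Sum>j<n. A i j * (c * v j)))] (mod int q)"
  proof (intro cong_sum cong_scalar_left)
    fix i
    have "[(\<Sum>j<n. A i j * ((c * v j) mod int q)) = (\<Sum>j<n. A i j * (c * v j))] (mod int q)"
      by (intro cong_sum cong_scalar_left) (simp add: cong_def)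
    then show "[(\<Sum>j<n. A i j * ((c * v j) mod int q)) mod int q = (\<Sum>j<n. A i j * (c * v j))] (mod int q)"
      by (simp add: cong_def)
  qed
  also have "(\<Sum>i<n. a i * (\<Sum>j<n. A i j * (c * v j))) = (\<Sum>i<n. \<Sum>j<n. c * (a i * A i j * v j))"
    by (simp add: sum_distrib_left mult_ac)
  also have "\<dots> = (\<Sum>j<n. \<Sum>i<n. c * (a i * A i j * v j))" by (rule sum.swap)
  also have "\<dots> = c * form n (pullback n A a) v"
    by (simp add: form_def pullback_def sum_distrib_left sum_distrib_right)
  finally show ?thesis .
qed

lemma self_in_point:
  assumes q: "prime q" and v: "v \<in> vecs n q" shows "v \<in> point n q v"
proof -
  have q1: "q > 1" "q > 0" using prime_gt_1_nat[OF q] by auto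
  have "v i = scale_vec n q 1 v i" for i
  proof (cases "i < n")
    case True
    then show ?thesis using vecs_memD[OF v q1(2) True] by (simp add: scale_vec_eq)
  next
    case False
    have "v \<in> {..<n} \<rightarrow>\<^sub>E {0..<int q}" using v vecs_eq[OF q1(2)] by blast
    then have "v i = undefined" by (rule PiE_arb) (use False in simp)
    then show ?thesis using False by (simp add: scale_vec_def)
  qed
  then have "v = scale_vec n q 1 v" by blast
  moreover have "1 \<in> carrier (Fq q)" using carrier_Fq[OF q1(2)] q1(1) by simp
  ultimately show ?thesis unfolding point_def by blast
qed

text \<open>Hensel lifting: the derivative \<open>q * x ^ (q - 1)\<close> is a unit modulo \<open>p\<close>.\<close>

lemma power_residue_prime_power:
  assumes p: "prime p" "p \<noteq> q" and q: "prime q" and t: "\<not> int p dvd t" and r: "power_residue q p t"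
  shows "power_residue q (p ^ j) t"
proof (cases "j = 0")
  case True then show ?thesis by (simp add: power_residue_def)
next
  case False
  then have "j \<ge> 1" by simp
  then show ?thesis
  proof (induction j rule: dec_induct)
    case base then show ?case using r by simp
  next
    case (step j)
    then obtain x where x: "[x ^ q = t] (mod int p ^ j)" by (auto simp: power_residue_def)
    have q0: "q > 0" using prime_gt_0_nat[OF q] .
    have "[x ^ q = t] (mod int p)" using x step by (metis cong_dvd_modulus dvd_power less_le_trans zero_less_one)
    then have "\<not> int p dvd x ^ q" using t by (metis cong_dvd_iff)
    then have nx: "\<not> int p dvd x" using q0 by (metis dvd_power dvd_trans)
    obtain e where e: "x ^ q - t = int p ^ j * e" using x by (auto simp: cong_iff_dvd_diff)
    have "\<not> int p dvd int q * x ^ (q - 1)"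
    proof
      assume "int p dvd int q * x ^ (q - 1)"
      then have "int p dvd int q" using prime_power_not_dvd[OF p(1) nx] p(1)
        by (metis prime_dvd_multD prime_nat_int_transfer)
      then show False using p q by (metis int_dvd_int_iff primes_dvd_imp_eq)
    qed
    then have "coprime (int q * x ^ (q - 1)) (int p)" using p(1) by (metis coprime_commute prime_imp_coprime prime_nat_int_transfer)
    then obtain u where u: "[(int q * x ^ (q - 1)) * u = 1] (mod int p)" using cong_solve_coprime_int by blast
    define y where "y = - (e * u)"
    obtain h where h: "poly (monom 1 q) (x + int p ^ j * y) = poly (monom 1 q) x
        + (int p ^ j * y) * poly (pderiv (monom 1 q)) x + (int p ^ j * y)\<^sup>2 * h"
      using poly_taylor2 by blast
    then have "(x + int p ^ j * y) ^ q - t = int p ^ j * (e + y * (int q * x ^ (q - 1))) + int p ^ (2 * j) * (y\<^sup>2 * h)"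
      using e by (simp add: poly_monom pderiv_monom power_mult_distrib power_mult[symmetric] algebra_simps mult.commute[of 2])
    moreover have "int p ^ Suc j dvd int p ^ j * (e + y * (int q * x ^ (q - 1)))"
    proof -
      have "[e + y * (int q * x ^ (q - 1)) = e - e * (int q * x ^ (q - 1) * u)] (mod int p)"
        by (simp add: y_def algebra_simps)
      also have "[e - e * (int q * x ^ (q - 1) * u) = e - e * 1] (mod int p)"
        by (intro cong_diff cong_refl cong_scalar_left u)
      finally have "int p dvd e + y * (int q * x ^ (q - 1))" by (simp add: cong_0_iff)
      then show ?thesis by (simp add: mult.commute mult_dvd_mono)
    qed
    moreover have "int p ^ Suc j dvd int p ^ (2 * j) * (y\<^sup>2 * h)"
      using step by (intro dvd_mult2 le_imp_power_dvd) simp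
    ultimately have "int p ^ Suc j dvd (x + int p ^ j * y) ^ q - t" by simp
    then show ?case unfolding power_residue_def by (auto simp: cong_iff_dvd_diff)
  qed
qed

text \<open>By the Chinese remainder theorem.\<close>

lemma power_residue_composite:
  assumes "N > 0" "\<And>p j. prime p \<Longrightarrow> p dvd N \<Longrightarrow> power_residue q (p ^ j) t"
  shows "power_residue q N t"
  using assms
proof (induction N rule: less_induct)
  case (less N)
  show ?case
  proof (cases "N = 1")
    case True then show ?thesis by (simp add: power_residue_def)
  next
    case False
    then obtain p where p: "prime p" "p dvd N" using prime_factor_nat by blast
    obtain M where M: "N = p ^ multiplicity p N * M" "\<not> p dvd M"
      by (rule multiplicity_decompose'[of N p]) (use less.prems(1) prime_gt_1_nat[OF p(1)] in auto)
    define j where "j = multiplicity p N"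
    have NM: "N = p ^ j * M" using M(1) by (simp add: j_def)
    have j: "j > 0" using NM M(2) p(2) by (cases j) auto
    have M0: "M > 0" using NM less.prems(1) by (cases M) auto
    have "p ^ j > 1" using one_less_power[OF prime_gt_1_nat[OF p(1)] j] .
    then have "M < N" using NM M0 by simp
    then have "power_residue q M t" using less M0 NM by (metis dvd_mult)
    then obtain y where y: "[y ^ q = t] (mod int M)" by (auto simp: power_residue_def)
    obtain x where x: "[x ^ q = t] (mod int (p ^ j))" using less.prems(2)[OF p, of j] by (auto simp: power_residue_def)
    have cop: "coprime (int (p ^ j)) (int M)" using M(2) p(1) by (simp add: prime_imp_coprime)
    obtain w where w: "[w = x] (mod int (p ^ j))" "[w = y] (mod int M)"
      using binary_chinese_remainder_int[OF cop] by blast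
    have "[w ^ q = t] (mod int (p ^ j))" "[w ^ q = t] (mod int M)"
      using cong_trans[OF cong_pow[OF w(1)] x] cong_trans[OF cong_pow[OF w(2)] y] by auto
    then have "[w ^ q = t] (mod int (p ^ j) * int M)"
      unfolding cong_iff_dvd_diff using cop by (rule divides_mult)
    then show ?thesis unfolding power_residue_def NM by auto
  qed
qed

lemma rad_pos: "rad q n > 0"
  unfolding rad_def by (intro prod_pos) (auto simp: prime_factors_dvd prime_gt_0_nat in_prime_factors_iff)

lemma multiplicity_rad:
  assumes p: "prime p" and n: "n > 0"
  shows "multiplicity p (rad q n) = multiplicity p n mod q"
proof -
  have pr: "prime x" if "x \<in> prime_factors n" for x using that by (simp add: in_prime_factors_iff)
  have "multiplicity p (rad q n) = (\<Sum>x\<in>prime_factors n. multiplicity p (x ^ (multiplicity x n mod q)))"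
    unfolding rad_def
    by (subst prime_elem_multiplicity_prod_distrib) (use pr p in \<open>auto simp: prime_gt_0_nat image_iff\<close>)
  also have "\<dots> = (\<Sum>x\<in>prime_factors n. if x = p then multiplicity x n mod q else 0)"
  proof (intro sum.cong refl)
    fix x assume x: "x \<in> prime_factors n"
    show "multiplicity p (x ^ (multiplicity x n mod q)) = (if x = p then multiplicity x n mod q else 0)"
    proof (cases "x = p")
      case True then show ?thesis using p by (simp add: multiplicity_same_power prime_gt_0_nat)
    next
      case False
      then have "\<not> p dvd x ^ (multiplicity x n mod q)" using pr[OF x] p
        by (metis prime_dvd_power primes_dvd_imp_eq)
      then show ?thesis using False by (simp add: not_dvd_imp_multiplicity_0)
    qed
  qed
  also have "\<dots> = (if p \<in> prime_factors n then multiplicity p n mod q else 0)"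
    using sum.delta[of "prime_factors n" p "\<lambda>x. multiplicity x n mod q"] by simp
  also have "\<dots> = multiplicity p n mod q"
    using p n by (auto simp: in_prime_factors_iff not_dvd_imp_multiplicity_0)
  finally show ?thesis .
qed

text \<open>All multiplicities of \<open>n div m\<close> are divisible by \<open>q\<close>.\<close>

lemma nat_eq_mult_power:
  fixes m n :: nat
  assumes q: "q > 0" and n: "n > 0" and m: "m > 0"
    and eq: "\<And>p. prime p \<Longrightarrow> multiplicity p m = multiplicity p n mod q"
  shows "\<exists>y>0. n = m * y ^ q"
proof -
  have le: "multiplicity p m \<le> multiplicity p n" if "prime p" for p using eq[OF that] by simp
  then have "m dvd n" using n m by (intro multiplicity_le_imp_dvd) auto
  then obtain k where k: "n = m * k" by blast
  have k0: "k > 0" using k n by (cases k) auto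
  have "q dvd multiplicity p k" if p: "prime p" for p
  proof -
    have "multiplicity p n = multiplicity p m + multiplicity p k"
      unfolding k using p m k0 by (intro prime_elem_multiplicity_mult_distrib) auto
    then have "multiplicity p k = multiplicity p n - multiplicity p n mod q" using eq[OF p] by simp
    then show ?thesis by (simp add: minus_mod_eq_mult_div)
  qed
  then have "is_nth_power q k" using is_nth_power_conv_multiplicity_nat[OF q] by blast
  then obtain y where y: "k = y ^ q" by (auto elim: is_nth_powerE)
  then have "y > 0" using k0 q by (cases y) auto
  then show ?thesis using k y by blast
qed

lemma rad_primes_props:
  assumes "finite S" "finite T"
  shows "distinct (rad_primes q S T)" "\<And>p. p \<in> set (rad_primes q S T) \<Longrightarrow> prime p"
    "\<And>s p. s \<in> S \<union> T \<Longrightarrow> prime p \<Longrightarrow> p dvd rad q (nat \<bar>s\<bar>) \<Longrightarrow> p \<in> set (rad_primes q S T)"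
proof -
  let ?P = "(\<Prod>s\<in>S. rad q (nat \<bar>s\<bar>)) * (\<Prod>t\<in>T. rad q (nat \<bar>t\<bar>))"
  have P0: "?P > 0" using rad_pos by (simp add: prod_pos)
  show "distinct (rad_primes q S T)" by (simp add: rad_primes_def)
  show "prime p" if "p \<in> set (rad_primes q S T)" for p
    using that by (simp add: rad_primes_def in_prime_factors_iff)
  fix s p assume s: "s \<in> S \<union> T" and p: "prime p" "p dvd rad q (nat \<bar>s\<bar>)"
  have "p dvd ?P"
  proof (cases "s \<in> S")
    case True
    then have "rad q (nat \<bar>s\<bar>) dvd (\<Prod>s\<in>S. rad q (nat \<bar>s\<bar>))" using assms(1) by (rule dvd_prodI[rotated])
    then show ?thesis using p(2) by (meson dvd_mult2 dvd_trans)
  next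
    case False
    then have "s \<in> T" using s by simp
    then have "rad q (nat \<bar>s\<bar>) dvd (\<Prod>s\<in>T. rad q (nat \<bar>s\<bar>))" using assms(2) by (rule dvd_prodI[rotated])
    then show ?thesis using p(2) by (meson dvd_mult dvd_trans)
  qed
  then show "p \<in> set (rad_primes q S T)" using p(1) P0 by (simp add: rad_primes_def in_prime_factors_iff)
qed

lemma exponent_vec_vecs: "q > 0 \<Longrightarrow> exponent_vec q ps s \<in> vecs (length ps) q"
  by (auto simp: vecs_eq exponent_vec_def)

text \<open>Up to a \<open>q\<close>-th power, an integer is the monomial of its exponent vector. For odd \<open>q\<close> the sign is
  a \<open>q\<close>-th power too.\<close>

lemma eq_monomial_times_power:
  assumes ps: "distinct ps" "\<And>p. p \<in> set ps \<Longrightarrow> prime p" and q: "prime q" "odd q" and s: "s \<noteq> 0"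
    and cov: "\<And>p. prime p \<Longrightarrow> p dvd rad q (nat \<bar>s\<bar>) \<Longrightarrow> p \<in> set ps"
  shows "\<exists>y::int. y \<noteq> 0 \<and> s = int (monomial ps (exponent_vec q ps s)) * y ^ q"
proof -
  let ?n = "nat \<bar>s\<bar>" and ?m = "monomial ps (exponent_vec q ps s)"
  have q0: "q > 0" using prime_gt_0_nat[OF q(1)] .
  have n0: "?n > 0" using s by simp
  have "multiplicity p ?m = multiplicity p ?n mod q" if p: "prime p" for p
  proof (cases "p \<in> set ps")
    case True
    then obtain i where i: "i < length ps" "p = ps ! i" by (auto simp: in_set_conv_nth)
    have "multiplicity p ?m = nat (exponent_vec q ps s i)"
      unfolding i(2) by (rule multiplicity_monomial[OF ps i(1)])
    also have "\<dots> = multiplicity p (rad q ?n) mod q"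
      using i by (simp add: exponent_vec_def zmod_int[symmetric])
    also have "\<dots> = multiplicity p ?n mod q" unfolding multiplicity_rad[OF p n0] by simp
    finally show ?thesis .
  next
    case False
    then have "\<not> p dvd rad q ?n" using cov p by blast
    then have "multiplicity p ?n mod q = 0" using multiplicity_rad[OF p n0, of q] not_dvd_imp_multiplicity_0 by metis
    moreover have "\<not> p dvd ?m"
    proof
      assume "p dvd ?m"
      then obtain i where "i < length ps" "p dvd ps ! i ^ nat (exponent_vec q ps s i)"
        unfolding monomial_def using p by (auto simp: prime_dvd_prod_iff)
      then have "p = ps ! i" using p ps(2) by (metis nth_mem prime_dvd_power primes_dvd_imp_eq)
      then show False using False \<open>i < length ps\<close> by simp
    qed
    ultimately show ?thesis by (simp add: not_dvd_imp_multiplicity_0)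
  qed
  then obtain y where y: "y > 0" "?n = ?m * y ^ q"
    using nat_eq_mult_power[OF q0 n0 monomial_pos[OF ps(2)]] by blast
  have "\<bar>s\<bar> = int ?n" by simp
  also have "\<dots> = int ?m * int y ^ q" using y(2) by (metis of_nat_mult of_nat_power)
  finally have a: "\<bar>s\<bar> = int ?m * int y ^ q" .
  show ?thesis
  proof (cases "s > 0")
    case True then show ?thesis using a y(1) by (intro exI[of _ "int y"]) auto
  next
    case False
    then have "s = int ?m * (- int y) ^ q" using a q(2) by (simp add: power_minus_odd)
    then show ?thesis using y(1) by (intro exI[of _ "- int y"]) auto
  qed
qed

lemma power_residue_times_power:
  assumes p: "prime p" and q: "q > 0" and y: "\<not> int p dvd y"
  shows "power_residue q p (m * y ^ q) \<longleftrightarrow> power_residue q p m"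
proof
  assume "power_residue q p m"
  then obtain x where "[x ^ q = m] (mod int p)" by (auto simp: power_residue_def)
  then have "[x ^ q * y ^ q = m * y ^ q] (mod int p)" by (rule cong_scalar_right)
  then show "power_residue q p (m * y ^ q)" unfolding power_residue_def power_mult_distrib[symmetric] by blast
next
  assume "power_residue q p (m * y ^ q)"
  then obtain x where x: "[x ^ q = m * y ^ q] (mod int p)" by (auto simp: power_residue_def)
  have "coprime y (int p)" using y p by (metis coprime_commute prime_imp_coprime prime_nat_int_transfer)
  then obtain u where u: "[y * u = 1] (mod int p)" using cong_solve_coprime_int by blast
  have "[(x * u) ^ q = (m * y ^ q) * u ^ q] (mod int p)" unfolding power_mult_distrib using x by (rule cong_scalar_right)
  also have "(m * y ^ q) * u ^ q = m * (y * u) ^ q" by (simp add: power_mult_distrib)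
  also have "[m * (y * u) ^ q = m * 1 ^ q] (mod int p)" by (intro cong_scalar_left cong_pow u)
  finally show "power_residue q p m" unfolding power_residue_def by auto
qed

section \<open>Invariance under geometric equivalence\<close>

lemma big_omega_prod_primes:
  assumes "finite A" "\<And>p. p \<in> A \<Longrightarrow> prime p"
  shows "big_omega (\<Prod>A) = card A"
  using assms
proof (induction A rule: finite_induct)
  case empty then show ?case by (simp add: big_omega_def)
next
  case (insert p A)
  have "0 \<notin> A" using insert.prems by (metis insertCI not_prime_0)
  then have "\<Prod>A \<noteq> 0" using insert.hyps by simp
  then have "prime_factorization (p * \<Prod>A) = prime_factorization p + prime_factorization (\<Prod>A)"
    using insert.prems[of p] by (intro prime_factorization_mult) auto
  then show ?case using insert by (simp add: big_omega_def prime_factorization_prime)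
qed

lemma card_prime_factors_le_big_omega: "card (prime_factors N) \<le> big_omega N"
proof -
  have "card (set_mset M) \<le> size M" for M :: "nat multiset"
    by (induction M) (auto simp: card_insert_if)
  then show ?thesis unfolding big_omega_def .
qed

lemma power_residue_dvd: "power_residue q N t \<Longrightarrow> M dvd N \<Longrightarrow> power_residue q M t"
  unfolding power_residue_def by (meson cong_dvd_modulus int_dvd_int_iff)

theorem proposition4p1:
  fixes q k :: nat and S T :: "int set"
  assumes "prime q" and "odd q" and "k \<ge> 1"
    and "finite S" and "0 \<notin> S" and "\<forall>s\<in>S. \<not> perfect_power q s"
    and "S \<in> power_sets k q"
    and "geometric_equivalent q S T"
  shows "T \<in> power_sets k q"
proof -
  note q = \<open>prime q\<close>
  have q0: "q > 0" using prime_gt_0_nat[OF q] .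
  define ps where "ps = rad_primes q S T"
  define n where "n = length ps"
  have T: "finite T" "0 \<notin> T"
    using assms(8) by (auto simp: geometric_equivalent_def power_free_set_def)
  note psp = rad_primes_props[OF assms(4) T(1), where q = q, folded ps_def]
  define vec where "vec = exponent_vec q ps"
  have vecs: "vec s \<in> vecs n q" for s unfolding vec_def n_def by (rule exponent_vec_vecs[OF q0])
  have factor: "\<exists>y::int. y \<noteq> 0 \<and> s = int (monomial ps (vec s)) * y ^ q" if "s \<in> S \<union> T" for s
    unfolding vec_def
    by (rule eq_monomial_times_power[OF psp(1,2) q assms(2) _ psp(3)[OF that]]) (use that assms(5) T(2) in auto)
  have residue_iff: "power_residue q p s \<longleftrightarrow> power_residue q p (int (monomial ps (vec s)))"
    if s: "s \<in> S \<union> T" and p: "prime p" "\<not> int p dvd s" for s p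
  proof -
    obtain y where y: "s = int (monomial ps (vec s)) * y ^ q" using factor[OF s] by blast
    then have "\<not> int p dvd y" using p(2) q0 by (metis dvd_mult dvd_power dvd_trans)
    then show ?thesis using power_residue_times_power[OF p(1) q0] y by metis
  qed
  obtain A where A: "(\<lambda>X\<in>PG n q. mat_vec n q A ` X) ` point_set q ps S = point_set q ps T"
    using assms(8) by (auto simp: geometric_equivalent_def Let_def PGL_def ps_def n_def)
  have image: "\<exists>t\<in>T. \<exists>c. vec t = mat_vec n q A (scale_vec n q c (vec s))" if s: "s \<in> S" for s
  proof -
    have "vec s \<noteq> zero_vec n q"
    proof
      assume z: "vec s = zero_vec n q"
      have "monomial ps (vec s) = 1" unfolding z by (simp add: monomial_def zero_vec_def residue_ring_def n_def)
      then obtain y :: int where "s = y ^ q" using factor[of s] s by auto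
      then have "perfect_power q s" unfolding perfect_power_def by (intro exI[of _ "of_int y"]) simp
      then show False using assms(6) s by blast
    qed
    then have PG: "point n q (vec s) \<in> PG n q" using vecs unfolding PG_def by blast
    have "point n q (vec s) \<in> point_set q ps S" using s unfolding point_set_def vec_def n_def by blast
    then have "mat_vec n q A ` point n q (vec s) \<in> point_set q ps T" using A PG by (metis image_eqI restrict_apply)
    then obtain t where t: "t \<in> T" "mat_vec n q A ` point n q (vec s) = point n q (vec t)"
      unfolding point_set_def vec_def n_def by blast
    then have "vec t \<in> mat_vec n q A ` point n q (vec s)" using self_in_point[OF q vecs] by blast
    then show ?thesis using t(1) unfolding point_def by blast
  qed
  obtain \<Delta> where \<Delta>: "\<Delta> > 0" "\<And>N. N > 0 \<Longrightarrow> big_omega N \<le> k \<Longrightarrow> coprime N \<Delta> \<Longrightarrow> contains_power_mod q S N"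
    using assms(7) by (auto simp: power_sets_def contains_power_mod_almost_all_def)
  \<comment> \<open>A prime larger than \<open>M\<close> divides neither \<open>\<Delta>\<close> nor any element of \<open>S\<close>.\<close>
  define M where "M = Max (insert \<Delta> ((\<lambda>s. nat \<bar>s\<bar>) ` S))"
  have M: "\<Delta> \<le> M" "\<And>s. s \<in> S \<Longrightarrow> nat \<bar>s\<bar> \<le> M" unfolding M_def using assms(4) by auto
  define \<Delta>' where "\<Delta>' = q * \<Prod>(set ps) * (\<Prod>t\<in>T. nat \<bar>t\<bar>)"
  have \<Delta>'0: "\<Delta>' > 0" unfolding \<Delta>'_def using q0 psp(2) T
    by (auto intro!: prod_pos simp: prime_gt_0_nat)
  have "contains_power_mod q T N" if N: "N > 0" "big_omega N \<le> k" "coprime N \<Delta>'" for N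
  proof -
    have outside: "p \<noteq> q \<and> p \<notin> set ps \<and> (\<forall>t\<in>T. \<not> int p dvd t)" if p: "prime p" "p dvd N" for p
    proof -
      have nd: "\<not> p dvd \<Delta>'" using N(3) p by (metis coprime_common_divisor not_prime_unit)
      have "p \<noteq> q" using nd by (auto simp: \<Delta>'_def)
      moreover have "p \<notin> set ps"
      proof
        assume "p \<in> set ps"
        then have "p dvd \<Prod>(set ps)" using dvd_prodI[of "set ps" p "\<lambda>x. x"] by simp
        then show False using nd by (auto simp: \<Delta>'_def)
      qed
      moreover have "\<not> int p dvd t" if t: "t \<in> T" for t
      proof
        assume "int p dvd t"
        then have "p dvd nat \<bar>t\<bar>" by (simp add: nat_dvd_iff)
        also have "nat \<bar>t\<bar> dvd (\<Prod>t\<in>T. nat \<bar>t\<bar>)" using T(1) t by (rule dvd_prodI)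
        finally show False using nd by (auto simp: \<Delta>'_def)
      qed
      ultimately show ?thesis by blast
    qed
    define P where "P = {p. prime p \<and> p dvd N \<and> q dvd p - 1}"
    have "\<exists>a. \<forall>v\<in>vecs n q. power_residue q p (int (monomial ps v)) \<longleftrightarrow> int q dvd form n a v" if "p \<in> P" for p
    proof -
      have p: "prime p" "q dvd p - 1" "p \<notin> set ps" using that outside by (auto simp: P_def)
      show ?thesis using monomial_residue_form[OF psp(2) q p] unfolding n_def by metis
    qed
    then obtain a where a: "\<And>p v. p \<in> P \<Longrightarrow> v \<in> vecs n q \<Longrightarrow>
        power_residue q p (int (monomial ps v)) \<longleftrightarrow> int q dvd form n (a p) v" by metis
    define b where "b p = pullback n A (a p)" for p
    \<comment> \<open>For the primes in \<open>P - P1\<close> the pulled back form is zero, so they impose no condition on \<open>S\<close>.\<close>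
    define P1 where "P1 = {p \<in> P. \<exists>i<n. \<not> int q dvd b p i}"
    have "\<exists>r. prime r \<and> r > M \<and> (\<forall>v\<in>vecs n q. power_residue q r (int (monomial ps v)) \<longleftrightarrow> int q dvd form n (b p) v)"
      if p: "p \<in> P1" for p
    proof -
      obtain i where i: "i < length ps" "\<not> int q dvd b p i" using p by (auto simp: P1_def n_def)
      obtain r where "prime r" "r > M"
        "\<And>v. v \<in> vecs (length ps) q \<Longrightarrow> power_residue q r (int (monomial ps v)) \<longleftrightarrow> int q dvd form (length ps) (b p) v"
        using ex_prime_with_residue_kernel[where b = "b p" and M = M, OF psp(1,2) q i] by metis
      then show ?thesis unfolding n_def by blast
    qed
    then obtain r where r: "\<And>p. p \<in> P1 \<Longrightarrow> prime (r p) \<and> r p > M \<and>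
        (\<forall>v\<in>vecs n q. power_residue q (r p) (int (monomial ps v)) \<longleftrightarrow> int q dvd form n (b p) v)" by metis
    have P1sub: "P1 \<subseteq> prime_factors N" using N(1) by (auto simp: P1_def P_def in_prime_factors_iff)
    have finP1: "finite P1" by (rule finite_subset[OF P1sub]) simp
    \<comment> \<open>A product over the set of the chosen primes, since \<open>r\<close> may take the same value twice; so \<open>N'\<close> is
      squarefree and has at most as many prime factors as \<open>N\<close>.\<close>
    define N' where "N' = \<Prod>(r ` P1)"
    have rp: "prime x" "x > M" if "x \<in> r ` P1" for x using that r by auto
    have "big_omega N' = card (r ` P1)" unfolding N'_def using finP1 rp by (intro big_omega_prod_primes) auto
    also have "\<dots> \<le> card P1" using finP1 by (rule card_image_le)
    also have "\<dots> \<le> card (prime_factors N)" by (rule card_mono[OF _ P1sub]) simp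
    also have "\<dots> \<le> k" using card_prime_factors_le_big_omega[of N] N(2) by linarith
    finally have om: "big_omega N' \<le> k" .
    have N'0: "N' > 0" unfolding N'_def using rp by (intro prod_pos) (auto simp: prime_gt_0_nat)
    have "coprime N' \<Delta>" unfolding N'_def
    proof (rule prod_coprime_left)
      fix x assume x: "x \<in> r ` P1"
      have "\<not> x dvd \<Delta>" using rp(2)[OF x] M(1) \<Delta>(1) by (auto dest: dvd_imp_le)
      then show "coprime x \<Delta>" using rp(1)[OF x] by (simp add: prime_imp_coprime)
    qed
    then have "contains_power_mod q S N'" using \<Delta>(2)[OF N'0 om] by blast
    then obtain s where s: "s \<in> S" "power_residue q N' s"
      by (auto simp: contains_power_mod_def power_residue_def)
    have bs: "int q dvd form n (b p) (vec s)" if p: "p \<in> P" for p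
    proof (cases "p \<in> P1")
      case True
      have "r p dvd N'" unfolding N'_def using finP1 True by (intro dvd_prodI) auto
      then have res: "power_residue q (r p) s" using s(2) power_residue_dvd by blast
      have "\<not> int (r p) dvd s"
      proof
        assume "int (r p) dvd s"
        then have "int (r p) \<le> \<bar>s\<bar>" using s(1) assms(5) by (intro zdvd_imp_le) auto
        then show False using M(2)[OF s(1)] r[OF True] by linarith
      qed
      then have "power_residue q (r p) (int (monomial ps (vec s)))"
        using residue_iff[of s "r p"] s(1) r[OF True] res by blast
      then show ?thesis using r[OF True] vecs by blast
    next
      case False
      then have "int q dvd b p i" if "i < n" for i using p that by (auto simp: P1_def)
      then show ?thesis unfolding form_def by (intro dvd_sum) auto
    qed
    obtain t c where t: "t \<in> T" "vec t = mat_vec n q A (scale_vec n q c (vec s))" using image[OF s(1)] by blast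
    have at: "int q dvd form n (a p) (vec t)" if "p \<in> P" for p
      using form_mat_vec[OF q, of n "a p" A c "vec s"] bs[OF that] unfolding t(2) b_def by (simp add: cong_dvd_iff)
    have "power_residue q N t"
    proof (rule power_residue_composite[OF N(1)])
      fix p j assume p: "prime p" "p dvd N"
      have o: "p \<noteq> q" "\<not> int p dvd t" using outside[OF p] t(1) by auto
      have "power_residue q p t"
      proof (cases "q dvd p - 1")
        case True
        then have "p \<in> P" using p by (simp add: P_def)
        then have "power_residue q p (int (monomial ps (vec t)))" using a at vecs by blast
        then show ?thesis using residue_iff[of t p] t(1) p(1) o(2) by blast
      next
        case False
        then show ?thesis by (rule power_residue_trivial[OF p(1) q _ o(2)])
      qed
      then show "power_residue q (p ^ j) t" by (rule power_residue_prime_power[OF p(1) o(1) q o(2)])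
    qed
    then show ?thesis using t(1) by (auto simp: contains_power_mod_def power_residue_def)
  qed
  then show ?thesis using T(1) \<Delta>'0 by (auto simp: power_sets_def contains_power_mod_almost_all_def)
qed

end
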